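(* For Lebesgue-almost every $\alpha\in\mathbb{T}$ the following holds: for every point $x_0\in\mathbb{T}$ and every function $\varphi:\mathbb{T}\to\mathbb{R}$ that is of class $C^2$ on $\mathbb{T}\setminus\{x_0\}$, has a logarithmic singularity at $x_0$, and satisfies $\int_{\mathbb{T}}\varphi\,d\mu=0$, the cylindrical transformation $$S_{\alpha,\varphi}:\mathbb{T}\times\mathbb{R}\to\mathbb{T}\times\mathbb{R},\qquad S_{\alpha,\varphi}(x,y)=(x+\alpha,\ \varphi(x)+y)$$ is ergodic with respect to $\mu\otimes\lambda$.
   Context: $\mathbb{T}=\mathbb{R}/\mathbb{Z}$ is the additive circle, $\mu$ is Lebesgue (Haar probability) measure on $\mathbb{T}$, and $\lambda$ is Lebesgue measure on $\mathbb{R}$. A real function $\varphi$ defined over $\mathbb{T}$ has a logarithmic singularity at a point $x_0$ if $\varphi$ is of class $C^2$ on $\mathbb{T}\setminus\{x_0\}$ and there exist $A,B\in\mathbb{R}\setminus\{0\}$ such that $$\lim_{x\to x_0^-}\varphi''(x)(x-x_0)^2=A,\qquad \lim_{x\to x_0^+}\varphi''(x)(x-x_0)^2=B.$$ Such a function is integrable, so its average $\int_{\mathbb{T}}\varphi\,d\mu$ makes sense. The value of $\varphi$ at the single point $x_0$ is irrelevant. Ergodicity with respect to the infinite invariant measure $\mu\otimes\lambda$ means that every measurable invariant set either has measure zero or has complement of measure zero. *)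

theory Defs
  imports "HOL-Analysis.Analysis"
begin

text \<open>
  The circle \<open>\<real>/\<int>\<close> is represented by its fundamental domain \<open>[0,1)\<close>, with addition
  \<open>frac (x + y)\<close>. Functions on the circle are 1-periodic functions on the reals, so that smoothness
  at \<open>0 = 1\<close> is the ordinary smoothness of the periodic function. A point of the circle may be given
  by any real representative.
\<close>

definition circle :: "real measure" where
  "circle = restrict_space lborel {0..<1}"

text \<open>Only used for open \<open>S\<close>: \<^term>\<open>deriv\<close> is the two-sided derivative.\<close>

definition C2_on :: "(real \<Rightarrow> real) \<Rightarrow> real set \<Rightarrow> bool" where
  "C2_on f S \<longleftrightarrow>
     (\<forall>x\<in>S. f differentiable (at x)) \<and>
     (\<forall>x\<in>S. deriv f differentiable (at x)) \<and>
     continuous_on S (deriv (deriv f))"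

text \<open>
  The set \<open>{x. x - x0 \<notin> \<int>}\<close> consists of all real representatives of circle points other than
  \<open>x0\<close>. Nothing is required of \<open>\<phi>\<close> at \<open>x0\<close> itself beyond periodicity.
\<close>

definition log_singularity :: "(real \<Rightarrow> real) \<Rightarrow> real \<Rightarrow> bool" where
  "log_singularity \<phi> x0 \<longleftrightarrow>
     (\<forall>x. \<phi> (x + 1) = \<phi> x) \<and>
     C2_on \<phi> {x. x - x0 \<notin> \<int>} \<and>
     (\<exists>A B. A \<noteq> 0 \<and> B \<noteq> 0 \<and>
        ((\<lambda>x. deriv (deriv \<phi>) x * (x - x0)\<^sup>2) \<longlongrightarrow> A) (at_left x0) \<and>
        ((\<lambda>x. deriv (deriv \<phi>) x * (x - x0)\<^sup>2) \<longlongrightarrow> B) (at_right x0))"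

definition cylinder_map :: "real \<Rightarrow> (real \<Rightarrow> real) \<Rightarrow> real \<times> real \<Rightarrow> real \<times> real" where
  "cylinder_map \<alpha> \<phi> = (\<lambda>(x, y). (frac (x + \<alpha>), \<phi> x + y))"

text \<open>The measure may be infinite, so the complement is required to be null explicitly.\<close>

definition ergodic :: "'a measure \<Rightarrow> ('a \<Rightarrow> 'a) \<Rightarrow> bool" where
  "ergodic M T \<longleftrightarrow>
     (\<forall>E\<in>sets M. T -` E \<inter> space M = E \<longrightarrow> emeasure M E = 0 \<or> emeasure M (space M - E) = 0)"

end

theory Submission
  imports Defs
begin

text \<open>
  The proof shows that every \<open>a\<close> of one sign is an essential value of the cocycle, along times \<open>N\<close>
  with \<open>\<alpha> = p / N + \<theta> / N\<close> and \<open>\<bar>\<theta>\<bar> < \<eta> / N\<close>. For such \<open>N\<close> the Birkhoff sum \<open>\<phi>\<^sub>N\<close> differs by \<open>O(\<eta>)\<close>,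
  away from its singularities, from a translate of the lattice sum \<open>\<Sum>i<N. \<phi> (x + i / N)\<close>, provided
  \<open>p / N\<close> satisfies a mild Diophantine condition. The lattice sum is \<open>1 / N\<close>-periodic with
  mean zero on every period and derivative \<open>O(N ln N)\<close>, so it takes the value \<open>a\<close> in every period, and
  \<open>\<bar>\<phi>\<^sub>N - a\<bar> < \<epsilon>\<close> holds on a \<open>1 / N\<close>-periodic union of intervals (a comb) of density
  \<open>c / ln N\<close>. The asymmetric and the symmetric case need no separate treatment.

  For almost every \<open>\<alpha>\<close> there are such times \<open>N\<^sub>k\<close>, of order \<open>(k!)\<^sup>2\<close>, for a set of indices \<open>k\<close> with
  \<open>\<Sum> 1 / ln N\<^sub>k = \<infinity>\<close>, since at each scale they exist with probability bounded below in every interval.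
  The combs are quasi-independent, and a Borel--Cantelli type second moment estimate gives, for every
  \<open>A\<close> of positive measure, some \<open>k\<close> and \<open>x \<in> A\<close> with \<open>x + N\<^sub>k \<alpha> \<in> A\<close> and the Birkhoff sum at \<open>x\<close> close to \<open>a\<close>.
\<close>

section \<open>Density points and combs\<close>

text \<open>The obstacle is a logarithm. The drift of the orbit against the lattice gives a first
  order term \<theta> \<Sum> s i * f' (t i) with |s i| \<le> 1/2. Since f' has size N / m at m cells
  from the singularity, bounding it termwise yields only \<eta> ln N. Cancellation among the
  sawtooth weights s i brings it down to O(\<eta>), and the Diophantine condition on p / N exists
  for that purpose. The slope of the lattice sum keeps its logarithm, and this fixes the density of
  the combs. The quality \<eta> depends on the function and on the precision asked for, while the
  exceptional null set of rotation numbers may not; countably many values of \<eta> are therefore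
  treated in advance. One sign of a is enough: if the mass of the sections is invariant under
  translation by a, it is invariant under translation by -a.\<close>

lemma emeasure_UN_le_nn_integral:
  assumes sets [measurable]: "\<And>i. i \<in> I \<Longrightarrow> X i \<in> sets M" and I [simp]: "countable I"
  shows "emeasure M (\<Union>i\<in>I. X i) \<le> (\<integral>\<^sup>+i. emeasure M (X i) \<partial>count_space I)"
proof -
  have sm: "(\<Union>i\<in>I. X i) \<in> sets M"
    using sets by (intro sets.countable_UN'[OF I]) auto
  have le: "indicator (\<Union>i\<in>I. X i) x \<le> (\<integral>\<^sup>+i. indicator (X i) x \<partial>count_space I)" for x
  proof (cases "x \<in> (\<Union>i\<in>I. X i)")
    case True
    then obtain j where j: "x \<in> X j" "j \<in> I" by auto
    have "(indicator (X j) x :: ennreal) \<le> (\<integral>\<^sup>+i. indicator (X i) x \<partial>count_space I)"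
      by (rule nn_integral_ge_point[OF j(2)])
    then show ?thesis using j True by simp
  qed simp
  have "emeasure M (\<Union>i\<in>I. X i) = (\<integral>\<^sup>+x. indicator (\<Union>i\<in>I. X i) x \<partial>M)"
    using sm by simp
  also have "\<dots> \<le> (\<integral>\<^sup>+x. \<integral>\<^sup>+i. indicator (X i) x \<partial>count_space I \<partial>M)"
    by (intro nn_integral_mono le)
  also have "\<dots> = (\<integral>\<^sup>+i. \<integral>\<^sup>+x. indicator (X i) x \<partial>M \<partial>count_space I)"
    by (subst nn_integral_count_space_nn_integral) auto
  also have "\<dots> = (\<integral>\<^sup>+i. emeasure M (X i) \<partial>count_space I)"
    by (auto intro!: nn_integral_cong)
  finally show ?thesis .
qed

text \<open>A covering argument in place of the density theorem. If every interval met
  \<open>A\<close> in proportion below \<open>1 - \<delta>\<close>, cover a bounded piece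
  \<open>S\<close> of \<open>A\<close> by non-overlapping intervals inside an open \<open>U\<close>
  with |U| \<le> (1 + \<delta>) |S|; then |S| \<le> (1 - \<delta>) (1 + \<delta>) |S| < |S|.\<close>

lemma exists_interval_of_high_density:
  fixes A :: "real set" and \<delta> :: real
  assumes A: "A \<in> sets lborel" and pos: "emeasure lborel A \<noteq> 0" and \<delta>: "0 < \<delta>" "\<delta> < 1"
  shows "\<exists>u v. u < v \<and> measure lborel (A \<inter> {u..v}) \<ge> (1 - \<delta>) * (v - u)"
proof (rule ccontr)
  assume "\<not> ?thesis"
  then have less: "measure lborel (A \<inter> {u..v}) < (1 - \<delta>) * (v - u)" if "u < v" for u v
    using that by force
  have "\<exists>n::nat. emeasure lborel (A \<inter> {- real n..real n}) \<noteq> 0"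
  proof (rule ccontr)
    assume "\<not> (\<exists>n::nat. emeasure lborel (A \<inter> {- real n..real n}) \<noteq> 0)"
    then have "(\<Union>n. A \<inter> {- real n..real n}) \<in> null_sets lborel"
      using A by (intro null_sets_UN) (auto simp: null_sets_def)
    moreover have "(\<Union>n. A \<inter> {- real n..real n}) = A"
    proof -
      have "\<exists>n. - real n \<le> x \<and> x \<le> real n" for x :: real
        by (rule exI[of _ "nat \<lceil>\<bar>x\<bar>\<rceil>"]) linarith
      then show ?thesis by auto
    qed
    ultimately show False using pos by auto
  qed
  then obtain n :: nat where n: "emeasure lborel (A \<inter> {- real n..real n}) \<noteq> 0" by blast
  define S where "S = A \<inter> {- real n..real n}"
  have S: "S \<in> sets borel" using A by (auto simp: S_def)
  have n0: "n > 0"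
  proof (rule ccontr)
    assume "\<not> n > 0"
    then have "S \<subseteq> {0}" by (auto simp: S_def)
    then have "emeasure lborel S \<le> emeasure lborel {0::real}"
      by (rule emeasure_mono) simp
    then show False using n by (simp add: S_def)
  qed
  have Sfin: "emeasure lborel S < \<infinity>"
  proof -
    have "emeasure lborel S \<le> emeasure lborel {- real n..real n}"
      by (intro emeasure_mono) (auto simp: S_def)
    also have "\<dots> < \<infinity>" by simp
    finally show ?thesis .
  qed
  define s where "s = measure lborel S"
  have es: "emeasure lborel S = ennreal s"
    using Sfin by (simp add: s_def emeasure_eq_ennreal_measure)
  have s0: "s > 0"
    using n es unfolding S_def[symmetric] by (metis ennreal_eq_0_iff not_less)
  obtain U where U: "open U" "S \<subseteq> U" and Um: "emeasure lborel (U - S) < ennreal (\<delta> * s)"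
    using outer_regular_lborel[OF S, of "\<delta> * s"] \<delta> s0 by auto
  \<comment> \<open>Every interval of the cover is tagged by a point of \<open>S\<close>, where the
    gauge is \<open>U\<close>; so all intervals lie in \<open>U\<close>.\<close>
  define g where "g = (\<lambda>x. if x \<in> S then U else UNIV)"
  have gauge: "gauge g"
    using U by (auto simp: gauge_def g_def)
  have cb: "S \<subseteq> cbox (- real n) (real n)" "box (- real n) (real n) \<noteq> {}"
    using n0 by (auto simp: S_def)
  obtain \<D> where D: "countable \<D>"
    "\<And>K. K \<in> \<D> \<Longrightarrow> interior K \<noteq> {} \<and> (\<exists>c d. K = cbox c d)"
    "pairwise (\<lambda>A B. interior A \<inter> interior B = {}) \<D>"
    "\<And>K. K \<in> \<D> \<Longrightarrow> \<exists>x \<in> S \<inter> K. K \<subseteq> g x"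
    "S \<subseteq> \<Union>\<D>"
    using covering_lemma[OF cb gauge] by metis
  have KU: "K \<subseteq> U" if "K \<in> \<D>" for K
    using D(4)[OF that] by (auto simp: g_def)
  have Kform: "\<exists>c d. c < d \<and> K = {c..d}" if "K \<in> \<D>" for K
  proof -
    note K = D(2)[OF that]
    then obtain c d where "K = cbox c d" "interior K \<noteq> {}" by blast
    moreover from this have "c < d" by (simp add: box_real)
    ultimately show ?thesis unfolding box_real by blast
  qed
  have K1: "emeasure lborel (S \<inter> K) \<le> ennreal (1 - \<delta>) * emeasure lborel (interior K)" if KD: "K \<in> \<D>" for K
  proof -
    obtain c d where cd: "c < d" "K = {c..d}" using Kform[OF KD] by blast
    have "emeasure lborel (S \<inter> K) \<le> emeasure lborel (A \<inter> K)"
      using A cd by (intro emeasure_mono) (auto simp: S_def)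
    also have "\<dots> = ennreal (measure lborel (A \<inter> K))"
    proof (rule emeasure_eq_ennreal_measure)
      have "emeasure lborel (A \<inter> K) \<le> emeasure lborel {c..d}"
        using cd by (intro emeasure_mono) auto
      also have "\<dots> < top" using cd by (simp add: less_top)
      finally show "emeasure lborel (A \<inter> K) \<noteq> top" by simp
    qed
    also have "\<dots> \<le> ennreal ((1 - \<delta>) * (d - c))"
      using less[of c d] cd by (intro ennreal_leI) auto
    also have "\<dots> = ennreal (1 - \<delta>) * emeasure lborel (interior K)"
      using \<delta> cd by (simp add: ennreal_mult)
    finally show ?thesis .
  qed
  have KS: "S \<inter> K \<in> sets lborel" if KD: "K \<in> \<D>" for K
  proof -
    obtain c d where "K = {c..d}" using Kform[OF KD] by blast
    then show ?thesis using S by simp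
  qed
  have "S = (\<Union>K\<in>\<D>. S \<inter> K)" using D(5) by blast
  then have "emeasure lborel S = emeasure lborel (\<Union>K\<in>\<D>. S \<inter> K)" by (rule arg_cong)
  also have "\<dots> \<le> (\<integral>\<^sup>+K. emeasure lborel (S \<inter> K) \<partial>count_space \<D>)"
    using KS D(1) by (rule emeasure_UN_le_nn_integral)
  also have "\<dots> \<le> (\<integral>\<^sup>+K. ennreal (1 - \<delta>) * emeasure lborel (interior K) \<partial>count_space \<D>)"
    using K1 by (intro nn_integral_mono) simp
  also have "\<dots> = ennreal (1 - \<delta>) * (\<integral>\<^sup>+K. emeasure lborel (interior K) \<partial>count_space \<D>)"
    by (rule nn_integral_cmult) simp
  also have "(\<integral>\<^sup>+K. emeasure lborel (interior K) \<partial>count_space \<D>) = emeasure lborel (\<Union>K\<in>\<D>. interior K)"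
    using D(1,3) by (intro emeasure_UN_countable[symmetric]) (auto simp: disjoint_family_on_def pairwise_def)
  also have "\<dots> \<le> emeasure lborel U"
    using KU U(1) interior_subset by (intro emeasure_mono) (blast, simp)
  also have "emeasure lborel U = emeasure lborel (S \<union> (U - S))"
    using U by (metis Un_Diff_cancel Un_absorb1)
  also have "\<dots> \<le> emeasure lborel S + emeasure lborel (U - S)"
    using S U by (intro emeasure_subadditive) auto
  also have "\<dots> \<le> ennreal s + ennreal (\<delta> * s)"
    using Um es by (intro add_mono) auto
  also have "\<dots> = ennreal (s + \<delta> * s)"
    using s0 \<delta> by simp
  finally have "ennreal s \<le> ennreal ((1 - \<delta>) * (s + \<delta> * s))"
    using es \<delta> s0 by (simp add: ennreal_mult mult_left_mono)
  then have "s \<le> (1 - \<delta>) * (s + \<delta> * s)"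
    using s0 \<delta> by (subst (asm) ennreal_le_iff) auto
  also have "\<dots> = s - \<delta>\<^sup>2 * s" by (simp add: algebra_simps power2_eq_square)
  also have "\<dots> < s" using s0 \<delta> by simp
  finally show False by simp
qed

text \<open>Teeth of half-width \<open>\<rho> / N\<close> around the points (b + i) / N. Measuring
  \<open>b\<close> and \<open>\<rho>\<close> in units of the spacing makes the density
  \<open>2 * \<rho>\<close> for every \<open>N\<close>; a translation by t becomes a change of
  \<open>b\<close> by N t.\<close>

definition comb :: "real \<Rightarrow> real \<Rightarrow> real \<Rightarrow> real set" where
  "comb N b \<rho> = {x. \<exists>i::int. \<bar>N * x - b - of_int i\<bar> < \<rho>}"

lemma comb_measurable [measurable]: "comb N b \<rho> \<in> sets borel"
proof -
  have "comb N b \<rho> = (\<Union>i::int. {x. \<bar>N * x - b - of_int i\<bar> < \<rho>})"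
    by (auto simp: comb_def)
  also have "\<dots> \<in> sets borel" by measurable
  finally show ?thesis .
qed

lemma comb_interval_cover:
  assumes N: "N > 0" and \<rho>: "\<rho> \<le> 1/2" and uv: "u \<le> v"
  obtains I :: "int set" where "finite I" "real (card I) \<le> N * (v - u) + 2"
    "comb N b \<rho> \<inter> {u..v} \<subseteq> (\<Union>i\<in>I. {(b + of_int i - \<rho>) / N .. (b + of_int i + \<rho>) / N})"
proof
  \<comment> \<open>Half a period of margin at each end is at least the half-width
    \<open>\<rho>\<close>, so no tooth meeting the interval is missed.\<close>
  define I where "I = {\<lceil>N * u - b - 1/2\<rceil>..\<lfloor>N * v - b + 1/2\<rfloor>}"
  show "finite I" by (simp add: I_def)
  have "N * (v - u) \<ge> 0" using N uv by simp
  then have "real_of_int (\<lfloor>N * v - b + 1/2\<rfloor> - \<lceil>N * u - b - 1/2\<rceil> + 1) \<le> N * (v - u) + 2"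
    unfolding right_diff_distrib by linarith
  then show "real (card I) \<le> N * (v - u) + 2"
    using \<open>N * (v - u) \<ge> 0\<close> by (auto simp: I_def)
  show "comb N b \<rho> \<inter> {u..v} \<subseteq> (\<Union>i\<in>I. {(b + of_int i - \<rho>) / N .. (b + of_int i + \<rho>) / N})"
  proof
    fix x assume x: "x \<in> comb N b \<rho> \<inter> {u..v}"
    then obtain i :: int where i: "\<bar>N * x - b - of_int i\<bar> < \<rho>" by (auto simp: comb_def)
    have "N * u \<le> N * x" "N * x \<le> N * v" using x N by auto
    then have "i \<in> I" using i \<rho> unfolding I_def atLeastAtMost_iff ceiling_le_iff le_floor_iff
      by linarith
    moreover have "x \<in> {(b + of_int i - \<rho>) / N .. (b + of_int i + \<rho>) / N}"
      using i N by (auto simp: field_simps abs_less_iff)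
    ultimately show "x \<in> (\<Union>i\<in>I. {(b + of_int i - \<rho>) / N .. (b + of_int i + \<rho>) / N})" by blast
  qed
qed

lemma fmeasurable_interval: "{u..v::real} \<in> fmeasurable lborel"
  by (simp add: fmeasurable_def emeasure_lborel_Icc_eq)

lemma fmeasurable_Int_interval: "B \<in> sets borel \<Longrightarrow> B \<inter> {u..v::real} \<in> fmeasurable lborel"
  using fmeasurable_Int_fmeasurable[OF fmeasurable_interval, of B u v] by (simp add: Int_commute)

lemma measure_comb_le:
  assumes N: "N > 0" and \<rho>: "0 \<le> \<rho>" "\<rho> \<le> 1/2" and uv: "u \<le> v"
  shows "measure lborel (comb N b \<rho> \<inter> {u..v}) \<le> (N * (v - u) + 2) * (2 * \<rho> / N)"
proof -
  obtain I :: "int set" where I: "finite I" "real (card I) \<le> N * (v - u) + 2"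
    "comb N b \<rho> \<inter> {u..v} \<subseteq> (\<Union>i\<in>I. {(b + of_int i - \<rho>) / N .. (b + of_int i + \<rho>) / N})"
    using comb_interval_cover[OF N \<rho>(2) uv] .
  have "measure lborel (comb N b \<rho> \<inter> {u..v})
      \<le> measure lborel (\<Union>i\<in>I. {(b + of_int i - \<rho>) / N .. (b + of_int i + \<rho>) / N})"
    using I by (intro measure_mono_fmeasurable fmeasurable.finite_UN fmeasurable_interval) auto
  also have "\<dots> \<le> (\<Sum>i\<in>I. measure lborel {(b + of_int i - \<rho>) / N .. (b + of_int i + \<rho>) / N})"
    using I by (intro measure_UNION_le) auto
  also have "\<dots> = (\<Sum>i\<in>I. 2 * \<rho> / N)"
    using N \<rho> by (intro sum.cong) (auto simp: field_simps)
  also have "\<dots> = real (card I) * (2 * \<rho> / N)" by simp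
  also have "\<dots> \<le> (N * (v - u) + 2) * (2 * \<rho> / N)"
    using I N \<rho> by (intro mult_right_mono) auto
  finally show ?thesis .
qed

lemma measure_comb_ge:
  assumes N: "N > 0" and \<rho>: "0 \<le> \<rho>" "\<rho> \<le> 1/2" and uv: "u \<le> v"
  shows "(N * (v - u) - 2) * (2 * \<rho> / N) \<le> measure lborel (comb N b \<rho> \<inter> {u..v})"
proof -
  define I where "I = {\<lceil>N * u - b + 1/2\<rceil>..\<lfloor>N * v - b - 1/2\<rfloor>}"
  let ?J = "\<lambda>i::int. {(b + of_int i - \<rho>) / N <..< (b + of_int i + \<rho>) / N}"
  have sub: "(\<Union>i\<in>I. ?J i) \<subseteq> comb N b \<rho> \<inter> {u..v}"
  proof
    fix x assume "x \<in> (\<Union>i\<in>I. ?J i)"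
    then obtain i where i: "i \<in> I" "x \<in> ?J i" by blast
    have a: "\<bar>N * x - b - of_int i\<bar> < \<rho>" using i N by (auto simp: field_simps abs_less_iff)
    have "N * u \<le> N * x" "N * x \<le> N * v" using i(1) a \<rho>
      unfolding I_def atLeastAtMost_iff ceiling_le_iff le_floor_iff by linarith+
    then show "x \<in> comb N b \<rho> \<inter> {u..v}" using a N by (auto simp: comb_def)
  qed
  have disj: "disjoint_family_on ?J I"
    unfolding disjoint_family_on_def
  proof (intro ballI impI)
    fix i j assume "i \<in> I" "j \<in> I" "i \<noteq> j"
    have "False" if x: "x \<in> ?J i" "x \<in> ?J j" for x
    proof -
      have "\<bar>N * x - b - of_int i\<bar> < \<rho>" "\<bar>N * x - b - of_int j\<bar> < \<rho>"
        using x N by (auto simp: field_simps abs_less_iff)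
      then have "\<bar>real_of_int i - of_int j\<bar> < 1" using \<rho> by linarith
      then show False using \<open>i \<noteq> j\<close> by linarith
    qed
    then show "?J i \<inter> ?J j = {}" by blast
  qed
  have "real_of_int (\<lfloor>N * v - b - 1/2\<rfloor> - \<lceil>N * u - b + 1/2\<rceil> + 1) \<ge> N * (v - u) - 2"
    unfolding right_diff_distrib by linarith
  then have "N * (v - u) - 2 \<le> real (card I)"
    unfolding I_def by simp
  then have "(N * (v - u) - 2) * (2 * \<rho> / N) \<le> real (card I) * (2 * \<rho> / N)"
    using N \<rho> by (intro mult_right_mono) auto
  also have "\<dots> = (\<Sum>i\<in>I. 2 * \<rho> / N)" by simp
  also have "\<dots> = (\<Sum>i\<in>I. measure lborel (?J i))"
    using N \<rho> by (intro sum.cong) (auto simp: field_simps)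
  also have "\<dots> = measure lborel (\<Union>i\<in>I. ?J i)"
    using disj N \<rho> by (intro measure_finite_Union[symmetric]) (auto simp: I_def field_simps)
  also have "\<dots> \<le> measure lborel (comb N b \<rho> \<inter> {u..v})"
    using sub by (intro measure_mono_fmeasurable fmeasurable_Int_interval) auto
  finally show ?thesis .
qed

text \<open>Quasi-independence: by \<open>sep\<close>, a tooth of the coarse comb is at least two
  periods of the fine comb long, so the fine comb fills it in the right proportion up to a factor 2.
  By \<open>big\<close>, the boundary teeth of the coarse comb cost another factor 2; hence 16 in
  place of 4.\<close>

lemma measure_comb_Int_comb_le:
  assumes N: "N > 0" and \<rho>: "0 \<le> \<rho>" "\<rho> \<le> 1/2" and uv: "u \<le> v"
    and N': "N' > 0" and \<rho>': "0 \<le> \<rho>'" "\<rho>' \<le> 1/2"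
    and big: "2 \<le> N * (v - u)" and sep: "N \<le> \<rho> * N'"
  shows "measure lborel (comb N b \<rho> \<inter> comb N' b' \<rho>' \<inter> {u..v}) \<le> 16 * (v - u) * \<rho> * \<rho>'"
proof -
  obtain I :: "int set" where I: "finite I" "real (card I) \<le> N * (v - u) + 2"
    "comb N b \<rho> \<inter> {u..v} \<subseteq> (\<Union>i\<in>I. {(b + of_int i - \<rho>) / N .. (b + of_int i + \<rho>) / N})"
    using comb_interval_cover[OF N \<rho>(2) uv] .
  let ?J = "\<lambda>i::int. {(b + of_int i - \<rho>) / N .. (b + of_int i + \<rho>) / N}"
  have "measure lborel (comb N b \<rho> \<inter> comb N' b' \<rho>' \<inter> {u..v})
      \<le> measure lborel (\<Union>i\<in>I. comb N' b' \<rho>' \<inter> ?J i)"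
    using I by (intro measure_mono_fmeasurable fmeasurable.finite_UN fmeasurable_Int_interval) auto
  also have "\<dots> \<le> (\<Sum>i\<in>I. measure lborel (comb N' b' \<rho>' \<inter> ?J i))"
    using I by (intro measure_UNION_le fmeasurable_Int_interval) auto
  also have "\<dots> \<le> (\<Sum>i\<in>I. 8 * \<rho> / N * \<rho>')"
  proof (intro sum_mono)
    fix i assume "i \<in> I"
    have le: "(b + of_int i - \<rho>) / N \<le> (b + of_int i + \<rho>) / N"
      using N \<rho> by (auto simp: field_simps)
    have eq: "(b + of_int i + \<rho>) / N - (b + of_int i - \<rho>) / N = 2 * \<rho> / N"
      using N by (simp add: field_simps)
    have "measure lborel (comb N' b' \<rho>' \<inter> ?J i) \<le> (N' * (2 * \<rho> / N) + 2) * (2 * \<rho>' / N')"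
      using measure_comb_le[OF N' \<rho>' le, of b'] unfolding eq .
    also have "\<dots> = (4 * \<rho> / N + 4 / N') * \<rho>'" using N N' by (simp add: field_simps)
    also have "\<dots> \<le> (8 * \<rho> / N) * \<rho>'"
    proof (intro mult_right_mono)
      have "1 / N' \<le> \<rho> / N" using sep N N' by (simp add: field_simps)
      then have "4 * (1 / N') \<le> 4 * (\<rho> / N)" by simp
      then show "4 * \<rho> / N + 4 / N' \<le> 8 * \<rho> / N" by simp
    qed (use \<rho>' in auto)
    finally show "measure lborel (comb N' b' \<rho>' \<inter> ?J i) \<le> 8 * \<rho> / N * \<rho>'" .
  qed
  also have "\<dots> = real (card I) * (8 * \<rho> / N * \<rho>')" by simp
  also have "\<dots> \<le> (2 * N * (v - u)) * (8 * \<rho> / N * \<rho>')"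
    using I big \<rho> \<rho>' N by (intro mult_right_mono) auto
  also have "\<dots> = 16 * (v - u) * \<rho> * \<rho>'" using N by simp
  finally show ?thesis .
qed

text \<open>With \<open>Z\<close> the number of sets \<open>B k\<close> containing a point, this is
  2 t Z \<le> Z^2 + t^2 integrated over \<open>D\<close>. The free parameter \<open>t\<close>
  replaces the square root of Cauchy--Schwarz.\<close>

lemma sum_measure_le_second_moment:
  fixes B :: "'i \<Rightarrow> 'a set"
  assumes T: "finite T" and D: "D \<in> fmeasurable M" and B: "\<And>k. k \<in> T \<Longrightarrow> B k \<in> sets M"
  shows "2 * t * (\<Sum>k\<in>T. measure M (B k \<inter> D))
    \<le> (\<Sum>k\<in>T. \<Sum>l\<in>T. measure M (B k \<inter> B l \<inter> D)) + t\<^sup>2 * measure M D"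
proof -
  have fm: "B k \<inter> D \<in> fmeasurable M" "B k \<inter> B l \<inter> D \<in> fmeasurable M" if "k \<in> T" "l \<in> T" for k l
    using fmeasurable_Int_fmeasurable[OF D B[OF that(1)]] fmeasurable_Int_fmeasurable[OF D sets.Int[OF B[OF that(1)] B[OF that(2)]]]
    by (simp_all only: Int_commute[of D])
  let ?i = "indicat_real"
  have int: "integrable M (?i (B k \<inter> D))" "integrable M (?i (B k \<inter> B l \<inter> D))" "integrable M (?i D)"
     if "k \<in> T" "l \<in> T" for k l
    using fm[OF that] D by (auto simp: fmeasurable_def intro!: integrable_real_indicator)
  have Di: "integrable M (?i D)" using D by (auto simp: fmeasurable_def)
  have eq: "(\<integral>x. ?i X x \<partial>M) = measure M X" if "X \<in> fmeasurable M" for X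
    using that by (simp add: fmeasurable_def Int_absorb2 sets.sets_into_space)
  have "0 \<le> (\<integral>x. (\<Sum>k\<in>T. \<Sum>l\<in>T. ?i (B k \<inter> B l \<inter> D) x) + t\<^sup>2 * ?i D x - 2 * t * (\<Sum>k\<in>T. ?i (B k \<inter> D) x) \<partial>M)"
  proof (intro Bochner_Integration.integral_nonneg)
    fix x
    define Z where "Z = (\<Sum>k\<in>T. ?i (B k) x)"
    have "(\<Sum>k\<in>T. \<Sum>l\<in>T. ?i (B k \<inter> B l \<inter> D) x) = ?i D x * Z\<^sup>2"
      unfolding Z_def power2_eq_square
      by (simp add: sum_product sum_distrib_left sum_distrib_right indicator_inter_arith mult_ac)
    moreover have "(\<Sum>k\<in>T. ?i (B k \<inter> D) x) = ?i D x * Z"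
      unfolding Z_def by (simp add: sum_distrib_left indicator_inter_arith mult_ac)
    ultimately have "(\<Sum>k\<in>T. \<Sum>l\<in>T. ?i (B k \<inter> B l \<inter> D) x) + t\<^sup>2 * ?i D x - 2 * t * (\<Sum>k\<in>T. ?i (B k \<inter> D) x)
        = ?i D x * (Z - t)\<^sup>2"
      by (simp add: power2_eq_square algebra_simps)
    then show "0 \<le> (\<Sum>k\<in>T. \<Sum>l\<in>T. ?i (B k \<inter> B l \<inter> D) x) + t\<^sup>2 * ?i D x - 2 * t * (\<Sum>k\<in>T. ?i (B k \<inter> D) x)"
      by simp
  qed
  also have "\<dots> = (\<Sum>k\<in>T. \<Sum>l\<in>T. measure M (B k \<inter> B l \<inter> D)) + t\<^sup>2 * measure M D
      - 2 * t * (\<Sum>k\<in>T. measure M (B k \<inter> D))"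
  proof -
    have "(\<integral>x. (\<Sum>k\<in>T. \<Sum>l\<in>T. ?i (B k \<inter> B l \<inter> D) x) + t\<^sup>2 * ?i D x - 2 * t * (\<Sum>k\<in>T. ?i (B k \<inter> D) x) \<partial>M)
      = (\<Sum>k\<in>T. \<Sum>l\<in>T. (\<integral>x. ?i (B k \<inter> B l \<inter> D) x \<partial>M)) + t\<^sup>2 * (\<integral>x. ?i D x \<partial>M) - 2 * t * (\<Sum>k\<in>T. (\<integral>x. ?i (B k \<inter> D) x \<partial>M))"
      using int Di by simp
    then show ?thesis
      using fm D by (simp add: eq cong: sum.cong)
  qed
  finally show ?thesis by simp
qed

lemma finite_subset_sum_gt:
  fixes \<rho> :: "nat \<Rightarrow> real"
  assumes nonneg: "\<And>k. k \<in> S \<Longrightarrow> 0 \<le> \<rho> k" and div: "\<not> summable (\<lambda>k. if k \<in> S then \<rho> k else 0)"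
  obtains T where "finite T" "T \<subseteq> S" "\<And>k. k \<in> T \<Longrightarrow> k0 \<le> k" "C < (\<Sum>k\<in>T. \<rho> k)"
proof -
  let ?g = "\<lambda>k. if k \<in> S \<and> k0 \<le> k then \<rho> k else 0"
  have "\<not> summable ?g"
  proof
    assume g: "summable ?g"
    have "\<forall>\<^sub>F k in sequentially. (if k \<in> S then \<rho> k else 0) = ?g k"
      using eventually_ge_at_top[of k0] by eventually_elim auto
    from summable_cong[OF this] g div show False by simp
  qed
  then have "\<exists>n. C < (\<Sum>k<n. ?g k)"
  proof (rule contrapos_np)
    assume "\<nexists>n. C < (\<Sum>k<n. ?g k)"
    then have "(\<Sum>k<n. ?g k) \<le> C" for n by (meson not_le)
    then show "summable ?g"
      using nonneg by (intro summableI_nonneg_bounded) simp_all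
  qed
  then obtain n where n: "C < (\<Sum>k<n. ?g k)" by blast
  let ?T = "{k \<in> {..<n}. k \<in> S \<and> k0 \<le> k}"
  have "(\<Sum>k<n. ?g k) = (\<Sum>k\<in>?T. \<rho> k)"
    by (rule sum.inter_filter[symmetric]) simp
  then show ?thesis using n by (intro that[of ?T]) auto
qed

text \<open>
  A second moment argument: on an interval \<open>J\<close> where \<open>A\<close> has density close to 1, both
  \<open>Z = (\<Sum>k. 1 (comb k))\<close> and its analogue for the shifted combs satisfy
  \<open>\<integral> Z\<^sup>2 \<le> C (\<integral> Z)\<^sup>2\<close>, so neither can put more than a small proportion of its mass on
  \<open>J - A\<close>. No relation between the sizes of \<open>\<theta> k\<close> and of the teeth of the comb is needed.
\<close>

lemma comb_recurrence:
  fixes N b \<rho> \<theta> :: "nat \<Rightarrow> real"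
  assumes N: "\<And>k. k \<in> S \<Longrightarrow> 0 < N k" and \<rho>: "\<And>k. k \<in> S \<Longrightarrow> 0 < \<rho> k" "\<And>k. k \<in> S \<Longrightarrow> \<rho> k \<le> 1/2"
    and \<theta>: "\<And>k. k \<in> S \<Longrightarrow> \<bar>\<theta> k\<bar> \<le> 1 / N k"
    and sep: "\<And>l k. \<lbrakk>l \<in> S; k \<in> S; l < k\<rbrakk> \<Longrightarrow> N l \<le> \<rho> l * N k"
    and unb: "\<And>C. \<forall>\<^sub>F k in sequentially. k \<in> S \<longrightarrow> C \<le> N k"
    and div: "\<not> summable (\<lambda>k. if k \<in> S then \<rho> k else 0)"
    and A: "A \<in> sets lborel" "emeasure lborel A \<noteq> 0"
  shows "\<exists>k\<in>S. \<exists>x\<in>A. x \<in> comb (N k) (b k) (\<rho> k) \<and> x + \<theta> k \<in> A"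
proof (rule ccontr)
  assume neg: "\<not> ?thesis"
  obtain u v where uv: "u < v" and dens: "measure lborel (A \<inter> {u..v}) \<ge> (1 - 1/160) * (v - u)"
    using exists_interval_of_high_density[OF A, of "1/160"] by auto
  define D where "D = {u..v} - A"
  have Ab: "A \<in> sets borel" using A by simp
  have Df: "D \<in> fmeasurable lborel"
    using Ab fmeasurable_Int_interval[of "- A" u v] by (simp add: D_def Diff_eq Int_commute)
  have Dm: "measure lborel D \<le> (v - u) / 160"
  proof -
    have "measure lborel {u..v} = measure lborel (A \<inter> {u..v}) + measure lborel D"
    proof -
      have "measure lborel ((A \<inter> {u..v}) \<union> D) = measure lborel (A \<inter> {u..v}) + measure lborel D"
        using fmeasurableD2[OF fmeasurable_Int_interval[OF Ab, of u v]] fmeasurableD2[OF Df] fmeasurableD[OF Df] Ab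
        by (intro measure_Union) (simp_all add: D_def, blast)
      moreover have "(A \<inter> {u..v}) \<union> D = {u..v}" by (auto simp: D_def)
      ultimately show ?thesis by simp
    qed
    then show ?thesis using dens uv by (simp add: field_simps)
  qed
  obtain k0 where k0: "\<And>k. k \<ge> k0 \<Longrightarrow> k \<in> S \<Longrightarrow> 12 / (v - u) \<le> N k"
    using unb[of "12 / (v - u)"] by (auto simp: eventually_sequentially)
  \<comment> \<open>A total weight above 1 gives \<open>r \<le> r\<^sup>2\<close>, which absorbs the
    diagonal terms of the second moment into the quadratic ones.\<close>
  obtain T where T: "finite T" "T \<subseteq> S" "\<And>k. k \<in> T \<Longrightarrow> k0 \<le> k" and r1: "1 < (\<Sum>k\<in>T. \<rho> k)"
  proof (rule finite_subset_sum_gt[OF _ div, where ?k0.0 = k0 and C = 1])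
    show "0 \<le> \<rho> k" if "k \<in> S" for k using \<rho>(1)[OF that] by simp
  qed blast
  define r where "r = (\<Sum>k\<in>T. \<rho> k)"
  define h where "h = v - u"
  have h: "h > 0" using uv by (simp add: h_def)
  have big: "12 \<le> N k * h" if "k \<in> T" for k
    using k0[of k] T that uv by (auto simp: field_simps h_def)
  \<comment> \<open>With \<open>t = 40 * r\<close> and |D| \<le> h / 160 the two terms on the right
    are \<open>20 * h * r\<^sup>2\<close> and \<open>10 * h * r\<^sup>2\<close>. The resulting 3/8
    is below 1/2, so that two combs together stay below \<open>r * h\<close>.\<close>
  have moment: "(\<Sum>k\<in>T. measure lborel (comb (N k) (c k) (\<rho> k) \<inter> D)) \<le> 3/8 * r * h" for c
  proof -
    let ?B = "\<lambda>k. comb (N k) (c k) (\<rho> k)"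
    have "measure lborel (?B k \<inter> ?B l \<inter> D) \<le> 16 * h * \<rho> k * \<rho> l + (if k = l then 4 * h * \<rho> k else 0)"
      if kl: "k \<in> T" "l \<in> T" for k l
    proof -
      have S: "k \<in> S" "l \<in> S" using kl T by auto
      have *: "measure lborel (?B k \<inter> ?B l \<inter> D) \<le> measure lborel (?B k \<inter> ?B l \<inter> {u..v})"
        using Ab by (intro measure_mono_fmeasurable fmeasurable_Int_interval) (auto simp: D_def)
      consider "k = l" | "k < l" | "l < k" by linarith
      then show ?thesis
      proof cases
        case 1
        have "measure lborel (?B k \<inter> {u..v}) \<le> (N k * (v - u) + 2) * (2 * \<rho> k / N k)"
          using S N \<rho> uv by (intro measure_comb_le) (auto simp: less_imp_le)
        also have "\<dots> \<le> (2 * N k * h) * (2 * \<rho> k / N k)"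
          using big[OF kl(1)] N[OF S(1)] \<rho>(1)[OF S(1)] unfolding h_def[symmetric]
          by (intro mult_right_mono) (linarith, simp)
        also have "\<dots> = 4 * h * \<rho> k" using N[OF S(1)] by simp
        finally show ?thesis using * 1 h \<rho>(1)[OF S(1)] by (simp add: add_increasing)
      next
        case 2
        have "measure lborel (?B k \<inter> ?B l \<inter> {u..v}) \<le> 16 * (v - u) * \<rho> k * \<rho> l"
          using S N \<rho> uv sep[OF S 2] big[OF kl(1)]
          by (intro measure_comb_Int_comb_le) (auto simp: less_imp_le h_def)
        then show ?thesis using * 2 by (simp add: h_def)
      next
        case 3
        have "measure lborel (?B l \<inter> ?B k \<inter> {u..v}) \<le> 16 * (v - u) * \<rho> l * \<rho> k"
          using S N \<rho> uv sep[OF S(2,1) 3] big[OF kl(2)]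
          by (intro measure_comb_Int_comb_le) (auto simp: less_imp_le h_def)
        then show ?thesis using * 3 by (simp add: h_def Int_ac mult_ac)
      qed
    qed
    then have "(\<Sum>k\<in>T. \<Sum>l\<in>T. measure lborel (?B k \<inter> ?B l \<inter> D))
        \<le> (\<Sum>k\<in>T. \<Sum>l\<in>T. 16 * h * \<rho> k * \<rho> l + (if k = l then 4 * h * \<rho> k else 0))"
      by (intro sum_mono) auto
    also have "\<dots> = 16 * h * r\<^sup>2 + 4 * h * r"
      using T(1) by (simp add: sum.distrib r_def power2_eq_square sum_product sum_distrib_left sum_distrib_right mult_ac)
    also have "\<dots> \<le> 20 * h * r\<^sup>2"
      using r1 h unfolding r_def[symmetric] by (simp add: power2_eq_square)
    finally have "2 * (40 * r) * (\<Sum>k\<in>T. measure lborel (?B k \<inter> D)) \<le> 20 * h * r\<^sup>2 + (40 * r)\<^sup>2 * measure lborel D"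
      using sum_measure_le_second_moment[OF T(1) Df, of ?B "40 * r"] by simp
    also have "\<dots> \<le> 20 * h * r\<^sup>2 + (40 * r)\<^sup>2 * (h / 160)"
      using Dm by (intro add_left_mono mult_left_mono) (auto simp: h_def)
    also have "\<dots> = 2 * (40 * r) * (3/8 * r * h)" by (simp add: power2_eq_square)
    finally show ?thesis using r1 unfolding r_def[symmetric] by (simp add: mult_le_cancel_left_pos mult_ac)
  qed
  have single: "\<rho> k * h \<le> measure lborel (comb (N k) (b k) (\<rho> k) \<inter> D)
      + measure lborel (comb (N k) (b k + N k * \<theta> k) (\<rho> k) \<inter> D)" if k: "k \<in> T" for k
  proof -
    let ?B = "comb (N k) (b k) (\<rho> k)" and ?B' = "comb (N k) (b k + N k * \<theta> k) (\<rho> k)"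
    have S: "k \<in> S" using k T by auto
    note Nk = N[OF S] and \<rho>k = \<rho>[OF S] and \<theta>k = \<theta>[OF S]
    \<comment> \<open>The strip \<open>L\<close> starting at \<open>e\<close> collects the points
      whose translate by \<open>\<theta> k\<close> may leave the interval.\<close>
    define e where "e = (if \<theta> k \<ge> 0 then v - \<theta> k else u)"
    define L where "L = {e..e + \<bar>\<theta> k\<bar>}"
    define X where "X = (\<lambda>x. \<theta> k + x) -` (?B' \<inter> D) "
    have Xm: "X \<in> fmeasurable lborel \<and> measure lborel X = measure lborel (?B' \<inter> D)"
    proof -
      have BD: "?B' \<inter> D \<in> sets borel" using Ab by (simp add: D_def)
      have "?B' \<inter> D \<in> fmeasurable lborel"
        using fmeasurable_Int_fmeasurable[OF Df, of ?B'] by (simp add: Int_commute)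
      moreover have "emeasure lborel X = emeasure lborel (?B' \<inter> D)"
      proof -
        have "emeasure lborel (?B' \<inter> D) = emeasure (distr lborel borel (\<lambda>x. \<theta> k + x)) (?B' \<inter> D)"
          by (simp add: lborel_distr_plus)
        also have "\<dots> = emeasure lborel X"
          using BD by (subst emeasure_distr) (auto simp: X_def)
        finally show ?thesis by simp
      qed
      moreover have "X \<in> sets borel"
        using measurable_sets[OF _ BD, of "\<lambda>x. \<theta> k + x" borel] by (simp add: X_def)
      ultimately show ?thesis by (auto simp: fmeasurable_def measure_def)
    qed
    \<comment> \<open>By the assumption to be refuted, a point of the comb and its translate are not
      both in \<open>A\<close>; so one of them is in \<open>D\<close>, or the translate has left the
      interval. The translated comb is again a comb, to which \<open>moment\<close> applies as
      well.\<close>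
    have sub: "?B \<inter> {u..v} \<subseteq> (?B \<inter> D) \<union> X \<union> (?B \<inter> L)"
    proof
      fix x assume x: "x \<in> ?B \<inter> {u..v}"
      have xB': "x + \<theta> k \<in> ?B'" using x by (auto simp: comb_def algebra_simps)
      show "x \<in> (?B \<inter> D) \<union> X \<union> (?B \<inter> L)"
      proof (cases "x \<in> A")
        case False
        then show ?thesis using x by (auto simp: D_def)
      next
        case True
        then have "x + \<theta> k \<notin> A" using neg S x by blast
        then show ?thesis using x xB'
          by (cases "x + \<theta> k \<in> {u..v}") (auto simp: X_def D_def L_def e_def add.commute)
      qed
    qed
    \<comment> \<open>From \<open>12 \<le> N k * h\<close>: boundary teeth cost at most 1/6 of the
      count, leaving 5/3 \<rho> h, and the strip costs at most 1/2 \<rho> h. The difference is the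
      7/6 below.\<close>
    have "5 / 6 * (2 * \<rho> k / N k) * (N k * h) \<le> (N k * h - 2) * (2 * \<rho> k / N k)"
    proof -
      have "5 / 6 * (N k * h) \<le> N k * h - 2" using big[OF k] by linarith
      then have "(5 / 6 * (N k * h)) * (2 * \<rho> k / N k) \<le> (N k * h - 2) * (2 * \<rho> k / N k)"
        using Nk \<rho>k by (intro mult_right_mono) auto
      then show ?thesis by (simp only: mult_ac)
    qed
    also have "\<dots> \<le> measure lborel (?B \<inter> {u..v})"
      unfolding h_def using Nk \<rho>k uv by (intro measure_comb_ge) auto
    also have "\<dots> \<le> measure lborel ((?B \<inter> D) \<union> X \<union> (?B \<inter> L))"
    proof (rule measure_mono_fmeasurable[OF sub])
      show "?B \<inter> {u..v} \<in> sets lborel" by simp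
      have "?B \<inter> D \<in> fmeasurable lborel"
        using fmeasurable_Int_fmeasurable[OF Df, of ?B] by (simp add: Int_commute)
      moreover have "?B \<inter> L \<in> fmeasurable lborel"
        unfolding L_def by (rule fmeasurable_Int_interval) simp
      ultimately show "(?B \<inter> D) \<union> X \<union> (?B \<inter> L) \<in> fmeasurable lborel"
        using Xm by (intro fmeasurable.Un) blast+
    qed
    also have "\<dots> \<le> measure lborel (?B \<inter> D) + measure lborel X + measure lborel (?B \<inter> L)"
    proof -
      have "?B \<inter> D \<in> sets lborel" "?B \<inter> L \<in> sets lborel" "X \<in> sets lborel"
        using fmeasurableD[OF Df] fmeasurableD[of X lborel] Xm by (simp_all add: L_def)
      then show ?thesis
        using measure_Un_le[of "(?B \<inter> D) \<union> X" lborel "?B \<inter> L"] measure_Un_le[of "?B \<inter> D" lborel X]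
        by (smt (verit) sets.Un)
    qed
    also have "measure lborel (?B \<inter> L) \<le> (N k * \<bar>\<theta> k\<bar> + 2) * (2 * \<rho> k / N k)"
      using measure_comb_le[of "N k" "\<rho> k" e "e + \<bar>\<theta> k\<bar>" "b k"] Nk \<rho>k by (simp add: L_def)
    also have "\<dots> \<le> 3 * (2 * \<rho> k / N k)"
      using \<theta>k Nk \<rho>k by (intro mult_right_mono) (auto simp: field_simps)
    also have "\<dots> \<le> h * \<rho> k / 2"
      using big[OF k] Nk \<rho>k by (simp add: field_simps)
    finally have "7/6 * (\<rho> k * h) \<le> measure lborel (?B \<inter> D) + measure lborel X"
      using Nk by (simp add: field_simps)
    moreover have "0 \<le> \<rho> k * h" using \<rho>k h by simp
    ultimately show ?thesis using Xm by linarith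
  qed
  have "r * h = (\<Sum>k\<in>T. \<rho> k * h)" by (simp add: r_def sum_distrib_right)
  also have "\<dots> \<le> (\<Sum>k\<in>T. measure lborel (comb (N k) (b k) (\<rho> k) \<inter> D)
      + measure lborel (comb (N k) (b k + N k * \<theta> k) (\<rho> k) \<inter> D))"
    by (intro sum_mono single)
  also have "\<dots> \<le> 3/8 * r * h + 3/8 * r * h"
    unfolding sum.distrib by (intro add_mono moment)
  finally show False using r1 h unfolding r_def[symmetric] by simp
qed

section \<open>Well placed rational approximations\<close>

text \<open>
  The last clause says that \<open>m p / N\<close> is at distance at least \<open>1 / (32 sqrt (m N))\<close> from the integers
  for \<open>0 < m < N\<close>. It translates into a Diophantine condition on the inverse of \<open>p\<close> modulo \<open>N\<close>,
  which governs the spatial order of the points \<open>j p / N\<close>.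
\<close>

definition well_placed :: "nat \<Rightarrow> nat \<Rightarrow> int \<Rightarrow> bool" where
  "well_placed Q N p \<longleftrightarrow> 0 < N \<and> Q \<le> 16 * N \<and> N \<le> Q \<and> coprime p (int N) \<and>
     (\<forall>m l. 0 < m \<and> m < int N \<longrightarrow> int N \<le> 1024 * m * (m * p - l * int N)\<^sup>2)"

definition well_approx :: "real \<Rightarrow> nat \<Rightarrow> real set" where
  "well_approx \<eta> Q = {\<alpha>. \<exists>N p. well_placed Q N p \<and> \<bar>\<alpha> - of_int p / real N\<bar> < \<eta> / (real N * real Q)}"

text \<open>
  The Dirichlet approximation at scale \<open>Q\<close> works: it inherits the spacing of the multiples of \<open>\<alpha>\<close>.
\<close>

lemma exists_well_placed:
  fixes \<alpha> :: real and Q :: nat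
  assumes Q: "Q > 0"
    and far: "\<And>m l::int. \<lbrakk>0 < m; 16 * m \<le> int Q\<rbrakk> \<Longrightarrow> 1 \<le> 16 * of_int m * real Q * (of_int m * \<alpha> - of_int l)\<^sup>2"
  obtains N p where "well_placed Q N p" "\<bar>\<alpha> - of_int p / real N\<bar> < 1 / (real N * real Q)"
proof -
  obtain h k where hk: "coprime h k" "0 < k" "k \<le> int Q" and ap: "\<bar>of_int k * \<alpha> - of_int h\<bar> < 1 / real Q"
    using Dirichlet_approx_coprime[OF Q] by metis
  define N where "N = nat k"
  have k: "k = int N" and N0: "N > 0" using hk by (auto simp: N_def)
  have Nr: "of_int k = real N" by (simp add: k)
  have Q1: "real Q \<ge> 1" using Q by simp
  have ap': "\<bar>real N * \<alpha> - of_int h\<bar> < 1 / real Q" using ap by (simp add: k)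
  have sq: "x\<^sup>2 < (1 / real Q)\<^sup>2" if "\<bar>x\<bar> < 1 / real Q" for x :: real
    using that by (metis abs_le_square_iff abs_of_nonneg not_less of_nat_0_le_iff zero_le_divide_1_iff)
  \<comment> \<open>Were the Dirichlet denominator at most \<open>Q / 16\<close>, its approximation
    would be better than \<open>far\<close> allows.\<close>
  have big: "Q < 16 * N"
  proof (rule ccontr)
    assume "\<not> Q < 16 * N"
    then have le: "16 * k \<le> int Q" by (simp add: k)
    have "1 \<le> 16 * of_int k * real Q * (of_int k * \<alpha> - of_int h)\<^sup>2"
      by (rule far[OF hk(2) le])
    also have "\<dots> < 16 * of_int k * real Q * (1 / real Q)\<^sup>2"
      using sq[OF ap] Q hk by (intro mult_strict_left_mono) auto
    also have "\<dots> = 16 * of_int k / real Q" using Q by (simp add: power2_eq_square)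
    also have "\<dots> \<le> 1"
    proof -
      have "real_of_int (16 * k) \<le> real_of_int (int Q)" using le by (rule of_int_le_iff[THEN iffD2])
      then show ?thesis using Q by simp
    qed
    finally show False by simp
  qed
  \<comment> \<open>1024 = 16 * 16 * 4: the factor in \<open>far\<close>, the bound 16 for Q / N,
    and the square of the 2 in |m \<alpha> - l| \<le> 2 |D| / N. As \<open>D\<close> is nonzero, a
    violation forces \<open>m\<close> to be small, which makes \<open>far\<close> applicable and the
    approximation error at most |D| / N.\<close>
  have spread: "int N \<le> 1024 * m * (m * h - l * int N)\<^sup>2" if m: "0 < m" "m < int N" for m l
  proof (rule ccontr)
    define D where "D = m * h - l * int N"
    assume "\<not> int N \<le> 1024 * m * (m * h - l * int N)\<^sup>2"
    then have lt: "1024 * m * D\<^sup>2 < int N" by (simp add: D_def)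
    have "D \<noteq> 0"
    proof
      assume "D = 0"
      then have "int N dvd m * h" by (simp add: D_def)
      moreover have "coprime (int N) h" using hk by (simp add: k coprime_commute)
      ultimately have "int N dvd m" by (simp add: coprime_dvd_mult_left_iff)
      then show False using m zdvd_imp_le by fastforce
    qed
    then have D1: "\<bar>D\<bar> \<ge> 1" by linarith
    then have D2: "D\<^sup>2 \<ge> 1" by (metis abs_ge_self abs_le_square_iff abs_one one_power2)
    have "1024 * m * 1 \<le> 1024 * m * D\<^sup>2" using m D2 by (intro mult_left_mono) auto
    then have m1024: "1024 * m < int N" using lt by simp
    then have m16: "16 * m \<le> int Q" using hk k m by linarith
    have e1: "of_int m * \<alpha> - of_int l = of_int D / real N + of_int m * (real N * \<alpha> - of_int h) / real N"
      using N0 by (simp add: D_def field_simps)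
    have "\<bar>of_int m * (real N * \<alpha> - of_int h)\<bar> \<le> of_int m * (1 / real Q)"
      unfolding abs_mult using m ap' by (intro mult_mono) auto
    also have "\<dots> \<le> 1" using m1024 hk k Q by (simp add: field_simps)
    also have "\<dots> \<le> real_of_int \<bar>D\<bar>" using D1 by linarith
    finally have "\<bar>of_int D + of_int m * (real N * \<alpha> - of_int h)\<bar> \<le> \<bar>2 * real_of_int D\<bar>" by linarith
    then have "(of_int D + of_int m * (real N * \<alpha> - of_int h))\<^sup>2 \<le> (2 * real_of_int D)\<^sup>2"
      by (simp only: abs_le_square_iff)
    moreover have "of_int m * \<alpha> - of_int l = (of_int D + of_int m * (real N * \<alpha> - of_int h)) / real N"
      using e1 by (simp add: add_divide_distrib)
    ultimately have "(of_int m * \<alpha> - of_int l)\<^sup>2 \<le> 4 * (real_of_int D)\<^sup>2 / (real N)\<^sup>2"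
      by (simp add: power_divide divide_right_mono)
    then have "16 * of_int m * real Q * (of_int m * \<alpha> - of_int l)\<^sup>2 \<le> 16 * of_int m * real Q * (4 * (real_of_int D)\<^sup>2 / (real N)\<^sup>2)"
      using m by (intro mult_left_mono) auto
    then have "1 \<le> 16 * of_int m * real Q * (4 * (real_of_int D)\<^sup>2 / (real N)\<^sup>2)"
      using far[OF m(1) m16, of l] by linarith
    also have "\<dots> \<le> 16 * of_int m * (16 * real N) * (4 * (real_of_int D)\<^sup>2 / (real N)\<^sup>2)"
      using m big by (intro mult_right_mono mult_left_mono) auto
    also have "\<dots> = 1024 * of_int m * (real_of_int D)\<^sup>2 / real N"
      using N0 by (simp add: power2_eq_square)
    finally have "real N \<le> 1024 * of_int m * (real_of_int D)\<^sup>2" using N0 by (simp add: field_simps)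
    also have "\<dots> = real_of_int (1024 * m * D\<^sup>2)" by simp
    finally have "real_of_int (int N) \<le> real_of_int (1024 * m * D\<^sup>2)" by simp
    then have "int N \<le> 1024 * m * D\<^sup>2" by (rule of_int_le_iff[THEN iffD1])
    then show False using lt by simp
  qed
  have "well_placed Q N h"
    unfolding well_placed_def using N0 big hk k spread by auto
  moreover have "\<bar>\<alpha> - of_int h / real N\<bar> < 1 / (real N * real Q)"
  proof -
    have "\<bar>\<alpha> - of_int h / real N\<bar> = \<bar>real N * \<alpha> - of_int h\<bar> / real N"
    proof -
      have "\<alpha> - of_int h / real N = (real N * \<alpha> - of_int h) / real N" using N0 by (simp add: field_simps)
      then show ?thesis by (simp add: abs_divide)
    qed
    also have "\<dots> < (1 / real Q) / real N" using ap' N0 by (intro divide_strict_right_mono) auto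
    finally show ?thesis by (simp add: mult.commute)
  qed
  ultimately show ?thesis by (rule that)
qed

section \<open>Measure of the numbers approximated too well by small denominators\<close>

lemma sum_inverse_sqrt_le: "(\<Sum>m=1..M. 1 / sqrt (real m)) \<le> 2 * sqrt (real M)"
proof (induction M)
  case (Suc M)
  have "1 / sqrt (real (Suc M)) \<le> 2 * (sqrt (real (Suc M)) - sqrt (real M))"
  proof -
    let ?a = "sqrt (real (Suc M))" and ?b = "sqrt (real M)"
    have ab: "?a > 0" "?b \<le> ?a" "?a\<^sup>2 - ?b\<^sup>2 = 1" "?b \<ge> 0" by auto
    have "1 = (?a - ?b) * (?a + ?b)" using ab(3) by (simp add: power2_eq_square algebra_simps)
    also have "\<dots> \<le> (?a - ?b) * (2 * ?a)" using ab by (intro mult_left_mono) auto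
    finally show ?thesis using ab(1) by (simp add: field_simps)
  qed
  then show ?case using Suc by simp
qed simp

lemma sum_inverse_three_halves_le: "(\<Sum>m=1..M. 1 / (real m * sqrt (real m))) \<le> 3"
proof -
  \<comment> \<open>The deficit in the induction hypothesis is the integral of x^(-3/2) from M + 1
    to infinity.\<close>
  have "(\<Sum>m=1..Suc M. 1 / (real m * sqrt (real m))) \<le> 3 - 2 / sqrt (real (Suc M))" for M
  proof (induction M)
    case (Suc M)
    let ?a = "sqrt (real (Suc M))" and ?b = "sqrt (real (Suc (Suc M)))"
    have ab: "?a > 0" "?a \<le> ?b" "?b\<^sup>2 - ?a\<^sup>2 = 1" and b0: "?b > 0" by auto
    have "?a * (?a + ?b) \<le> ?b * (?b + ?b)"
      using ab by (intro mult_mono) auto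
    also have "\<dots> = 2 * ?b\<^sup>2 * ((?b - ?a) * (?a + ?b))"
      using ab(3) by (simp add: power2_eq_square algebra_simps)
    finally have "?a * (?a + ?b) \<le> (2 * ?b\<^sup>2 * (?b - ?a)) * (?a + ?b)" by (simp only: mult.assoc)
    then have "?a \<le> 2 * ?b\<^sup>2 * (?b - ?a)"
      using ab b0 by (simp only: mult_le_cancel_right_pos add_pos_pos)
    moreover have "1 / (b\<^sup>2 * b) \<le> 2 / a - 2 / b" if "0 < a" "0 < b" "a \<le> 2 * b\<^sup>2 * (b - a)" for a b :: real
    proof -
      have "a / (a * (b\<^sup>2 * b)) \<le> (2 * b\<^sup>2 * (b - a)) / (a * (b\<^sup>2 * b))"
        using that by (intro divide_right_mono) auto
      also have "\<dots> = 2 / a - 2 / b" using that by (simp add: field_simps power2_eq_square)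
      finally show ?thesis using that by simp
    qed
    ultimately have "1 / (?b\<^sup>2 * ?b) \<le> 2 / ?a - 2 / ?b" using ab b0 by blast
    then have "1 / (real (Suc (Suc M)) * ?b) \<le> 2 / ?a - 2 / ?b" by simp
    then show ?case using Suc by (simp add: sum.cl_ivl_Suc del: of_nat_Suc)
  qed simp
  note * = this
  show ?thesis
  proof (cases M)
    case (Suc n)
    have "(\<Sum>m=1..M. 1 / (real m * sqrt (real m))) \<le> 3 - 2 / sqrt (real (Suc n))"
      unfolding Suc by (rule *)
    also have "\<dots> \<le> 3" by simp
    finally show ?thesis .
  qed simp
qed

text \<open>The failure of the hypothesis \<open>far\<close> of \<open>exists_well_placed\<close>,
  with the square root taken. Written as a union of combs, its measure is bounded tooth by
  tooth.\<close>

definition too_well_approximable :: "nat \<Rightarrow> real set" where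
  "too_well_approximable Q = (\<Union>m\<in>{1..Q div 16}. comb (real m) 0 (1 / (4 * sqrt (real m * real Q))))"

text \<open>The densities add up to \<Sum> 1 / (2 sqrt (m Q)) over m \<le> Q / 16, at most sqrt (Q /
  16) / sqrt Q = 1/4. The cutoff 16 is chosen to leave most of every interval; the second summand
  counts boundary teeth.\<close>

lemma measure_too_well_approximable_le:
  assumes Q: "Q > 0" and uv: "u \<le> v"
  shows "measure lborel (too_well_approximable Q \<inter> {u..v}) \<le> (v - u) / 4 + 3 / sqrt (real Q)"
proof -
  let ?M = "Q div 16" and ?\<rho> = "\<lambda>m. 1 / (4 * sqrt (real m * real Q))"
  have "measure lborel (too_well_approximable Q \<inter> {u..v})
      = measure lborel (\<Union>m\<in>{1..?M}. comb (real m) 0 (?\<rho> m) \<inter> {u..v})"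
    by (simp add: too_well_approximable_def)
  also have "\<dots> \<le> (\<Sum>m=1..?M. measure lborel (comb (real m) 0 (?\<rho> m) \<inter> {u..v}))"
    by (intro measure_UNION_le) auto
  also have "\<dots> \<le> (\<Sum>m=1..?M. (v - u) / (2 * sqrt (real Q)) * (1 / sqrt (real m)) + 1 / sqrt (real Q) * (1 / (real m * sqrt (real m))))"
  proof (intro sum_mono)
    fix m assume m: "m \<in> {1..?M}"
    have "1 \<le> sqrt (real m * real Q)"
      using m Q by (simp add: mult_ge1_I)
    moreover have "1 / (4 * s) \<le> 1/2" if "1 \<le> s" for s :: real using that by (simp add: field_simps)
    ultimately have "?\<rho> m \<le> 1/2" by blast
    with m uv have "measure lborel (comb (real m) 0 (?\<rho> m) \<inter> {u..v}) \<le> (real m * (v - u) + 2) * (2 * ?\<rho> m / real m)"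
      by (intro measure_comb_le) simp_all
    also have "\<dots> = (v - u) / (2 * sqrt (real Q)) * (1 / sqrt (real m)) + 1 / sqrt (real Q) * (1 / (real m * sqrt (real m)))"
      using m Q by (simp add: real_sqrt_mult field_simps)
    finally show "measure lborel (comb (real m) 0 (?\<rho> m) \<inter> {u..v}) \<le> \<dots>" .
  qed
  also have "\<dots> = (v - u) / (2 * sqrt (real Q)) * (\<Sum>m=1..?M. 1 / sqrt (real m))
      + 1 / sqrt (real Q) * (\<Sum>m=1..?M. 1 / (real m * sqrt (real m)))"
    by (simp only: sum.distrib sum_distrib_left)
  also have "\<dots> \<le> (v - u) / (2 * sqrt (real Q)) * (2 * (sqrt (real Q) / 4)) + 1 / sqrt (real Q) * 3"
  proof (intro add_mono mult_left_mono sum_inverse_three_halves_le)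
    have "sqrt (real ?M) \<le> sqrt (real Q / 16)"
      by (intro real_sqrt_le_mono) linarith
    also have "\<dots> = sqrt (real Q) / 4" by (simp add: real_sqrt_divide)
    finally show "(\<Sum>m=1..?M. 1 / sqrt (real m)) \<le> 2 * (sqrt (real Q) / 4)"
      using sum_inverse_sqrt_le[of ?M] by linarith
  qed (use uv in auto)
  also have "\<dots> = (v - u) / 4 + 3 / sqrt (real Q)" using Q by simp
  finally show ?thesis .
qed

lemma exists_well_placed':
  assumes Q: "Q > 0" and \<alpha>: "\<alpha> \<notin> too_well_approximable Q"
  obtains N p where "well_placed Q N p" "\<bar>\<alpha> - of_int p / real N\<bar> < 1 / (real N * real Q)"
proof (rule exists_well_placed[OF Q])
  fix m l :: int
  assume m: "0 < m" "16 * m \<le> int Q"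
  define n where "n = nat m"
  have n: "m = int n" "n \<in> {1..Q div 16}" using m by (auto simp: n_def)
  then have "\<alpha> \<notin> comb (real n) 0 (1 / (4 * sqrt (real n * real Q)))"
    using \<alpha> unfolding too_well_approximable_def by blast
  then have "1 / (4 * sqrt (real n * real Q)) \<le> \<bar>real n * \<alpha> - of_int l\<bar>"
    by (auto simp: comb_def not_less)
  then have "(1 / (4 * sqrt (real n * real Q)))\<^sup>2 \<le> (real n * \<alpha> - of_int l)\<^sup>2"
    by (subst abs_le_square_iff[symmetric]) auto
  moreover have "(1 / (4 * sqrt (real n * real Q)))\<^sup>2 = 1 / (16 * (real n * real Q))"
    by (simp add: power_divide power_mult_distrib)
  ultimately have "1 / (16 * (real n * real Q)) \<le> (real n * \<alpha> - of_int l)\<^sup>2" by simp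
  moreover have "0 < 16 * (real n * real Q)" using n Q by simp
  ultimately have "1 \<le> (real n * \<alpha> - of_int l)\<^sup>2 * (16 * (real n * real Q))"
    by (simp only: pos_divide_le_eq)
  then show "1 \<le> 16 * of_int m * real Q * (of_int m * \<alpha> - of_int l)\<^sup>2"
    by (simp add: n(1) mult_ac)
qed (use that in blast)

lemma well_approx_measurable [measurable]: "well_approx \<eta> Q \<in> sets borel"
proof -
  have "well_approx \<eta> Q = (\<Union>N. \<Union>p. {\<alpha>. well_placed Q N p \<and> \<bar>\<alpha> - of_int p / real N\<bar> < \<eta> / (real N * real Q)})"
    by (auto simp: well_approx_def)
  also have "\<dots> \<in> sets borel" by measurable
  finally show ?thesis .
qed

lemma measure_ball_real: "0 \<le> r \<Longrightarrow> measure lborel {c - r<..<c + r::real} = 2 * r"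
  by simp

lemma fmeasurable_open_interval: "{a<..<b::real} \<in> fmeasurable lborel"
  by (cases "a \<le> b") (simp_all add: fmeasurable_def)

text \<open>
  Dirichlet balls \<open>1 / (N Q)\<close> around well placed fractions cover most of an interval; shrinking
  them by \<open>\<eta>\<close> makes them disjoint and costs only the factor \<open>\<eta>\<close> in measure.
\<close>

lemma measure_well_approx_ge:
  assumes Q: "Q > 0" and uv: "u \<le> v" and \<eta>: "0 < \<eta>" "\<eta> \<le> 1/2"
  shows "\<eta> * (3/4 * (v - u) - 3 / sqrt (real Q)) - 64 / (real Q)\<^sup>2 \<le> measure lborel (well_approx \<eta> Q \<inter> {u..v})"
proof -
  define F where "F = {(N, p). well_placed Q N p \<and> (\<exists>\<alpha>\<in>{u..v}. \<bar>\<alpha> - of_int p / real N\<bar> < 1 / (real N * real Q))}"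
  define I where "I = (\<lambda>\<epsilon> (N, p). {of_int p / real N - \<epsilon> / (real N * real Q) <..< of_int p / real N + \<epsilon> / (real N * real Q)})"
  have Q1: "real Q \<ge> 1" using Q by simp
  have wpN: "0 < N" "real N \<ge> real Q / 16" "N \<le> Q" "real N \<ge> 1" if "well_placed Q N p" for N p
    using that by (auto simp: well_placed_def)
  have finF: "finite F"
  proof (rule finite_subset)
    let ?B = "\<lceil>real Q * (\<bar>u\<bar> + \<bar>v\<bar> + 1)\<rceil>"
    show "F \<subseteq> {..Q} \<times> {- ?B..?B}"
    proof
      fix x assume "x \<in> F"
      then obtain N p \<alpha> where x: "x = (N, p)" "well_placed Q N p" "\<alpha> \<in> {u..v}"
        "\<bar>\<alpha> - of_int p / real N\<bar> < 1 / (real N * real Q)" by (auto simp: F_def)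
      note w = wpN[OF x(2)]
      have "1 / (real N * real Q) \<le> 1" using w Q1 by (simp add: mult_ge1_I)
      then have "\<bar>of_int p / real N\<bar> \<le> \<bar>u\<bar> + \<bar>v\<bar> + 1" using x(3,4) by auto
      then have "\<bar>real_of_int p\<bar> \<le> real N * (\<bar>u\<bar> + \<bar>v\<bar> + 1)" using w by (simp add: field_simps)
      also have "\<dots> \<le> real Q * (\<bar>u\<bar> + \<bar>v\<bar> + 1)" using w by (intro mult_right_mono) auto
      finally have "p \<in> {- ?B..?B}" by (auto simp: abs_le_iff) linarith+
      then show "x \<in> {..Q} \<times> {- ?B..?B}" using x w by auto
    qed
  qed simp
  have meas_I: "measure lborel (I \<epsilon> z) = 2 * \<epsilon> / (real (fst z) * real Q)" if "0 \<le> \<epsilon>" for \<epsilon> z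
    using that measure_ball_real[of "\<epsilon> / (real (fst z) * real Q)"]
    by (simp add: I_def case_prod_beta)
  have sets_I [simp]: "I \<epsilon> z \<in> sets borel" for \<epsilon> z
    by (simp add: I_def case_prod_beta)
  have fm_I: "I \<epsilon> z \<in> fmeasurable lborel" for \<epsilon> z
    by (simp add: I_def case_prod_beta fmeasurable_open_interval)
  define \<Sigma> where "\<Sigma> = (\<Sum>z\<in>F. 2 / (real (fst z) * real Q))"
  have "v - u \<le> measure lborel ((too_well_approximable Q \<inter> {u..v}) \<union> (\<Union>z\<in>F. I 1 z))"
  proof -
    have "{u..v} \<subseteq> (too_well_approximable Q \<inter> {u..v}) \<union> (\<Union>z\<in>F. I 1 z)"
    proof
      fix \<alpha> assume \<alpha>: "\<alpha> \<in> {u..v}"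
      show "\<alpha> \<in> (too_well_approximable Q \<inter> {u..v}) \<union> (\<Union>z\<in>F. I 1 z)"
      proof (cases "\<alpha> \<in> too_well_approximable Q")
        case False
        then obtain N p where "well_placed Q N p" "\<bar>\<alpha> - of_int p / real N\<bar> < 1 / (real N * real Q)"
          using exists_well_placed'[OF Q] by blast
        then have "(N, p) \<in> F \<and> \<alpha> \<in> I 1 (N, p)" using \<alpha> by (auto simp: F_def I_def abs_less_iff)
        then show ?thesis by blast
      qed (use \<alpha> in blast)
    qed
    then have "measure lborel {u..v} \<le> measure lborel ((too_well_approximable Q \<inter> {u..v}) \<union> (\<Union>z\<in>F. I 1 z))"
      using fm_I finF
      by (intro measure_mono_fmeasurable fmeasurable.Un fmeasurable.finite_UN fmeasurable_Int_interval)
        (auto simp: too_well_approximable_def)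
    then show ?thesis using uv by simp
  qed
  also have "\<dots> \<le> measure lborel (too_well_approximable Q \<inter> {u..v}) + measure lborel (\<Union>z\<in>F. I 1 z)"
  proof (intro measure_Un_le)
    show "too_well_approximable Q \<inter> {u..v} \<in> sets lborel"
      by (auto simp: too_well_approximable_def)
    show "(\<Union>z\<in>F. I 1 z) \<in> sets lborel"
      using finF fm_I by (intro sets.finite_UN) auto
  qed
  finally have le: "v - u \<le> measure lborel (too_well_approximable Q \<inter> {u..v}) + measure lborel (\<Union>z\<in>F. I 1 z)" .
  have "measure lborel (\<Union>z\<in>F. I 1 z) \<le> (\<Sum>z\<in>F. measure lborel (I 1 z))"
    using finF fm_I by (intro measure_UNION_le) auto
  also have "\<dots> = \<Sigma>" by (simp add: meas_I \<Sigma>_def)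
  finally have \<Sigma>le: "measure lborel (\<Union>z\<in>F. I 1 z) \<le> \<Sigma>" .
  have \<Sigma>: "3/4 * (v - u) - 3 / sqrt (real Q) \<le> \<Sigma>"
  proof -
    have "v - u \<le> ((v - u) / 4 + 3 / sqrt (real Q)) + \<Sigma>"
      using \<Sigma>le measure_too_well_approximable_le[OF Q uv] by (intro order_trans[OF le] add_mono)
    then show ?thesis by (simp add: field_simps)
  qed
  \<comment> \<open>Distinct fractions with denominators N, N' \<le> Q are at least 1 / (N N')
    apart, and for \<open>\<eta> \<le> 1/2\<close> each radius is at most half of that.\<close>
  have disj: "disjoint_family_on (I \<eta>) F"
    unfolding disjoint_family_on_def
  proof (intro ballI impI)
    fix z z' assume z: "z \<in> F" "z' \<in> F" "z \<noteq> z'"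
    obtain N p N' p' where eq: "z = (N, p)" "z' = (N', p')" by fastforce
    have wp: "well_placed Q N p" "well_placed Q N' p'" using z by (auto simp: F_def eq)
    note w = wpN[OF wp(1)] and w' = wpN[OF wp(2)]
    show "I \<eta> z \<inter> I \<eta> z' = {}"
    proof (rule ccontr)
      assume "I \<eta> z \<inter> I \<eta> z' \<noteq> {}"
      then obtain x where x: "x \<in> I \<eta> z" "x \<in> I \<eta> z'" by blast
      have "\<bar>x - of_int p / real N\<bar> < \<eta> / (real N * real Q)"
        using x(1) unfolding I_def eq case_prod_conv greaterThanLessThan_iff by linarith
      moreover have "\<bar>x - of_int p' / real N'\<bar> < \<eta> / (real N' * real Q)"
        using x(2) unfolding I_def eq case_prod_conv greaterThanLessThan_iff by linarith
      moreover have "\<eta> / (real N * real Q) \<le> (1/2) / (real N * real N')"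
        using w w' \<eta> Q1 by (intro frac_le mult_left_mono) auto
      moreover have "\<eta> / (real N' * real Q) \<le> (1/2) / (real N' * real N)"
        using w w' \<eta> Q1 by (intro frac_le mult_left_mono) auto
      ultimately have "\<bar>of_int p / real N - of_int p' / real N'\<bar> < 1 / (real N * real N')"
        by (simp add: mult.commute)
      moreover have "of_int p / real N - of_int p' / real N' = of_int (p * int N' - p' * int N) / (real N * real N')"
        using w w' by (simp add: field_simps)
      ultimately have "\<bar>real_of_int (p * int N' - p' * int N)\<bar> / (real N * real N') < 1 / (real N * real N')"
        using w w' by (simp add: abs_divide abs_mult)
      then have "\<bar>real_of_int (p * int N' - p' * int N)\<bar> < 1"
        using w w' by (simp add: divide_less_cancel)
      then have e: "p * int N' = p' * int N" by linarith
      have cop: "coprime p (int N)" "coprime p' (int N')" using wp by (auto simp: well_placed_def)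
      have "int N dvd int N'" using e cop(1) by (metis coprime_commute coprime_dvd_mult_right_iff dvd_triv_right)
      moreover have "int N' dvd int N" using e cop(2) by (metis coprime_commute coprime_dvd_mult_right_iff dvd_triv_right)
      ultimately have "N = N'" by (simp add: dvd_antisym)
      then show False using e z w eq by simp
    qed
  qed
  \<comment> \<open>\<open>N \<ge> Q / 16\<close> bounds every radius by
    \<open>16 / (real Q)\<^sup>2\<close>, and a shrunken ball whose Dirichlet ball meets the
    interval sticks out by at most two radii, at either end.\<close>
  let ?V = "\<Union>z\<in>F. I \<eta> z" and ?c = "32 / (real Q)\<^sup>2"
  have "\<eta> * \<Sigma> = (\<Sum>z\<in>F. measure lborel (I \<eta> z))"
    using \<eta> by (simp add: meas_I \<Sigma>_def sum_distrib_left mult_ac)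
  also have "\<dots> = measure lborel ?V"
    using finF fm_I disj by (intro measure_finite_Union[symmetric]) (auto simp: fmeasurableD2)
  also have "\<dots> \<le> measure lborel ((well_approx \<eta> Q \<inter> {u..v}) \<union> {u - ?c..u} \<union> {v..v + ?c})"
  proof (intro measure_mono_fmeasurable fmeasurable.Un fmeasurable_Int_interval fmeasurable_interval)
    show "?V \<subseteq> (well_approx \<eta> Q \<inter> {u..v}) \<union> {u - ?c..u} \<union> {v..v + ?c}"
    proof
      fix x assume "x \<in> ?V"
      then obtain N p \<alpha> where z: "well_placed Q N p" "\<alpha> \<in> {u..v}"
        "\<bar>\<alpha> - of_int p / real N\<bar> < 1 / (real N * real Q)" "x \<in> I \<eta> (N, p)" by (auto simp: F_def)
      note w = wpN[OF z(1)]
      have x: "\<bar>x - of_int p / real N\<bar> < \<eta> / (real N * real Q)" using z(4) by (auto simp: I_def abs_less_iff)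
      then have wx: "x \<in> well_approx \<eta> Q" using z(1) by (auto simp: well_approx_def)
      have le: "1 / (real N * real Q) \<le> 16 / (real Q)\<^sup>2"
      proof -
        have "1 / (real N * real Q) \<le> 1 / (real Q / 16 * real Q)"
          using w Q1 by (intro divide_left_mono mult_right_mono) auto
        then show ?thesis by (simp add: power2_eq_square)
      qed
      moreover have "\<eta> / (real N * real Q) \<le> 1 / (real N * real Q)"
        using \<eta> by (intro divide_right_mono) auto
      ultimately have "\<bar>x - \<alpha>\<bar> < ?c" using x z(3) by linarith
      then show "x \<in> (well_approx \<eta> Q \<inter> {u..v}) \<union> {u - ?c..u} \<union> {v..v + ?c}"
        using wx z(2) by auto
    qed
    show "?V \<in> sets lborel" using finF fm_I by (intro sets.finite_UN) auto
  qed auto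
  also have "\<dots> \<le> measure lborel (well_approx \<eta> Q \<inter> {u..v}) + measure lborel {u - ?c..u} + measure lborel {v..v + ?c}"
    by (intro order_trans[OF measure_Un_le] add_right_mono measure_Un_le) auto
  also have "measure lborel {u - ?c..u} = ?c" by simp
  also have "measure lborel {v..v + ?c} = ?c" by simp
  finally have "\<eta> * \<Sigma> \<le> measure lborel (well_approx \<eta> Q \<inter> {u..v}) + 64 / (real Q)\<^sup>2" by simp
  moreover have "\<eta> * (3/4 * (v - u) - 3 / sqrt (real Q)) \<le> \<eta> * \<Sigma>"
    using \<Sigma> \<eta> by (intro mult_left_mono) auto
  ultimately show ?thesis by linarith
qed

section \<open>Divergence over the scales for almost every rotation number\<close>

lemma sum_measure_le_of_pointwise:
  fixes w :: "'i \<Rightarrow> real"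
  assumes T: "finite T" and Y: "Y \<in> fmeasurable M" and B: "\<And>k. k \<in> T \<Longrightarrow> B k \<in> sets M"
    and le: "\<And>x. x \<in> Y \<Longrightarrow> (\<Sum>k\<in>T. w k * indicator (B k) x) \<le> C"
  shows "(\<Sum>k\<in>T. w k * measure M (B k \<inter> Y)) \<le> C * measure M Y"
proof -
  have fm: "B k \<inter> Y \<in> fmeasurable M" if "k \<in> T" for k
    using fmeasurable_Int_fmeasurable[OF Y B[OF that]] by (simp only: Int_commute)
  have int: "integrable M (indicat_real X)" if "X \<in> fmeasurable M" for X
    using that by (simp add: fmeasurable_def)
  have eq: "(\<integral>x. indicat_real X x \<partial>M) = measure M X" if "X \<in> fmeasurable M" for X
    using that by (simp add: fmeasurable_def Int_absorb2 sets.sets_into_space)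
  have i1: "integrable M (\<lambda>x. \<Sum>k\<in>T. w k * indicat_real (B k \<inter> Y) x)"
    using fm int by (intro Bochner_Integration.integrable_sum integrable_mult_right) blast
  have i2: "integrable M (\<lambda>x. C * indicat_real Y x)" using int[OF Y] by (intro integrable_mult_right)
  have "(\<Sum>k\<in>T. w k * measure M (B k \<inter> Y)) = (\<integral>x. (\<Sum>k\<in>T. w k * indicat_real (B k \<inter> Y) x) \<partial>M)"
    using fm int by (subst Bochner_Integration.integral_sum) (auto simp: eq)
  also have "\<dots> \<le> (\<integral>x. C * indicat_real Y x \<partial>M)"
  proof (rule integral_mono[OF i1 i2])
    fix x
    have "(\<Sum>k\<in>T. w k * indicat_real (B k \<inter> Y) x) = (\<Sum>k\<in>T. w k * indicator (B k) x) * indicat_real Y x"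
      by (simp add: sum_distrib_left sum_distrib_right indicator_inter_arith mult_ac)
    then show "(\<Sum>k\<in>T. w k * indicat_real (B k \<inter> Y) x) \<le> C * indicat_real Y x"
      using le[of x] by (auto simp: indicator_def)
  qed
  also have "\<dots> = C * measure M Y" using eq[OF Y] by simp
  finally show ?thesis .
qed

lemma eventually_measure_well_approx_ge:
  assumes Q: "filterlim Q at_top sequentially" and uv: "u < v" and \<eta>: "0 < \<eta>" "\<eta> \<le> 1/2"
  shows "\<forall>\<^sub>F k in sequentially. \<eta> * (v - u) / 2 \<le> measure lborel (well_approx \<eta> (Q k) \<inter> {u..v})"
proof -
  have lim: "(\<lambda>n::nat. \<eta> * (3/4 * (v - u) - 3 / sqrt (real n)) - 64 / (real n)\<^sup>2) \<longlonglongrightarrow> \<eta> * (3/4 * (v - u) - 0) - 0"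
  proof (intro tendsto_intros)
    show "(\<lambda>n. 3 / sqrt (real n)) \<longlonglongrightarrow> 0"
      by (rule real_tendsto_divide_at_top[OF tendsto_const])
        (rule filterlim_compose[OF sqrt_at_top filterlim_real_sequentially])
    show "(\<lambda>n. 64 / (real n)\<^sup>2) \<longlonglongrightarrow> 0"
      by (rule real_tendsto_divide_at_top[OF tendsto_const])
        (rule filterlim_pow_at_top[OF _ filterlim_real_sequentially], simp)
  qed
  have "\<eta> * (v - u) / 2 < \<eta> * (3/4 * (v - u) - 0) - 0" using uv \<eta> by simp
  then have "\<forall>\<^sub>F n::nat in sequentially. \<eta> * (v - u) / 2 < \<eta> * (3/4 * (v - u) - 3 / sqrt (real n)) - 64 / (real n)\<^sup>2"
    using lim by (rule order_tendstoD(1)[rotated])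
  then have "\<forall>\<^sub>F n::nat in sequentially. \<eta> * (v - u) / 2 \<le> measure lborel (well_approx \<eta> n \<inter> {u..v})"
    using eventually_gt_at_top[of "0::nat"]
  proof eventually_elim
    case (elim n)
    have "\<eta> * (3/4 * (v - u) - 3 / sqrt (real n)) - 64 / (real n)\<^sup>2 \<le> measure lborel (well_approx \<eta> n \<inter> {u..v})"
      using elim(2) uv \<eta> by (intro measure_well_approx_ge) auto
    then show ?case using elim(1) by linarith
  qed
  then show ?thesis using Q by (rule eventually_compose_filterlim)
qed

text \<open>A density argument takes the place of independence between scales. If the weighted sums
  stayed below \<open>C\<close> on a set of positive measure, choose an interval that this set fills
  up to a proportion \<open>\<eta> / 8\<close>. Every late event fills at least
  \<open>\<eta> / 2\<close> of the interval, so meets the set in at least 3/8 \<eta> of it;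
  integrating the weighted sums over the set then bounds the partial sums of
  \<open>w\<close>.\<close>

lemma AE_not_summable_well_approx:
  fixes w :: "nat \<Rightarrow> real"
  assumes Q: "filterlim Q at_top sequentially" and w: "\<And>k. 0 \<le> w k" "\<not> summable w" and \<eta>: "0 < \<eta>" "\<eta> \<le> 1/2"
  shows "AE \<alpha> in lborel. \<not> summable (\<lambda>k. if \<alpha> \<in> well_approx \<eta> (Q k) then w k else 0)"
proof -
  define s where "s = (\<lambda>n \<alpha>. \<Sum>k<n. w k * indicat_real (well_approx \<eta> (Q k)) \<alpha>)"
  define X where "X = (\<lambda>C::nat. {\<alpha>. \<forall>n. s n \<alpha> \<le> real C})"
  have X_meas [measurable]: "X C \<in> sets borel" for C
    unfolding X_def s_def by measurable
  have X_null: "X C \<in> null_sets lborel" for C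
  proof (rule ccontr)
    assume "X C \<notin> null_sets lborel"
    then have "emeasure lborel (X C) \<noteq> 0" by (auto simp: null_sets_def)
    moreover have "X C \<in> sets lborel" by simp
    ultimately obtain u v where uv: "u < v" "(1 - \<eta> / 8) * (v - u) \<le> measure lborel (X C \<inter> {u..v})"
      using exists_interval_of_high_density[of "X C" "\<eta> / 8"] \<eta> by auto
    define Y where "Y = X C \<inter> {u..v}"
    have Y: "Y \<in> fmeasurable lborel" unfolding Y_def by (rule fmeasurable_Int_interval) simp
    obtain k0 where k0: "\<And>k. k0 \<le> k \<Longrightarrow> \<eta> * (v - u) / 2 \<le> measure lborel (well_approx \<eta> (Q k) \<inter> {u..v})"
      using eventually_measure_well_approx_ge[OF Q uv(1) \<eta>] by (auto simp: eventually_sequentially)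
    define c where "c = 3/8 * \<eta> * (v - u)"
    have c: "c > 0" using uv \<eta> by (simp add: c_def)
    have ge: "c \<le> measure lborel (well_approx \<eta> (Q k) \<inter> Y)" if "k0 \<le> k" for k
    proof -
      let ?G = "well_approx \<eta> (Q k)"
      have fm: "?G \<inter> {u..v} \<in> fmeasurable lborel" by (rule fmeasurable_Int_interval) simp
      have "measure lborel ((?G \<inter> {u..v}) \<union> Y) + measure lborel ((?G \<inter> {u..v}) \<inter> Y) = measure lborel (?G \<inter> {u..v}) + measure lborel Y"
        using measure_Un3[OF fm Y] by simp
      moreover have "measure lborel ((?G \<inter> {u..v}) \<union> Y) \<le> measure lborel {u..v}"
        using fm Y by (intro measure_mono_fmeasurable fmeasurable_interval) (auto simp: Y_def)
      moreover have "(?G \<inter> {u..v}) \<inter> Y = ?G \<inter> Y" by (auto simp: Y_def)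
      then have "measure lborel ((?G \<inter> {u..v}) \<inter> Y) = measure lborel (?G \<inter> Y)" by (rule arg_cong)
      moreover have "measure lborel {u..v} = v - u" using uv by simp
      moreover have "(v - u) - \<eta> * (v - u) / 8 \<le> measure lborel Y"
        using uv(2) by (simp add: Y_def left_diff_distrib)
      moreover have "c = \<eta> * (v - u) / 2 - \<eta> * (v - u) / 8" by (simp add: c_def)
      ultimately show ?thesis using k0[OF that] by linarith
    qed
    have "(\<Sum>k<n. w k) \<le> (\<Sum>k<k0. w k) + real C * measure lborel Y / c" for n
    proof -
      have "(\<Sum>k<n. w k) \<le> (\<Sum>k\<in>{..<k0} \<union> {k0..<n}. w k)"
        using w by (intro sum_mono2) auto
      also have "\<dots> = (\<Sum>k<k0. w k) + (\<Sum>k\<in>{k0..<n}. w k)"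
        by (intro sum.union_disjoint) auto
      also have "(\<Sum>k\<in>{k0..<n}. w k) \<le> real C * measure lborel Y / c"
      proof -
        have "(\<Sum>k\<in>{k0..<n}. w k) * c \<le> (\<Sum>k\<in>{k0..<n}. w k * measure lborel (well_approx \<eta> (Q k) \<inter> Y))"
          unfolding sum_distrib_right using ge w by (intro sum_mono mult_left_mono) auto
        also have "\<dots> \<le> (\<Sum>k\<in>{..<n}. w k * measure lborel (well_approx \<eta> (Q k) \<inter> Y))"
          using w by (intro sum_mono2) auto
        also have "\<dots> \<le> real C * measure lborel Y"
          using Y by (intro sum_measure_le_of_pointwise) (auto simp: Y_def X_def s_def)
        finally show ?thesis using c by (simp add: field_simps)
      qed
      finally show ?thesis by simp
    qed
    then have "summable w" using w(1) by (intro summableI_nonneg_bounded)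
    then show False using w(2) by simp
  qed
  have "(\<Union>C. X C) \<in> null_sets lborel" using X_null by (intro null_sets_UN)
  moreover have "{\<alpha> \<in> space lborel. \<not> \<not> summable (\<lambda>k. if \<alpha> \<in> well_approx \<eta> (Q k) then w k else 0)} \<subseteq> (\<Union>C. X C)"
  proof
    fix \<alpha> assume "\<alpha> \<in> {\<alpha> \<in> space lborel. \<not> \<not> summable (\<lambda>k. if \<alpha> \<in> well_approx \<eta> (Q k) then w k else 0)}"
    then have "summable (\<lambda>k. if \<alpha> \<in> well_approx \<eta> (Q k) then w k else 0)" by simp
    moreover have "(\<lambda>k. if \<alpha> \<in> well_approx \<eta> (Q k) then w k else 0) = (\<lambda>k. w k * indicat_real (well_approx \<eta> (Q k)) \<alpha>)"
      by (auto simp: indicator_def)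
    ultimately have sm: "summable (\<lambda>k. w k * indicat_real (well_approx \<eta> (Q k)) \<alpha>)" by simp
    have "s n \<alpha> \<le> (\<Sum>k. w k * indicat_real (well_approx \<eta> (Q k)) \<alpha>)" for n
      unfolding s_def using sm w(1) by (intro sum_le_suminf) auto
    then have "\<alpha> \<in> X (nat \<lceil>\<Sum>k. w k * indicat_real (well_approx \<eta> (Q k)) \<alpha>\<rceil>)"
      unfolding X_def by (auto intro: order_trans[OF _ real_nat_ceiling_ge])
    then show "\<alpha> \<in> (\<Union>C. X C)" by blast
  qed
  ultimately show ?thesis by (rule AE_I')
qed

text \<open>
  Consecutive scales must grow by more than a factor \<open>ln (scale k)\<close> for the combs to be
  quasi-independent, but \<open>1 / ln (scale k)\<close> must not be summable.
\<close>

definition scale :: "nat \<Rightarrow> nat" where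
  "scale k = (fact k)\<^sup>2"

lemma scale_pos: "0 < scale k" by (simp add: scale_def)

lemma scale_Suc: "scale (Suc k) = (Suc k)\<^sup>2 * scale k"
  by (simp add: scale_def power2_eq_square algebra_simps)

lemma scale_mono: "l \<le> k \<Longrightarrow> scale l \<le> scale k"
  by (auto simp: scale_def intro!: power_mono fact_mono)

lemma filterlim_scale: "filterlim scale at_top sequentially"
proof (rule filterlim_at_top_mono[OF filterlim_ident])
  have "k \<le> scale k" for k
    using fact_ge_self[of k] by (simp add: scale_def power2_eq_square) (metis fact_ge_1 le_trans mult_le_mono2 nat_mult_1_right)
  then show "\<forall>\<^sub>F k in sequentially. k \<le> scale k" by simp
qed

lemma ln_scale_le: "ln (real (scale k)) \<le> 2 * real k * ln (real k + 1)"
proof -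
  have "ln (real (scale k)) = 2 * ln (fact k)"
    by (simp add: scale_def ln_realpow)
  also have "(fact k :: real) \<le> (real k + 1) ^ k"
  proof -
    have "(fact k :: nat) \<le> k ^ k" by (metis fact_le_power of_nat_id)
    then have "(fact k :: real) \<le> real k ^ k" by (metis of_nat_fact of_nat_le_iff of_nat_power)
    also have "\<dots> \<le> (real k + 1) ^ k" by (intro power_mono) auto
    finally show ?thesis .
  qed
  then have "ln (fact k :: real) \<le> ln ((real k + 1) ^ k)" by simp
  also have "\<dots> = real k * ln (real k + 1)" by (simp add: ln_realpow)
  finally show ?thesis by simp
qed

text \<open>Comparison with 1 / (k ln k), whose condensation is the harmonic series. At k = 0 and k
  = 1 the logarithm is 0 and the quotient has the default value 0, so the comparison starts at
  2.\<close>

lemma not_summable_inverse_ln_scale: "\<not> summable (\<lambda>k. 1 / ln (real (scale k)))"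
proof
  assume s: "summable (\<lambda>k. 1 / ln (real (scale k)))"
  define f where "f = (\<lambda>n. 1 / (real n * ln (real n + 1)))"
  have "summable f"
  proof (rule summable_comparison_test_ev)
    show "summable (\<lambda>k. 2 * (1 / ln (real (scale k))))" using s by (rule summable_mult)
    show "\<forall>\<^sub>F k in sequentially. norm (f k) \<le> 2 * (1 / ln (real (scale k)))"
      using eventually_ge_at_top[of 2]
    proof eventually_elim
      case (elim k)
      have "scale 2 \<le> scale k" using elim by (rule scale_mono)
      then have "4 \<le> scale k" by (simp add: scale_def[of 2] fact_numeral)
      then have "1 < real (scale k)" by linarith
      then have pos: "0 < ln (real (scale k))" by simp
      have "1 / (2 * (real k * ln (real k + 1))) \<le> 1 / ln (real (scale k))"
        using ln_scale_le[of k, unfolded mult.assoc] pos elim by (intro divide_left_mono) auto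
      then have "2 * (1 / (2 * (real k * ln (real k + 1)))) \<le> 2 * (1 / ln (real (scale k)))"
        by (rule mult_left_mono) simp
      moreover have "2 * (1 / (2 * (real k * ln (real k + 1)))) = norm (f k)"
        using elim by (simp add: f_def abs_mult)
      ultimately show ?case by simp
    qed
  qed
  moreover have "summable f \<longleftrightarrow> summable (\<lambda>n. 2 ^ n * f (2 ^ n))"
  proof (rule condensation_test)
    show "f (Suc m) \<le> f m" if "0 < m" for m
      unfolding f_def using that by (intro divide_left_mono mult_mono) auto
    show "0 \<le> f n" for n by (simp add: f_def)
  qed
  ultimately have s2: "summable (\<lambda>n. 2 ^ n * f (2 ^ n))" by simp
  have "summable (\<lambda>n. inverse (real (Suc n)))"
  proof (rule summable_comparison_test'[OF s2])
    fix n :: nat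
    have "ln ((2::real) ^ n + 1) \<le> ln (2 ^ Suc n)" by (subst ln_le_cancel_iff) (auto simp: add_pos_pos)
    also have "\<dots> = real (Suc n) * ln 2" by (rule ln_realpow)
    also have "\<dots> \<le> real (Suc n) * 1" using ln_2_less_1 by (intro mult_left_mono) auto
    finally have le: "ln ((2::real) ^ n + 1) \<le> real (Suc n)" by simp
    have "1 < (2::real) ^ n + 1" by simp
    then have "0 < ln ((2::real) ^ n + 1)" by (rule ln_gt_zero)
    then have "1 / real (Suc n) \<le> 1 / ln ((2::real) ^ n + 1)"
      using le by (intro divide_left_mono mult_pos_pos) auto
    then show "norm (inverse (real (Suc n))) \<le> 2 ^ n * f (2 ^ n)"
      by (simp add: f_def inverse_eq_divide)
  qed
  then show False
    using not_summable_harmonic[where 'a=real] summable_Suc_iff[of "\<lambda>n. inverse (real n)"] by blast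
qed

section \<open>Sawtooth sums\<close>

lemma bij_betw_affine_mod:
  fixes g t :: int
  assumes cop: "coprime t (int k)" and k: "k > 0"
  shows "bij_betw (\<lambda>i. nat ((g + int i * t) mod int k)) {..<k} {..<k}"
proof -
  let ?\<sigma> = "\<lambda>i. nat ((g + int i * t) mod int k)"
  have into: "?\<sigma> ` {..<k} \<subseteq> {..<k}" using k by (auto simp: nat_less_iff)
  have inj: "inj_on ?\<sigma> {..<k}"
  proof (rule inj_onI)
    fix i j assume ij: "i \<in> {..<k}" "j \<in> {..<k}" "?\<sigma> i = ?\<sigma> j"
    then have "(g + int i * t) mod int k = (g + int j * t) mod int k"
      using k by (simp add: nat_eq_iff)
    then have "int k dvd (g + int i * t) - (g + int j * t)" by (simp add: mod_eq_dvd_iff)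
    then have "int k dvd (int i - int j) * t" by (simp add: algebra_simps)
    then have "int k dvd int i - int j"
      using cop by (simp add: coprime_dvd_mult_left_iff coprime_commute)
    moreover have "\<bar>int i - int j\<bar> < int k" using ij by auto
    ultimately have "int i - int j = 0" by (metis dvd_imp_le_int int_nat_eq linorder_not_less abs_of_nat)
    then show "i = j" by simp
  qed
  show ?thesis using inj into endo_inj_surj[of "{..<k}" ?\<sigma>] by (auto simp: bij_betw_def)
qed

text \<open>Modulo 1 the points \<gamma> + i \<beta> follow the translated grid (l + c) / k, using
  each grid point once, with displacement at most 1 / k. The grid itself contributes c - 1/2, the
  displacements 1 in total, and the two cells next to the jump of \<open>frac\<close> at most 1
  each.\<close>

lemma sawtooth_block_sum_le:
  fixes \<beta> \<gamma> :: real
  assumes k: "k > 0" and cop: "coprime t (int k)" and close: "\<bar>real k * \<beta> - of_int t\<bar> \<le> 1 / real k"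
  shows "\<bar>\<Sum>i<k. frac (\<gamma> + real i * \<beta>) - 1/2\<bar> \<le> 4"
proof -
  define g where "g = \<lfloor>real k * \<gamma>\<rfloor>"
  define c where "c = frac (real k * \<gamma>)"
  define \<sigma> where "\<sigma> = (\<lambda>i. nat ((g + int i * t) mod int k))"
  define z where "z = (\<lambda>l. (real l + c) / real k)"
  define d where "d = (\<lambda>l. 1 / real k + (if l = 0 \<or> l = k - 1 then 1 else 0))"
  have bij: "bij_betw \<sigma> {..<k} {..<k}" unfolding \<sigma>_def by (rule bij_betw_affine_mod[OF cop k])
  have c: "0 \<le> c" "c < 1" by (auto simp: c_def frac_lt_1)
  have \<gamma>: "\<gamma> = (of_int g + c) / real k" using k by (simp add: g_def c_def frac_def)
  have near: "\<bar>frac (\<gamma> + real i * \<beta>) - z (\<sigma> i)\<bar> \<le> d (\<sigma> i)" if i: "i < k" for i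
  proof -
    define e where "e = real i * (\<beta> - of_int t / real k)"
    define q where "q = (g + int i * t) div int k"
    have \<sigma>i: "int (\<sigma> i) = (g + int i * t) mod int k" "\<sigma> i < k"
      using k by (auto simp: \<sigma>_def nat_less_iff)
    have "g + int i * t = int k * q + int (\<sigma> i)" by (simp add: \<sigma>i q_def)
    then have "real_of_int (g + int i * t) = real k * of_int q + real (\<sigma> i)" by simp
    then have E: "of_int g + real i * of_int t + c = real k * of_int q + (real (\<sigma> i) + c)" by simp
    have "\<gamma> + real i * \<beta> = (of_int g + real i * of_int t + c) / real k + e"
      using k by (simp add: \<gamma> e_def field_simps)
    also have "\<dots> = of_int q + (z (\<sigma> i) + e)"
      unfolding E using k by (simp add: z_def add_divide_distrib)
    finally have "\<gamma> + real i * \<beta> = of_int q + (z (\<sigma> i) + e)" .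
    then have fr: "frac (\<gamma> + real i * \<beta>) = frac (z (\<sigma> i) + e)"
      by (simp add: frac_def)
    have e: "\<bar>e\<bar> \<le> 1 / real k"
    proof -
      have "\<bar>e\<bar> = real i / real k * \<bar>real k * \<beta> - of_int t\<bar>"
      proof -
        have "e = real i / real k * (real k * \<beta> - of_int t)" using k by (simp add: e_def field_simps)
        then show ?thesis by (simp add: abs_mult)
      qed
      also have "\<dots> \<le> 1 * (1 / real k)" using i close by (intro mult_mono) auto
      finally show ?thesis by simp
    qed
    have z: "0 \<le> z (\<sigma> i)" "z (\<sigma> i) < 1"
      using c \<sigma>i k by (auto simp: z_def)
    show ?thesis
    proof (cases "\<sigma> i = 0 \<or> \<sigma> i = k - 1")
      case True
      have "0 \<le> frac (z (\<sigma> i) + e)" "frac (z (\<sigma> i) + e) < 1" by (auto simp: frac_lt_1)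
      then have "\<bar>frac (z (\<sigma> i) + e) - z (\<sigma> i)\<bar> \<le> 1" using z by linarith
      then show ?thesis using True k by (auto simp: d_def fr intro: order_trans)
    next
      case False
      then have "1 \<le> \<sigma> i" "\<sigma> i + 2 \<le> k" using \<sigma>i by auto
      then have b: "1 \<le> real (\<sigma> i) + c" "real (\<sigma> i) + c < real k - 1" using c by linarith+
      have "1 / real k \<le> z (\<sigma> i)" unfolding z_def using b k by (intro divide_right_mono) auto
      moreover have "z (\<sigma> i) < (real k - 1) / real k"
        unfolding z_def using b k by (intro divide_strict_right_mono) auto
      then have "z (\<sigma> i) < 1 - 1 / real k" using k by (simp add: diff_divide_distrib)
      ultimately have "frac (z (\<sigma> i) + e) = z (\<sigma> i) + e"
        using e by (subst frac_eq) linarith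
      then show ?thesis using e False by (simp add: d_def fr)
    qed
  qed
  have "(\<Sum>i<k. d (\<sigma> i)) = (\<Sum>l<k. d l)" by (rule sum.reindex_bij_betw[OF bij])
  also have "\<dots> \<le> 3"
  proof -
    have "(\<Sum>l<k. if l = 0 \<or> l = k - 1 then 1 else (0::real)) = real (card {l \<in> {..<k}. l = 0 \<or> l = k - 1})"
      by (simp add: sum.inter_filter[symmetric])
    also have "card {l \<in> {..<k}. l = 0 \<or> l = k - 1} \<le> card {0, k - 1}"
      by (intro card_mono) auto
    also have "\<dots> \<le> 2" by (simp add: card_insert_if)
    finally have "(\<Sum>l<k. if l = 0 \<or> l = k - 1 then 1 else (0::real)) \<le> 2" by simp
    then show ?thesis using k by (simp add: d_def sum.distrib)
  qed
  finally have sd: "(\<Sum>i<k. d (\<sigma> i)) \<le> 3" .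
  have "(\<Sum>i<k. z (\<sigma> i)) = (\<Sum>l<k. z l)" by (rule sum.reindex_bij_betw[OF bij])
  also have "\<dots> = (\<Sum>l<k. real l) / real k + c"
    using k by (simp add: z_def sum_divide_distrib[symmetric] sum.distrib add_divide_distrib)
  also have "(\<Sum>l<k. real l) = real k * (real k - 1) / 2"
    by (induction k) (auto simp: field_simps)
  also have "real k * (real k - 1) / 2 / real k + c = (real k - 1) / 2 + c" using k by simp
  finally have sz: "(\<Sum>i<k. z (\<sigma> i)) = (real k - 1) / 2 + c" .
  have "\<bar>(\<Sum>i<k. frac (\<gamma> + real i * \<beta>)) - (\<Sum>i<k. z (\<sigma> i))\<bar> \<le> (\<Sum>i<k. \<bar>frac (\<gamma> + real i * \<beta>) - z (\<sigma> i)\<bar>)"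
    unfolding sum_subtractf[symmetric] by (rule sum_abs)
  also have "\<dots> \<le> (\<Sum>i<k. d (\<sigma> i))" using near by (intro sum_mono) auto
  finally have A: "\<bar>(\<Sum>i<k. frac (\<gamma> + real i * \<beta>)) - (\<Sum>i<k. z (\<sigma> i))\<bar> \<le> 3" using sd by linarith
  have "(\<Sum>i<k. frac (\<gamma> + real i * \<beta>) - 1/2) = (\<Sum>i<k. frac (\<gamma> + real i * \<beta>)) - real k / 2"
    by (simp add: sum_subtractf)
  moreover have "\<bar>S1\<bar> \<le> 4" if "S1 = S2 - real k / 2" "\<bar>S2 - Z\<bar> \<le> 3" "Z = (real k - 1) / 2 + c" for S1 S2 Z
  proof -
    have "S1 = (S2 - Z) + (c - 1/2)" using that by (simp add: diff_divide_distrib)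
    then show ?thesis using that(2) c by linarith
  qed
  ultimately show ?thesis using A sz by blast
qed

lemma sum_lessThan_add:
  fixes g :: "nat \<Rightarrow> real"
  shows "(\<Sum>i<n + m. g i) = (\<Sum>i<n. g i) + (\<Sum>i<m. g (n + i))"
  by (induction m) (simp_all add: add.assoc)

text \<open>Recursive decomposition by Dirichlet denominators k: a block of length k sums to at most
  4, and \<open>H\<close> leaves at most 32 sqrt L blocks. The remainder has length at most L / 2,
  whose root is at most 3/4 sqrt L; 4 * 32 + 600 * 3/4 \<le> 600 closes the induction.\<close>

lemma sawtooth_sum_le:
  fixes \<beta> \<gamma> :: real
  assumes H: "\<And>k L l. \<lbrakk>0 < k; k \<le> L; L \<le> N; \<bar>real k * \<beta> - of_int l\<bar> < 1 / real L\<rbrakk> \<Longrightarrow> L \<le> 1024 * k\<^sup>2"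
    and L: "L \<le> N"
  shows "\<bar>\<Sum>i<L. frac (\<gamma> + real i * \<beta>) - 1/2\<bar> \<le> 600 * sqrt (real L)"
  using L
proof (induction L arbitrary: \<gamma> rule: less_induct)
  case (less L)
  show ?case
  proof (cases "L = 0")
    case False
    then have L0: "L > 0" by simp
    obtain t k' where tk: "coprime t k'" "0 < k'" "k' \<le> int L" "\<bar>of_int k' * \<beta> - of_int t\<bar> < 1 / real L"
      using Dirichlet_approx_coprime[OF L0] by metis
    define k where "k = nat k'"
    have k': "k' = int k" using tk by (simp add: k_def)
    have k: "k > 0" "k \<le> L" "coprime t (int k)" "\<bar>real k * \<beta> - of_int t\<bar> < 1 / real L"
      using tk by (auto simp: k')
    have big: "L \<le> 1024 * k\<^sup>2" using H[OF k(1,2) less.prems k(4)] .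
    have close: "\<bar>real k * \<beta> - of_int t\<bar> \<le> 1 / real k"
    proof -
      have "1 / real L \<le> 1 / real k" using k L0 by (intro divide_left_mono) auto
      then show ?thesis using k(4) by linarith
    qed
    define f where "f = (\<lambda>i. frac (\<gamma> + real i * \<beta>) - 1/2)"
    let ?b = "L div k" and ?r = "L mod k"
    have Lbr: "L = ?b * k + ?r" by simp
    have "(\<Sum>i<L. f i) = (\<Sum>i<?b * k + ?r. f i)" by simp
    also have "\<dots> = (\<Sum>i<?b * k. f i) + (\<Sum>i<?r. f (?b * k + i))"
      by (rule sum_lessThan_add)
    also have "(\<Sum>i<?b * k. f i) = (\<Sum>m<?b. \<Sum>i\<in>{m * k..<m * k + k}. f i)"
      by (rule sum.nat_group[symmetric])
    finally have split: "(\<Sum>i<L. f i) = (\<Sum>m<?b. \<Sum>i\<in>{m * k..<m * k + k}. f i) + (\<Sum>i<?r. f (?b * k + i))" .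
    have "\<bar>\<Sum>i\<in>{m * k..<m * k + k}. f i\<bar> \<le> 4" for m
    proof -
      have "(\<Sum>i\<in>{m * k..<m * k + k}. f i) = (\<Sum>i<k. f (m * k + i))"
        by (rule sum.reindex_bij_witness[of _ "\<lambda>i. m * k + i" "\<lambda>i. i - m * k"]) auto
      also have "\<dots> = (\<Sum>i<k. frac ((\<gamma> + real (m * k) * \<beta>) + real i * \<beta>) - 1/2)"
        by (simp add: f_def algebra_simps)
      finally show ?thesis using sawtooth_block_sum_le[OF k(1,3) close] by simp
    qed
    then have "(\<Sum>m<?b. \<bar>\<Sum>i\<in>{m * k..<m * k + k}. f i\<bar>) \<le> (\<Sum>m<?b. 4)"
      by (rule sum_mono)
    then have "\<bar>\<Sum>m<?b. \<Sum>i\<in>{m * k..<m * k + k}. f i\<bar> \<le> (\<Sum>m<?b. 4)"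
      by (rule order_trans[OF sum_abs])
    then have P1: "\<bar>\<Sum>m<?b. \<Sum>i\<in>{m * k..<m * k + k}. f i\<bar> \<le> 4 * real ?b" by simp
    have r: "?r < L" "2 * ?r \<le> L"
    proof -
      have "?b \<ge> 1" using k by (simp add: div_greater_zero_iff Suc_le_eq)
      then have "k \<le> ?b * k" by simp
      moreover have "?r < k" using k by simp
      ultimately show "?r < L" "2 * ?r \<le> L" using Lbr by linarith+
    qed
    have "(\<Sum>i<?r. f (?b * k + i)) = (\<Sum>i<?r. frac ((\<gamma> + real (?b * k) * \<beta>) + real i * \<beta>) - 1/2)"
      by (simp add: f_def algebra_simps)
    then have P2: "\<bar>\<Sum>i<?r. f (?b * k + i)\<bar> \<le> 600 * sqrt (real ?r)"
      using less.IH[OF r(1)] less.prems r(1) by simp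
    have s1: "sqrt (real ?r) \<le> 3/4 * sqrt (real L)"
    proof (rule real_le_lsqrt)
      have "real (2 * ?r) \<le> real L" using r(2) by (simp only: of_nat_le_iff)
      then show "real ?r \<le> (3/4 * sqrt (real L))\<^sup>2" by (simp add: power_mult_distrib power2_eq_square)
    qed auto
    have s2: "real ?b \<le> 32 * sqrt (real L)"
    proof -
      have "real L \<le> (32 * real k)\<^sup>2"
      proof -
        have "real L \<le> real (1024 * k\<^sup>2)" using big by (simp only: of_nat_le_iff)
        then show ?thesis by (simp add: power_mult_distrib)
      qed
      then have "sqrt (real L) \<le> 32 * real k" by (rule real_le_lsqrt[rotated]) auto
      then have "sqrt (real L) * sqrt (real L) \<le> 32 * real k * sqrt (real L)" by (rule mult_right_mono) simp
      then have "real L \<le> (32 * sqrt (real L)) * real k" by (simp add: mult_ac)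
      moreover have "real ?b * real k \<le> real L"
        by (metis of_nat_mult of_nat_mono div_times_less_eq_dividend)
      ultimately have "real ?b * real k \<le> (32 * sqrt (real L)) * real k" by linarith
      then show ?thesis using k by simp
    qed
    have "\<bar>\<Sum>i<L. f i\<bar> \<le> 4 * real ?b + 600 * sqrt (real ?r)"
      using P1 P2 split by linarith
    also have "\<dots> \<le> 600 * sqrt (real L)" using s1 s2 real_sqrt_ge_zero[of "real L"] by linarith
    finally show ?thesis by (simp add: f_def)
  qed simp
qed

text \<open>Duality between p / N and r / N: m = k r - l N satisfies m p = k modulo N. A good
  approximation of r / N with denominator \<open>k\<close> thus produces a small multiplier |m| with
  small residue \<open>k\<close>, which the last clause of \<open>well_placed\<close> restricts to N
  \<le> 1024 |m| k^2, while |m| L < N.\<close>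

lemma well_placed_inverse_badly_approximable:
  assumes wp: "well_placed Q N p" and r: "int N dvd r * p - 1"
    and kL: "0 < k" "k \<le> L" "L \<le> N" and ap: "\<bar>real k * (of_int r / real N) - of_int l\<bar> < 1 / real L"
  shows "L \<le> 1024 * k\<^sup>2"
proof -
  have N: "N > 0" using wp by (simp add: well_placed_def)
  define m where "m = int k * r - l * int N"
  have "real k * (of_int r / real N) - of_int l = of_int m / real N"
    using N by (simp add: m_def field_simps)
  then have "\<bar>real_of_int m\<bar> / real N < 1 / real L" using ap by simp
  then have "\<bar>real_of_int m\<bar> * real L < real N"
    using N kL by (simp add: field_simps)
  then have "real_of_int (\<bar>m\<bar> * int L) < real_of_int (int N)" by simp
  then have mL: "\<bar>m\<bar> * int L < int N" by (rule of_int_less_iff[THEN iffD1])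
  obtain s where s: "r * p - 1 = int N * s" using r by (auto simp: dvd_def)
  have mp: "m * p = int k + int N * (int k * s - l * p)"
  proof -
    have "m * p = int k * (r * p) - l * int N * p" by (simp add: m_def algebra_simps)
    also have "r * p = 1 + int N * s" using s by simp
    finally show ?thesis by (simp add: algebra_simps)
  qed
  show ?thesis
  proof (cases "m = 0")
    case True
    then have "int N dvd int k" using mp by (metis add_diff_cancel_right' dvd_0_right dvd_diff dvd_triv_left mult_zero_left add.commute dvd_add_right_iff)
    then have "N \<le> k" using kL by (simp add: dvd_imp_le)
    then have "L \<le> k" using kL by simp
    also have "k \<le> 1024 * k\<^sup>2" using kL by (simp add: power2_eq_square)
    finally show ?thesis .
  next
    case False
    define x where "x = int k * s - l * p"
    have m: "0 < \<bar>m\<bar>" "\<bar>m\<bar> < int N"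
    proof -
      show "0 < \<bar>m\<bar>" using False by simp
      have "\<bar>m\<bar> * 1 \<le> \<bar>m\<bar> * int L" using kL by (intro mult_left_mono) auto
      then show "\<bar>m\<bar> < int N" using mL by simp
    qed
    have "int N \<le> 1024 * \<bar>m\<bar> * (\<bar>m\<bar> * p - (sgn m * x) * int N)\<^sup>2"
      using wp m unfolding well_placed_def by blast
    moreover have "\<bar>m\<bar> * p - (sgn m * x) * int N = sgn m * int k"
    proof -
      have "\<bar>m\<bar> * p - (sgn m * x) * int N = sgn m * (m * p - int N * x)"
        by (simp add: abs_sgn algebra_simps)
      also have "m * p - int N * x = int k" using mp by (simp add: x_def)
      finally show ?thesis .
    qed
    moreover have "(sgn m * int k)\<^sup>2 = (int k)\<^sup>2"
      using False by (simp add: power_mult_distrib power2_eq_square sgn_if)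
    ultimately have "int N \<le> 1024 * \<bar>m\<bar> * (int k)\<^sup>2" by simp
    then have "\<bar>m\<bar> * int L < \<bar>m\<bar> * (1024 * (int k)\<^sup>2)" using mL by (simp add: mult_ac)
    then have "int L < 1024 * (int k)\<^sup>2" using m by (simp add: mult_less_cancel_left_pos)
    then have "int L < int (1024 * k\<^sup>2)" by simp
    then show ?thesis by linarith
  qed
qed

section \<open>Lattice sums of a function with a logarithmic singularity\<close>

lemma abs_diff_le_of_deriv_le:
  fixes F G :: "real \<Rightarrow> real"
  assumes ab: "a \<le> b"
    and F: "\<And>x. \<lbrakk>a \<le> x; x \<le> b\<rbrakk> \<Longrightarrow> (F has_real_derivative F' x) (at x)"
    and G: "\<And>x. \<lbrakk>a \<le> x; x \<le> b\<rbrakk> \<Longrightarrow> (G has_real_derivative G' x) (at x)"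
    and le: "\<And>x. \<lbrakk>a \<le> x; x \<le> b\<rbrakk> \<Longrightarrow> \<bar>F' x\<bar> \<le> G' x"
  shows "\<bar>F b - F a\<bar> \<le> G b - G a"
proof -
  have "G a - F a \<le> G b - F b"
  proof (rule DERIV_nonneg_imp_nondecreasing[OF ab])
    fix x assume "a \<le> x" "x \<le> b"
    then show "\<exists>y. ((\<lambda>x. G x - F x) has_real_derivative y) (at x) \<and> 0 \<le> y"
      using F G le by (intro exI[of _ "G' x - F' x"]) (auto intro!: DERIV_diff simp: abs_le_iff)
  qed
  moreover have "G a + F a \<le> G b + F b"
  proof (rule DERIV_nonneg_imp_nondecreasing[OF ab])
    fix x assume "a \<le> x" "x \<le> b"
    then show "\<exists>y. ((\<lambda>x. G x + F x) has_real_derivative y) (at x) \<and> 0 \<le> y"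
      using F[of x] G[of x] le[of x] by (intro exI[of _ "G' x + F' x"] conjI DERIV_add) (auto simp: abs_le_iff)
  qed
  ultimately show ?thesis by (simp add: abs_le_iff)
qed

lemma has_integral_one_minus:
  fixes f :: "real \<Rightarrow> real"
  assumes "(f has_integral i) {0..1}"
  shows "((\<lambda>x. f (1 - x)) has_integral i) {0..1}"
proof -
  have i: "(f has_integral i) (cbox 0 1)" using assms by simp
  have "bij_betw (\<lambda>x. 1 - x) {0..1::real} {0..1}"
    by (rule bij_betw_byWitness[where f' = "\<lambda>x. 1 - x"]) auto
  then have im: "(\<lambda>x::real. 1 - x) ` {0..1} = {0..1}" by (rule bij_betw_imp_surj_on)
  show ?thesis using has_integral_affinity[OF i, of "-1" 1] by (simp add: im)
qed

text \<open>Power majorants of the singularities at both ends of a cell, chosen over logarithms for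
  their simple integrals and primitives: exponent -3/2 for first derivatives, -1/2 for the
  functions, and -3/4 where a small factor has to be split off.\<close>

definition edge :: "real \<Rightarrow> real \<Rightarrow> real" where
  "edge a u = u powr a + (1 - u) powr a"

lemma has_integral_edge:
  assumes "-1 < a"
  shows "(edge a has_integral 2 / (a + 1)) {0..1}"
proof -
  have "((\<lambda>u. u powr a) has_integral (1 powr (a + 1) / (a + 1))) {0..1}"
    using assms by (intro has_integral_powr_from_0) auto
  then have 1: "((\<lambda>u. u powr a) has_integral (1 / (a + 1))) {0..1}" by simp
  have "((\<lambda>u. u powr a + (1 - u) powr a) has_integral (1 / (a + 1) + 1 / (a + 1))) {0..1}"
    by (intro has_integral_add 1 has_integral_one_minus[OF 1])
  then show ?thesis by (simp add: edge_def[abs_def] add_divide_distrib[symmetric])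
qed

lemma has_integral_le_interior:
  fixes g h :: "real \<Rightarrow> real"
  assumes g: "(g has_integral i) {0..1}" and h: "(h has_integral j) {0..1}"
    and le: "\<And>u. \<lbrakk>0 < u; u < 1\<rbrakk> \<Longrightarrow> g u \<le> h u"
  shows "i \<le> j"
proof -
  let ?h = "\<lambda>u. if u \<in> {0<..<1} then h u else g u"
  have "(?h has_integral j) {0..1}"
    using has_integral_spike_interior[of h j 0 1 ?h] h by simp
  then show ?thesis by (rule has_integral_le[OF g]) (use le in auto)
qed

lemma edge_ge_inverse:
  assumes "0 < u" "u < 1" shows "1 / u + 1 / (1 - u) \<le> edge (-3/2) u"
proof -
  have "1 / t \<le> t powr (-3/2)" if "0 < t" "t < 1" for t :: real
  proof -
    have "1 / t = t powr (-1)" using that by (simp add: powr_minus divide_inverse)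
    also have "\<dots> \<le> t powr (-3/2)" using that by (intro powr_mono') auto
    finally show ?thesis .
  qed
  from this[of u] this[of "1 - u"] show ?thesis using assms by (simp add: edge_def)
qed

text \<open>Applies to the function on one period, with constant \<open>C\<close>, and to its
  lattice sums on one cell, with constant \<open>2 * C\<close> whatever the number of
  points.\<close>

locale inverse_square_second_derivative =
  fixes g g' g'' :: "real \<Rightarrow> real" and C :: real
  assumes deriv: "\<And>t. \<lbrakk>0 < t; t < 1\<rbrakk> \<Longrightarrow> (g has_real_derivative g' t) (at t)"
    and deriv2: "\<And>t. \<lbrakk>0 < t; t < 1\<rbrakk> \<Longrightarrow> (g' has_real_derivative g'' t) (at t)"
    and bound2: "\<And>t. \<lbrakk>0 < t; t < 1\<rbrakk> \<Longrightarrow> \<bar>g'' t\<bar> \<le> C * (1 / t\<^sup>2 + 1 / (1 - t)\<^sup>2)"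
begin

lemma C_nonneg: "0 \<le> C"
  using bound2[of "1/2"] by (simp add: power2_eq_square)

lemma bound1:
  assumes u: "0 < u" "u < 1"
  shows "\<bar>g' u - g' (1/2)\<bar> \<le> C * (1 / u + 1 / (1 - u))"
proof -
  let ?G = "\<lambda>t. C * (1 / (1 - t) - 1 / t)"
  have G: "(?G has_real_derivative C * (1 / t\<^sup>2 + 1 / (1 - t)\<^sup>2)) (at t)" if "0 < t" "t < 1" for t
    by ((rule derivative_eq_intros refl | (use that in linarith))+) (use that in \<open>simp add: power2_eq_square field_simps\<close>)
  have le: "\<bar>?G u\<bar> \<le> C * (1 / u + 1 / (1 - u))"
    using u C_nonneg unfolding abs_mult by (intro mult_mono) (auto simp: abs_le_iff)
  show ?thesis
  proof (cases "u \<le> 1/2")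
    case True
    have "\<bar>g' (1/2) - g' u\<bar> \<le> ?G (1/2) - ?G u"
      using True u by (intro abs_diff_le_of_deriv_le[OF True deriv2 G bound2]) auto
    then show ?thesis using le by (simp add: abs_minus_commute)
  next
    case False
    have "\<bar>g' u - g' (1/2)\<bar> \<le> ?G u - ?G (1/2)"
      using False u by (intro abs_diff_le_of_deriv_le[OF _ deriv2 G bound2]) auto
    then show ?thesis using le by simp
  qed
qed

lemma bound0:
  assumes u: "0 < u" "u < 1"
  shows "\<bar>g u - g (1/2) - g' (1/2) * (u - 1/2)\<bar> \<le> 2 * C * edge (-1/2) u"
proof -
  let ?F = "\<lambda>t. g t - g' (1/2) * t"
  let ?H = "\<lambda>t. 2 * C * ((1 - t) powr (-1/2) - t powr (-1/2))"
  have F: "(?F has_real_derivative g' t - g' (1/2)) (at t)" if "0 < t" "t < 1" for t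
    using deriv[OF that] by (auto intro!: derivative_eq_intros)
  have H: "(?H has_real_derivative C * edge (-3/2) t) (at t)" if "0 < t" "t < 1" for t
    using that by (auto intro!: derivative_eq_intros simp: edge_def algebra_simps)
  have FH: "\<bar>g' t - g' (1/2)\<bar> \<le> C * edge (-3/2) t" if "0 < t" "t < 1" for t
    using bound1[OF that] mult_left_mono[OF edge_ge_inverse[OF that] C_nonneg] by linarith
  have le: "\<bar>?H u\<bar> \<le> 2 * C * edge (-1/2) u"
    using u C_nonneg unfolding abs_mult edge_def by (intro mult_mono) (auto simp: abs_le_iff)
  show ?thesis
  proof (cases "u \<le> 1/2")
    case True
    have "\<bar>?F (1/2) - ?F u\<bar> \<le> ?H (1/2) - ?H u"
      using True u by (intro abs_diff_le_of_deriv_le[OF True F H FH]) auto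
    then show ?thesis using le by (simp add: algebra_simps abs_minus_commute)
  next
    case False
    have "\<bar>?F u - ?F (1/2)\<bar> \<le> ?H u - ?H (1/2)"
      using False u by (intro abs_diff_le_of_deriv_le[OF _ F H FH]) auto
    then show ?thesis using le by (simp add: algebra_simps)
  qed
qed

text \<open>\<open>bound0\<close> leaves the value and the slope at the midpoint open. The linear
  term is odd about 1/2 and integrates to 0, so mean zero bounds the value by the integral
  \<open>8 * C\<close> of the error, and \<open>edge (-1/2) u \<ge> 1\<close> absorbs it. The slope
  cannot be removed: for lattice sums it is bounded only logarithmically.\<close>

lemma mean_zero_bound:
  assumes mean: "(g has_integral 0) {0..1}" and u: "0 < u" "u < 1"
  shows "\<bar>g u - g' (1/2) * (u - 1/2)\<bar> \<le> 10 * C * edge (-1/2) u"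
proof -
  let ?L = "\<lambda>u. g' (1/2) * (u - 1/2)"
  have L: "(?L has_integral 0) {0..1}"
  proof -
    have "((\<lambda>u. u::real) has_integral (1/2)) {0..1}"
      using ident_has_integral[of 0 "1::real"] by simp
    moreover have "((\<lambda>u::real. 1/2::real) has_integral (1/2)) {0..1}"
      using has_integral_const_real[of "1/2::real" 0 1] by simp
    ultimately have "((\<lambda>u::real. u - 1/2) has_integral (1/2 - 1/2)) {0..1}"
      by (rule has_integral_diff)
    then show ?thesis using has_integral_mult_right[of "\<lambda>u::real. u - 1/2" 0 "{0..1}" "g' (1/2)"] by simp
  qed
  have d: "((\<lambda>u. g u - ?L u) has_integral 0) {0..1}"
    using has_integral_diff[OF mean L] by simp
  have c: "((\<lambda>u::real. g (1/2)) has_integral g (1/2)) {0..1}"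
    using has_integral_const_real[of "g (1/2)" 0 1] by simp
  have e: "((\<lambda>u. 2 * C * edge (-1/2) u) has_integral 8 * C) {0..1}"
    using has_integral_mult_right[OF has_integral_edge[of "-1/2"], of "2 * C"] by simp
  have "0 \<le> g (1/2) + 8 * C"
  proof (rule has_integral_le_interior[OF d has_integral_add[OF c e]])
    fix u :: real assume "0 < u" "u < 1"
    from bound0[OF this] show "g u - ?L u \<le> g (1/2) + 2 * C * edge (-1/2) u" by linarith
  qed
  moreover have "g (1/2) - 8 * C \<le> 0"
  proof (rule has_integral_le_interior[OF has_integral_diff[OF c e] d])
    fix u :: real assume "0 < u" "u < 1"
    from bound0[OF this] show "g (1/2) - 2 * C * edge (-1/2) u \<le> g u - ?L u" by linarith
  qed
  ultimately have "\<bar>g (1/2)\<bar> \<le> 8 * C * 1" by linarith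
  also have "\<dots> \<le> 8 * C * edge (-1/2) u"
  proof (intro mult_left_mono)
    have "1 powr (-1/2) \<le> u powr (-1/2)" using u by (intro powr_mono2') auto
    then show "1 \<le> edge (-1/2) u" by (simp add: edge_def add_increasing2)
  qed (use C_nonneg in auto)
  finally show ?thesis using bound0[OF u] by (simp add: algebra_simps)
qed

end

section \<open>Lattice sums rescaled to a single cell\<close>

lemma sum_inverse_square_le: "(\<Sum>i<N. 1 / (real i + 1)\<^sup>2) \<le> 2"
proof -
  have "(\<Sum>i<Suc N. 1 / (real i + 1)\<^sup>2) \<le> 2 - 1 / real (Suc N)" for N
  proof (induction N)
    case (Suc N)
    have "1 / (real (Suc N) + 1)\<^sup>2 \<le> 1 / (real (Suc N) * real (Suc (Suc N)))"
      by (intro divide_left_mono) (auto simp: power2_eq_square)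
    also have "\<dots> = 1 / real (Suc N) - 1 / real (Suc (Suc N))" by (simp add: field_simps)
    finally have "1 / (real (Suc N) + 1)\<^sup>2 \<le> 1 / real (Suc N) - 1 / real (Suc (Suc N))" .
    moreover have "(\<Sum>i<Suc (Suc N). 1 / (real i + 1)\<^sup>2) = (\<Sum>i<Suc N. 1 / (real i + 1)\<^sup>2) + 1 / (real (Suc N) + 1)\<^sup>2"
      by (rule sum.lessThan_Suc)
    ultimately show ?case using Suc by linarith
  qed simp
  from this[of "N - 1"] show ?thesis by (cases N) (auto intro: order_trans)
qed

lemma sum_inverse_shifted_square_le:
  assumes "0 < u" "u \<le> 1"
  shows "(\<Sum>i<N. 1 / (u + real i)\<^sup>2) \<le> 2 / u\<^sup>2"
proof -
  have "1 / (u + real i)\<^sup>2 \<le> 1 / u\<^sup>2 * (1 / (real i + 1)\<^sup>2)" for i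
  proof -
    have "u * (real i + 1) \<le> u + real i" using assms by (simp add: algebra_simps mult_left_le_one_le)
    then have "(u * (real i + 1))\<^sup>2 \<le> (u + real i)\<^sup>2" using assms by (intro power_mono) auto
    then have "1 / (u + real i)\<^sup>2 \<le> 1 / (u * (real i + 1))\<^sup>2"
      using assms by (intro divide_left_mono mult_pos_pos) auto
    then show ?thesis by (simp add: power_mult_distrib)
  qed
  then have "(\<Sum>i<N. 1 / (u + real i)\<^sup>2) \<le> (\<Sum>i<N. 1 / u\<^sup>2 * (1 / (real i + 1)\<^sup>2))" by (intro sum_mono)
  also have "\<dots> = 1 / u\<^sup>2 * (\<Sum>i<N. 1 / (real i + 1)\<^sup>2)" by (simp only: sum_distrib_left)
  also have "\<dots> \<le> 1 / u\<^sup>2 * 2" by (intro mult_left_mono sum_inverse_square_le) auto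
  finally show ?thesis by simp
qed

lemma sum_reverse_shifted:
  fixes h :: "real \<Rightarrow> real"
  shows "(\<Sum>i<N. h (real N - (u + real i))) = (\<Sum>i<N. h (1 - u + real i))"
proof -
  have "(\<Sum>i<N. h (1 - u + real i)) = (\<Sum>i<N. h (1 - u + real (N - Suc i)))"
    by (rule sum.nat_diff_reindex[symmetric])
  also have "\<dots> = (\<Sum>i<N. h (real N - (u + real i)))"
    by (intro sum.cong arg_cong[where f = h]) (auto simp: of_nat_diff)
  finally show ?thesis ..
qed

lemma sum_inverse_le_ln:
  assumes "N > 0" shows "(\<Sum>i<N. 1 / (real i + 1)) \<le> 1 + ln (real N)"
proof -
  have "(\<Sum>i<Suc N. 1 / (real i + 1)) \<le> 1 + ln (real (Suc N))" for N
  proof (induction N)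
    case (Suc N)
    have "ln (real (Suc N) / real (Suc (Suc N))) \<le> real (Suc N) / real (Suc (Suc N)) - 1"
      by (intro ln_le_minus_one) auto
    also have "\<dots> = - (1 / real (Suc (Suc N)))" by (simp add: field_simps)
    finally have "1 / (real (Suc N) + 1) \<le> ln (real (Suc (Suc N))) - ln (real (Suc N))"
      by (simp add: ln_div add.commute)
    moreover have "(\<Sum>i<Suc (Suc N). 1 / (real i + 1)) = (\<Sum>i<Suc N. 1 / (real i + 1)) + 1 / (real (Suc N) + 1)"
      by (rule sum.lessThan_Suc)
    ultimately show ?case using Suc by linarith
  qed simp
  from this[of "N - 1"] show ?thesis using assms by simp
qed

text \<open>Normal form: the singularity sits at the integers, and the sign is such that the second
  derivative tends to +\<infinity> at the right end of the period (0, 1). \<open>A\<close>,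
  \<open>C\<close> and \<open>\<delta>\<close> are explicit constants because the estimates for
  lattice sums must be uniform in \<open>N\<close>.\<close>

locale logarithmic_singularity =
  fixes f f' f'' :: "real \<Rightarrow> real" and A C \<delta> :: real
  assumes periodic: "\<And>t. f (t + 1) = f t"
    and deriv: "\<And>t. t \<notin> \<int> \<Longrightarrow> (f has_real_derivative f' t) (at t)"
    and deriv2: "\<And>t. t \<notin> \<int> \<Longrightarrow> (f' has_real_derivative f'' t) (at t)"
    and bound2: "\<And>t. \<lbrakk>0 < t; t < 1\<rbrakk> \<Longrightarrow> \<bar>f'' t\<bar> \<le> C * (1 / t\<^sup>2 + 1 / (1 - t)\<^sup>2)"
    and A_pos: "0 < A" and \<delta>_pos: "0 < \<delta>"
    and left: "\<And>t. \<lbrakk>1 - \<delta> < t; t < 1\<rbrakk> \<Longrightarrow> A / (1 - t)\<^sup>2 \<le> f'' t"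
    and mean_zero: "(f has_integral 0) {0..1}"
begin

text \<open>The variable \<open>u\<close> is the position within a cell of length 1 / N, so that all
  \<open>N\<close> live on the interval (0, 1). Only the term i = 0 is singular at u = 0, and only i
  = N - 1 at u = 1.\<close>

definition \<Psi> :: "nat \<Rightarrow> real \<Rightarrow> real" where
  "\<Psi> N u = (\<Sum>i<N. f ((u + real i) / real N))"
definition \<Psi>' :: "nat \<Rightarrow> real \<Rightarrow> real" where
  "\<Psi>' N u = (\<Sum>i<N. f' ((u + real i) / real N) / real N)"
definition \<Psi>'' :: "nat \<Rightarrow> real \<Rightarrow> real" where
  "\<Psi>'' N u = (\<Sum>i<N. f'' ((u + real i) / real N) / (real N)\<^sup>2)"

lemma not_Ints: "0 < t \<Longrightarrow> t < 1 \<Longrightarrow> (t::real) \<notin> \<int>"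
  by (auto elim!: Ints_cases)

lemma cell: "\<lbrakk>0 < u; u < 1; i < N\<rbrakk> \<Longrightarrow> 0 < (u + real i) / real N \<and> (u + real i) / real N < 1"
  by (auto simp: field_simps)

lemma bound2_cell:
  assumes "0 < u" "u < 1" "i < N"
  shows "\<bar>f'' ((u + real i) / real N)\<bar> \<le> C * (real N)\<^sup>2 * (1 / (u + real i)\<^sup>2 + 1 / (real N - (u + real i))\<^sup>2)"
proof -
  have N: "real N > 0" using assms by simp
  have e: "1 - (u + real i) / real N = (real N - (u + real i)) / real N" using N by (simp add: field_simps)
  show ?thesis
    using bound2[of "(u + real i) / real N"] cell[OF assms] N
    unfolding e by (simp add: power_divide algebra_simps)
qed

text \<open>Inverse squares are scale invariant: dividing by N^2 turns the bound for f'' into C / (u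
  + i)^2 and its mirror image, summable uniformly in N.\<close>

lemma \<Psi>''_bound:
  assumes u: "0 < u" "u < 1" and N: "N > 0"
  shows "\<bar>\<Psi>'' N u\<bar> \<le> (2 * C) * (1 / u\<^sup>2 + 1 / (1 - u)\<^sup>2)"
proof -
  have C0: "0 \<le> C" using bound2[of "1/2"] by (simp add: power2_eq_square)
  have "\<bar>\<Psi>'' N u\<bar> \<le> (\<Sum>i<N. \<bar>f'' ((u + real i) / real N) / (real N)\<^sup>2\<bar>)"
    unfolding \<Psi>''_def by (rule sum_abs)
  also have "\<dots> \<le> (\<Sum>i<N. C * (1 / (u + real i)\<^sup>2 + 1 / (real N - (u + real i))\<^sup>2))"
  proof (intro sum_mono)
    fix i assume "i \<in> {..<N}"
    then show "\<bar>f'' ((u + real i) / real N) / (real N)\<^sup>2\<bar> \<le> C * (1 / (u + real i)\<^sup>2 + 1 / (real N - (u + real i))\<^sup>2)"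
      using bound2_cell[OF u, of i N] N by (simp add: abs_divide divide_le_eq mult_ac)
  qed
  also have "\<dots> = C * ((\<Sum>i<N. 1 / (u + real i)\<^sup>2) + (\<Sum>i<N. 1 / (1 - u + real i)\<^sup>2))"
    using sum_reverse_shifted[of "\<lambda>x. 1 / x\<^sup>2" N u] by (simp add: sum_distrib_left[symmetric] sum.distrib)
  also have "\<dots> \<le> C * (2 / u\<^sup>2 + 2 / (1 - u)\<^sup>2)"
    using u C0 by (intro mult_left_mono add_mono sum_inverse_shifted_square_le) auto
  finally show ?thesis by (simp add: algebra_simps)
qed

lemma \<Psi>_deriv:
  assumes u: "0 < u" "u < 1" and N: "N > 0"
  shows "(\<Psi> N has_real_derivative \<Psi>' N u) (at u)"
proof -
  have "((\<lambda>u. f ((u + real i) / real N)) has_real_derivative f' ((u + real i) / real N) * (1 / real N)) (at u)" if "i < N" for i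
    by (rule DERIV_chain2[OF deriv]) (use cell[OF u that] not_Ints N in \<open>auto intro!: derivative_eq_intros\<close>)
  then show ?thesis unfolding \<Psi>_def[abs_def] \<Psi>'_def by (intro DERIV_sum) simp
qed

lemma \<Psi>'_deriv:
  assumes u: "0 < u" "u < 1" and N: "N > 0"
  shows "(\<Psi>' N has_real_derivative \<Psi>'' N u) (at u)"
proof -
  have "((\<lambda>u. f' ((u + real i) / real N)) has_real_derivative f'' ((u + real i) / real N) * (1 / real N)) (at u)" if "i < N" for i
    by (rule DERIV_chain2[OF deriv2]) (use cell[OF u that] not_Ints N in \<open>auto intro!: derivative_eq_intros\<close>)
  then have "((\<lambda>u. f' ((u + real i) / real N) / real N) has_real_derivative f'' ((u + real i) / real N) * (1 / real N) / real N) (at u)" if "i < N" for i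
    using that by (intro DERIV_cdivide) auto
  then show ?thesis unfolding \<Psi>'_def[abs_def] \<Psi>''_def by (intro DERIV_sum) (simp add: power2_eq_square)
qed

lemma \<Psi>_second_derivative: "N > 0 \<Longrightarrow> inverse_square_second_derivative (\<Psi> N) (\<Psi>' N) (\<Psi>'' N) (2 * C)"
  by unfold_locales (simp_all add: \<Psi>_deriv \<Psi>'_deriv \<Psi>''_bound)

lemma f_second_derivative: "inverse_square_second_derivative f f' f'' C"
  by unfold_locales (simp_all add: deriv deriv2 bound2 not_Ints)

lemma C_nonneg: "0 \<le> C"
  by (rule inverse_square_second_derivative.C_nonneg[OF f_second_derivative])

lemma f'_bound:
  obtains C1 where "0 \<le> C1" "\<And>t. \<lbrakk>0 < t; t < 1\<rbrakk> \<Longrightarrow> \<bar>f' t\<bar> \<le> C1 * (1 / t + 1 / (1 - t))"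
proof
  show "0 \<le> C + \<bar>f' (1/2)\<bar>" using C_nonneg by simp
  fix t :: real assume t: "0 < t" "t < 1"
  have "1 \<le> 1 / t" using t by simp
  then have "1 \<le> 1 / t + 1 / (1 - t)" using t by (simp add: add_increasing2)
  then have "\<bar>f' (1/2)\<bar> * 1 \<le> \<bar>f' (1/2)\<bar> * (1 / t + 1 / (1 - t))" by (intro mult_left_mono) auto
  then show "\<bar>f' t\<bar> \<le> (C + \<bar>f' (1/2)\<bar>) * (1 / t + 1 / (1 - t))"
    using inverse_square_second_derivative.bound1[OF f_second_derivative t] by (simp add: distrib_right)
qed

text \<open>First derivatives decay only like 1 / i from cell to cell, so a harmonic sum remains.
  Its logarithm decides how narrow the teeth are in \<open>birkhoff_sum_hits\<close>.\<close>

lemma \<Psi>'_half_bound: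
  obtains C2 where "0 \<le> C2" "\<And>N. 0 < N \<Longrightarrow> \<bar>\<Psi>' N (1/2)\<bar> \<le> C2 * (1 + ln (real N))"
proof -
  obtain C1 where C1: "0 \<le> C1" "\<And>t. \<lbrakk>0 < t; t < 1\<rbrakk> \<Longrightarrow> \<bar>f' t\<bar> \<le> C1 * (1 / t + 1 / (1 - t))"
    using f'_bound by blast
  have "\<bar>\<Psi>' N (1/2)\<bar> \<le> 4 * C1 * (1 + ln (real N))" if N: "0 < N" for N
  proof -
    have "\<bar>\<Psi>' N (1/2)\<bar> \<le> (\<Sum>i<N. \<bar>f' ((1/2 + real i) / real N) / real N\<bar>)"
      unfolding \<Psi>'_def by (rule sum_abs)
    also have "\<dots> \<le> (\<Sum>i<N. C1 * (1 / (1/2 + real i) + 1 / (real N - (1/2 + real i))))"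
    proof (intro sum_mono)
      fix i assume i: "i \<in> {..<N}"
      have e: "1 - (1/2 + real i) / real N = (real N - (1/2 + real i)) / real N" using N by (simp add: field_simps)
      have "\<bar>f' ((1/2 + real i) / real N)\<bar> / real N \<le> C1 * (1 / ((1/2 + real i) / real N) + 1 / (1 - (1/2 + real i) / real N)) / real N"
        using i cell[of "1/2" i N] by (intro divide_right_mono C1(2)) auto
      also have "\<dots> = C1 * (1 / (1/2 + real i) + 1 / (real N - (1/2 + real i)))"
      proof -
        have "1 / (x / real N) = real N * (1 / x)" for x by simp
        moreover have "C1 * (real N * x + real N * y) / real N = C1 * (x + y)" for x y
          using N by (simp add: field_simps)
        ultimately show ?thesis unfolding e by (simp only:)
      qed
      finally show "\<bar>f' ((1/2 + real i) / real N) / real N\<bar> \<le> C1 * (1 / (1/2 + real i) + 1 / (real N - (1/2 + real i)))"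
        by simp
    qed
    also have "\<dots> = C1 * ((\<Sum>i<N. 1 / (1/2 + real i)) + (\<Sum>i<N. 1 / (1 - 1/2 + real i)))"
      using sum_reverse_shifted[of "\<lambda>x. 1 / x" N "1/2"] by (simp only: sum_distrib_left[symmetric] sum.distrib)
    also have "\<dots> = 2 * C1 * (\<Sum>i<N. 1 / (1/2 + real i))" by simp
    also have "\<dots> \<le> 2 * C1 * (\<Sum>i<N. 2 * (1 / (real i + 1)))"
      using C1(1) by (intro mult_left_mono sum_mono) (auto simp: field_simps)
    also have "\<dots> = 4 * C1 * (\<Sum>i<N. 1 / (real i + 1))" by (simp only: sum_distrib_left[symmetric])
    also have "\<dots> \<le> 4 * C1 * (1 + ln (real N))"
      using C1(1) N by (intro mult_left_mono sum_inverse_le_ln) auto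
    finally show ?thesis .
  qed
  then show ?thesis using C1(1) by (intro that[of "4 * C1"]) auto
qed

lemma \<Psi>_mean_zero:
  assumes N: "N > 0"
  shows "(\<Psi> N has_integral 0) {0..1}"
proof -
  have fi: "f integrable_on {a..b}" if "0 \<le> a" "b \<le> 1" for a b
    using integrable_on_subinterval[of f "{0..1}" a b] has_integral_integrable[OF mean_zero] that by simp
  define I where "I = (\<lambda>i. integral {real i / real N..real (Suc i) / real N} f)"
  have "(\<Sum>i<n. I i) = integral {0..real n / real N} f" if "n \<le> N" for n
    using that
  proof (induction n)
    case (Suc n)
    have "integral {0..real n / real N} f + integral {real n / real N..real (Suc n) / real N} f = integral {0..real (Suc n) / real N} f"
      using Suc.prems N by (intro Henstock_Kurzweil_Integration.integral_combine fi) (auto simp: field_simps)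
    then show ?case using Suc by (simp add: I_def)
  qed simp
  from this[of N] have s0: "(\<Sum>i<N. I i) = 0" using N mean_zero by (simp add: integral_unique)
  have "((\<lambda>u. f ((u + real i) / real N)) has_integral real N * I i) {0..1}" if i: "i < N" for i
  proof -
    have le: "real i / real N \<le> real (Suc i) / real N" by (intro divide_right_mono) auto
    have "(f has_integral I i) {real i / real N..real (Suc i) / real N}"
      unfolding I_def using i N by (intro integrable_integral fi) (auto simp: field_simps)
    then have "(f has_integral I i) (cbox (real i / real N) (real (Suc i) / real N))" by simp
    then have "((\<lambda>x. f ((1 / real N) *\<^sub>R x + real i / real N)) has_integral (1 / \<bar>1 / real N\<bar> ^ DIM(real)) *\<^sub>R I i)
       ((\<lambda>x. (1 / (1 / real N)) *\<^sub>R x + - ((1 / (1 / real N)) *\<^sub>R (real i / real N))) ` cbox (real i / real N) (real (Suc i) / real N))"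
      by (rule has_integral_affinity) (use N in simp)
    moreover have "(\<lambda>x. (1 / (1 / real N)) *\<^sub>R x + - ((1 / (1 / real N)) *\<^sub>R (real i / real N))) ` cbox (real i / real N) (real (Suc i) / real N) = {0..1}"
      using N le image_affinity_atLeastAtMost[of "real N" "- real i" "real i / real N" "real (Suc i) / real N"] by simp
    moreover have "(\<lambda>x. f ((1 / real N) *\<^sub>R x + real i / real N)) = (\<lambda>u. f ((u + real i) / real N))"
      by (simp add: add_divide_distrib)
    ultimately show ?thesis by simp
  qed
  then have "(\<Psi> N has_integral (\<Sum>i<N. real N * I i)) {0..1}"
    unfolding \<Psi>_def[abs_def] by (intro has_integral_sum) auto
  then show ?thesis using s0 by (simp add: sum_distrib_left[symmetric])
qed

lemma \<Psi>_bound: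
  assumes "0 < u" "u < 1" "0 < N"
  shows "\<bar>\<Psi> N u - \<Psi>' N (1/2) * (u - 1/2)\<bar> \<le> 20 * C * edge (-1/2) u"
  using inverse_square_second_derivative.mean_zero_bound[OF \<Psi>_second_derivative \<Psi>_mean_zero, of N u] assms by simp

end

section \<open>Values taken by the lattice sums\<close>

lemma IVT_either_order:
  fixes g :: "real \<Rightarrow> real"
  assumes cont: "continuous_on {l..r} g" and x: "x \<in> {l..r}" "g x \<le> a" and y: "y \<in> {l..r}" "a \<le> g y"
  shows "\<exists>u\<in>{l..r}. g u = a"
proof (cases "x \<le> y")
  case True
  have "continuous_on {x..y} g" using cont by (rule continuous_on_subset) (use x y in auto)
  then obtain u where "x \<le> u" "u \<le> y" "g u = a" using IVT'[of g x a y] x y True by blast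
  then show ?thesis using x y by (intro bexI[of _ u]) auto
next
  case False
  have "continuous_on {y..x} g" using cont by (rule continuous_on_subset) (use x y in auto)
  then obtain u where "y \<le> u" "u \<le> x" "g u = a" using IVT2'[of g x a y] x y False by auto
  then show ?thesis using x y by (intro bexI[of _ u]) auto
qed

lemma powr_minus_half_le_2: "1/4 \<le> t \<Longrightarrow> t powr (-1/2) \<le> (2::real)"
proof -
  assume t: "1/4 \<le> t"
  then have "t powr (-1/2) \<le> (1/4) powr (-1/2)" by (intro powr_mono2') auto
  also have "\<dots> = ((1/2) powr 2) powr (-1/2)" by (simp add: power_divide)
  also have "\<dots> = 2" by (simp only: powr_powr) (simp add: powr_minus)
  finally show ?thesis .
qed

lemma edge_le_near_0:
  assumes "0 < u" "u \<le> 1/2"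
  shows "edge (-1/2) u \<le> 3 * u powr (-1/2)"
proof -
  have "(1 - u) powr (-1/2) \<le> 2" using assms by (intro powr_minus_half_le_2) auto
  moreover have "1 powr (-1/2) \<le> u powr (-1/2)" using assms by (intro powr_mono2') auto
  ultimately show ?thesis by (simp add: edge_def)
qed

lemma edge_commute: "edge a (1 - u) = edge a u"
  by (simp add: edge_def)

context logarithmic_singularity
begin

lemma \<Psi>_continuous:
  assumes "0 < l" "r < 1" "0 < N"
  shows "continuous_on {l..r} (\<Psi> N)"
proof (rule continuous_at_imp_continuous_on, intro ballI)
  fix u assume "u \<in> {l..r}"
  then show "isCont (\<Psi> N) u" using assms by (intro DERIV_isCont[OF \<Psi>_deriv]) auto
qed

text \<open>For N \<ge> 1 / \<delta> the last term lies within the range of \<open>left\<close>, and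
  rescaling returns exactly \<open>A / (1 - u)\<^sup>2\<close>. For u \<ge> 1/2 all other terms are
  at least half a cell away from the singularity; they amount to at most \<open>8 * C\<close> from
  the left end and \<open>2 * C\<close> from the right.\<close>

lemma \<Psi>''_lower_bound:
  assumes u: "1/2 \<le> u" "u < 1" and N: "1 / \<delta> \<le> real N" "0 < N"
  shows "A / (1 - u)\<^sup>2 - 10 * C \<le> \<Psi>'' N u"
proof -
  obtain n where n: "N = Suc n" using N by (cases N) auto
  have u0: "0 < u" using u by simp
  have Nr: "real N > 0" using N by simp
  have last: "A / (1 - u)\<^sup>2 \<le> f'' ((u + real n) / real N) / (real N)\<^sup>2"
  proof -
    have e: "1 - (u + real n) / real N = (1 - u) / real N" by (simp add: n field_simps)
    have "1 \<le> \<delta> * real N" using N(1) \<delta>_pos by (simp add: field_simps)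
    then have "(1 - u) / real N < \<delta>" using u Nr by (simp add: field_simps)
    then have "1 - \<delta> < (u + real n) / real N" using e by linarith
    moreover have "(u + real n) / real N < 1" using cell[OF u0 u(2), of n N] n by simp
    ultimately have "A / ((1 - u) / real N)\<^sup>2 \<le> f'' ((u + real n) / real N)"
      using left[of "(u + real n) / real N"] unfolding e by simp
    then have "A / ((1 - u) / real N)\<^sup>2 / (real N)\<^sup>2 \<le> f'' ((u + real n) / real N) / (real N)\<^sup>2"
      by (rule divide_right_mono) simp
    moreover have "A / ((1 - u) / real N)\<^sup>2 / (real N)\<^sup>2 = A / (1 - u)\<^sup>2"
      using Nr by (simp add: power_divide)
    ultimately show ?thesis by (simp only:)
  qed
  have "\<bar>\<Sum>i<n. f'' ((u + real i) / real N) / (real N)\<^sup>2\<bar> \<le> (\<Sum>i<n. \<bar>f'' ((u + real i) / real N) / (real N)\<^sup>2\<bar>)"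
    by (rule sum_abs)
  also have "\<dots> \<le> (\<Sum>i<n. C * (1 / (u + real i)\<^sup>2 + 1 / (real n - (0 + real i))\<^sup>2))"
  proof (intro sum_mono)
    fix i assume i: "i \<in> {..<n}"
    have "\<bar>f'' ((u + real i) / real N)\<bar> \<le> C * (real N)\<^sup>2 * (1 / (u + real i)\<^sup>2 + 1 / (real N - (u + real i))\<^sup>2)"
      using i n u u0 by (intro bound2_cell) auto
    also have "\<dots> \<le> C * (real N)\<^sup>2 * (1 / (u + real i)\<^sup>2 + 1 / (real n - (0 + real i))\<^sup>2)"
    proof (intro mult_left_mono add_left_mono)
      have "(real n - (0 + real i))\<^sup>2 \<le> (real N - (u + real i))\<^sup>2"
        using i u n by (intro power_mono) auto
      then show "1 / (real N - (u + real i))\<^sup>2 \<le> 1 / (real n - (0 + real i))\<^sup>2"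
        using i u n by (intro divide_left_mono mult_pos_pos) auto
    qed (use C_nonneg in auto)
    finally have "\<bar>f'' ((u + real i) / real N)\<bar> \<le> (C * (1 / (u + real i)\<^sup>2 + 1 / (real n - (0 + real i))\<^sup>2)) * (real N)\<^sup>2"
      by (simp only: mult_ac)
    then show "\<bar>f'' ((u + real i) / real N) / (real N)\<^sup>2\<bar> \<le> C * (1 / (u + real i)\<^sup>2 + 1 / (real n - (0 + real i))\<^sup>2)"
      using Nr by (simp add: abs_divide pos_divide_le_eq)
  qed
  also have "\<dots> = C * ((\<Sum>i<n. 1 / (u + real i)\<^sup>2) + (\<Sum>i<n. 1 / (1 - 0 + real i)\<^sup>2))"
    by (simp only: sum_distrib_left[symmetric] sum.distrib sum_reverse_shifted[of "\<lambda>x. 1 / x\<^sup>2" n 0])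
  also have "\<dots> \<le> C * (8 + 2)"
  proof (intro mult_left_mono add_mono C_nonneg)
    have "(\<Sum>i<n. 1 / (u + real i)\<^sup>2) \<le> 2 / u\<^sup>2" using u by (intro sum_inverse_shifted_square_le) auto
    also have "\<dots> \<le> 2 / (1/2)\<^sup>2" using u by (intro divide_left_mono power_mono mult_pos_pos) auto
    finally show "(\<Sum>i<n. 1 / (u + real i)\<^sup>2) \<le> 8" by (simp add: power2_eq_square)
    show "(\<Sum>i<n. 1 / (1 - 0 + real i)\<^sup>2) \<le> 2" using sum_inverse_square_le[of n] by (simp add: add.commute)
  qed
  finally have rest: "\<bar>\<Sum>i<n. f'' ((u + real i) / real N) / (real N)\<^sup>2\<bar> \<le> 10 * C" by simp
  have "\<Psi>'' N u = (\<Sum>i<n. f'' ((u + real i) / real N) / (real N)\<^sup>2) + f'' ((u + real n) / real N) / (real N)\<^sup>2"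
    unfolding \<Psi>''_def by (simp add: n)
  then show ?thesis using rest last by linarith
qed

text \<open>Two integrations from the midpoint, carrying slope and value there as initial data;
  \<open>\<Psi>_hits\<close> bounds both uniformly in \<open>N\<close> when the slope is
  moderate.\<close>

lemma \<Psi>_lower_bound:
  assumes u: "1/2 \<le> u" "u < 1" and N: "1 / \<delta> \<le> real N" "0 < N"
  shows "- A * ln (1 - u) - (3 * A + 5 * C + \<bar>\<Psi>' N (1/2)\<bar>) - \<bar>\<Psi> N (1/2)\<bar> \<le> \<Psi> N u"
proof -
  define E where "E = \<Psi>' N (1/2) - 2 * A - 5 * C"
  have d1: "E + A / (1 - v) \<le> \<Psi>' N v" if v: "1/2 \<le> v" "v < 1" for v
  proof -
    have "\<Psi>' N (1/2) - A / (1 - 1/2) + 10 * C * (1/2) \<le> \<Psi>' N v - A / (1 - v) + 10 * C * v"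
    proof (rule DERIV_nonneg_imp_nondecreasing[OF v(1)])
      fix x assume x: "1/2 \<le> x" "x \<le> v"
      have inv: "((\<lambda>x. A / (1 - x)) has_real_derivative A / (1 - x)\<^sup>2) (at x)"
        by ((rule derivative_eq_intros refl | (use x v in linarith))+) (use x v in \<open>simp add: power2_eq_square\<close>)
      have "((\<lambda>x. \<Psi>' N x - A / (1 - x) + 10 * C * x) has_real_derivative \<Psi>'' N x - A / (1 - x)\<^sup>2 + 10 * C) (at x)"
        using x v N by (intro DERIV_add DERIV_diff \<Psi>'_deriv inv DERIV_cmult_Id) auto
      moreover have "0 \<le> \<Psi>'' N x - A / (1 - x)\<^sup>2 + 10 * C"
        using \<Psi>''_lower_bound[of x N] x v N by simp
      ultimately show "\<exists>y. ((\<lambda>x. \<Psi>' N x - A / (1 - x) + 10 * C * x) has_real_derivative y) (at x) \<and> 0 \<le> y"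
        by blast
    qed
    moreover have "10 * C * v \<le> 10 * C * 1" using v C_nonneg by (intro mult_left_mono) auto
    ultimately show ?thesis by (simp add: E_def)
  qed
  have "\<Psi> N (1/2) + A * ln (1 - 1/2) - E * (1/2) \<le> \<Psi> N u + A * ln (1 - u) - E * u"
  proof (rule DERIV_nonneg_imp_nondecreasing[OF u(1)])
    fix x assume x: "1/2 \<le> x" "x \<le> u"
    have ln: "((\<lambda>x. A * ln (1 - x)) has_real_derivative - (A / (1 - x))) (at x)"
    proof -
      have "((\<lambda>x. 1 - x) has_real_derivative - 1) (at x)" by (auto intro!: derivative_eq_intros)
      then have "((\<lambda>x. ln (1 - x)) has_real_derivative (1 / (1 - x)) * - 1) (at x)"
        using x u by (intro DERIV_chain2[OF DERIV_ln_divide]) auto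
      then have "((\<lambda>x. A * ln (1 - x)) has_real_derivative A * ((1 / (1 - x)) * - 1)) (at x)"
        by (rule DERIV_cmult)
      then show ?thesis by simp
    qed
    have "((\<lambda>x. \<Psi> N x + A * ln (1 - x) - E * x) has_real_derivative \<Psi>' N x + - (A / (1 - x)) - E) (at x)"
      using x u N by (intro DERIV_add DERIV_diff \<Psi>_deriv ln DERIV_cmult_Id) auto
    moreover have "0 \<le> \<Psi>' N x + - (A / (1 - x)) - E"
      using d1[of x] x u by simp
    ultimately show "\<exists>y. ((\<lambda>x. \<Psi> N x + A * ln (1 - x) - E * x) has_real_derivative y) (at x) \<and> 0 \<le> y"
      by blast
  qed
  then have le: "\<Psi> N (1/2) + A * ln (1/2) + E * (u - 1/2) - A * ln (1 - u) \<le> \<Psi> N u" by (simp add: algebra_simps)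
  have "- 1 \<le> ln (1/2::real)" using ln_2_less_1 by (simp add: ln_div)
  then have l: "A * (- 1) \<le> A * ln (1/2)" using A_pos by (intro mult_left_mono) auto
  have "\<bar>E * (u - 1/2)\<bar> \<le> \<bar>E\<bar> * 1" unfolding abs_mult using u by (intro mult_left_mono) auto
  moreover have "\<bar>E\<bar> \<le> \<bar>\<Psi>' N (1/2)\<bar> + 2 * A + 5 * C" using A_pos C_nonneg by (simp add: E_def)
  ultimately show ?thesis using le l by linarith
qed

text \<open>
  If the slope at the centre is large, the linear part of \<open>\<Psi> N\<close> sweeps over \<open>a\<close> inside
  \<open>[1/4, 3/4]\<close>. Otherwise \<open>\<Psi> N\<close> is bounded away from the ends uniformly in \<open>N\<close>; it blows up to
  \<open>+\<infinity>\<close> at the right end, and having mean zero it cannot exceed \<open>a > 0\<close> throughout the middle.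
\<close>

lemma \<Psi>_hits:
  assumes a: "0 < a"
  obtains \<kappa> N0 where "0 < \<kappa>" "\<kappa> \<le> 1/4" "\<And>N. \<lbrakk>N0 \<le> N; 0 < N\<rbrakk> \<Longrightarrow> \<exists>u\<in>{\<kappa>..1-\<kappa>}. \<Psi> N u = a"
proof -
  define D where "D = 20 * C"
  \<comment> \<open>Chosen for \<open>K / 4 - 4 * D = a\<close>: beyond this slope, the linear part
    at 1/4 and 3/4 exceeds the error \<open>4 * D\<close> by \<open>a\<close>.\<close>
  define K where "K = 16 * D + 4 * a"
  define M where "M = a + K + 3 * D"
  \<comment> \<open>The integral of \<open>edge (-3/4)\<close> is 8, so the fourth power makes the
    loss \<open>M * \<kappa>1 powr (1/4) * 8\<close> at most \<open>a / 2\<close>.\<close>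
  define \<kappa>1 where "\<kappa>1 = min (1/4) ((a / (16 * M)) ^ 4)"
  define B where "B = 3 * A + 5 * C + K + 4 * D"
  \<comment> \<open>Makes \<open>- A * ln \<kappa>2\<close> at least \<open>a + B\<close>, so that
    \<open>\<Psi>_lower_bound\<close> reaches \<open>a\<close> at
    \<open>1 - \<kappa>2\<close>.\<close>
  define \<kappa>2 where "\<kappa>2 = min (1/4) (exp (- (a + B) / A))"
  define \<kappa> where "\<kappa> = min \<kappa>1 \<kappa>2"
  have D0: "0 \<le> D" using C_nonneg by (simp add: D_def)
  have K0: "0 < K" using D0 a by (simp add: K_def)
  have M0: "0 < M" using D0 a K0 by (simp add: M_def)
  have \<kappa>: "0 < \<kappa>" "\<kappa> \<le> 1/4" using a M0 by (auto simp: \<kappa>_def \<kappa>1_def \<kappa>2_def)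
  have "\<exists>u\<in>{\<kappa>..1-\<kappa>}. \<Psi> N u = a" if N: "nat \<lceil>1 / \<delta>\<rceil> \<le> N" "0 < N" for N
  proof -
    define G where "G = \<Psi>' N (1/2)"
    have bd: "\<bar>\<Psi> N u - G * (u - 1/2)\<bar> \<le> D * edge (-1/2) u" if "0 < u" "u < 1" for u
      using \<Psi>_bound[OF that N(2)] by (simp add: G_def D_def)
    have cont: "continuous_on {\<kappa>..1-\<kappa>} (\<Psi> N)" using \<kappa> N by (intro \<Psi>_continuous) auto
    have bd4: "\<bar>\<Psi> N u - G * (u - 1/2)\<bar> \<le> 4 * D" if "1/4 \<le> u" "u \<le> 3/4" for u
    proof -
      have "edge (-1/2) u \<le> 2 + 2" unfolding edge_def using that by (intro add_mono powr_minus_half_le_2) auto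
      then have "D * edge (-1/2) u \<le> D * 4" using D0 by (intro mult_left_mono) auto
      then show ?thesis using bd[of u] that by simp
    qed
    have b14: "\<bar>\<Psi> N (1/4) + G / 4\<bar> \<le> 4 * D" using bd4[of "1/4"] by simp
    have b34: "\<bar>\<Psi> N (3/4) - G / 4\<bar> \<le> 4 * D" using bd4[of "3/4"] by simp
    have mem: "1/4 \<in> {\<kappa>..1-\<kappa>}" "3/4 \<in> {\<kappa>..1-\<kappa>}" using \<kappa> by auto
    consider "K \<le> G" | "G \<le> - K" | "\<bar>G\<bar> < K" by linarith
    then show ?thesis
    proof cases
      case 1
      then have "\<Psi> N (1/4) \<le> a" "a \<le> \<Psi> N (3/4)" using b14 b34 a D0 unfolding K_def by linarith+
      then show ?thesis by (intro IVT_either_order[OF cont mem(1) _ mem(2)])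
    next
      case 2
      then have "\<Psi> N (3/4) \<le> a" "a \<le> \<Psi> N (1/4)" using b14 b34 a D0 unfolding K_def by linarith+
      then show ?thesis by (intro IVT_either_order[OF cont mem(2) _ mem(1)])
    next
      case 3
      \<comment> \<open>Near an end, t^(-1/2) is split as t^(1/4) * t^(-3/4): the first factor is at
        most \<open>\<kappa>1 powr (1/4)\<close>, the second is still integrable, so the error
        becomes small in the mean.\<close>
      have low: "a - M * \<kappa>1 powr (1/4) * edge (-3/4) u \<le> \<Psi> N u"
        if u: "0 < u" "u < 1" and t: "t = u \<or> t = 1 - u" "t < \<kappa>1" for u t
      proof -
        have t0: "0 < t" "t \<le> 1/4" using u t by (auto simp: \<kappa>1_def)
        have ed: "edge a' u = edge a' t" for a' using t edge_commute by auto
        have "\<bar>G * (u - 1/2)\<bar> \<le> K * 1" unfolding abs_mult using 3 u by (intro mult_mono) auto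
        then have "- K - D * edge (-1/2) u \<le> \<Psi> N u" using bd[OF u] by linarith
        moreover have "D * edge (-1/2) u \<le> D * (3 * t powr (-1/2))"
          unfolding ed using t0 D0 by (intro mult_left_mono edge_le_near_0) auto
        moreover have "(a + K) * 1 \<le> (a + K) * t powr (-1/2)"
        proof (intro mult_left_mono)
          have "1 powr (-1/2) \<le> t powr (-1/2)" using t0 by (intro powr_mono2') auto
          then show "1 \<le> t powr (-1/2)" by simp
        qed (use a K0 in auto)
        ultimately have "a - \<Psi> N u \<le> M * t powr (-1/2)" by (simp add: M_def algebra_simps)
        also have "t powr (-1/2) = t powr (1/4) * t powr (-3/4)" using t0 by (simp add: powr_add[symmetric])
        also have "\<dots> \<le> \<kappa>1 powr (1/4) * edge (-3/4) u"
          unfolding ed using t0 t by (intro mult_mono powr_mono2) (auto simp: edge_def)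
        finally show ?thesis using M0 by (simp add: mult.assoc mult_left_mono)
      qed
      \<comment> \<open>Otherwise the minorant in \<open>low\<close> would be valid on the whole
        cell; its integral is at least \<open>a / 2\<close>, contradicting mean zero.\<close>
      have "\<exists>u\<in>{\<kappa>1..1-\<kappa>1}. \<Psi> N u \<le> a"
      proof (rule ccontr)
        assume "\<not> ?thesis"
        then have gt: "a < \<Psi> N u" if "u \<in> {\<kappa>1..1-\<kappa>1}" for u using that by force
        have "a - M * \<kappa>1 powr (1/4) * 8 \<le> 0"
        proof (rule has_integral_le_interior[OF _ \<Psi>_mean_zero[OF N(2)]])
          have "((\<lambda>u::real. a) has_integral a) {0..1}" using has_integral_const_real[of a 0 1] by simp
          then show "((\<lambda>u. a - M * \<kappa>1 powr (1/4) * edge (-3/4) u) has_integral a - M * \<kappa>1 powr (1/4) * 8) {0..1}"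
            using has_integral_edge[of "-3/4"] by (intro has_integral_diff has_integral_mult_right) auto
          fix u :: real assume u: "0 < u" "u < 1"
          show "a - M * \<kappa>1 powr (1/4) * edge (-3/4) u \<le> \<Psi> N u"
          proof (cases "u \<in> {\<kappa>1..1-\<kappa>1}")
            case True
            moreover have "0 \<le> M * \<kappa>1 powr (1/4) * edge (-3/4) u" using M0 by (simp add: edge_def)
            ultimately show ?thesis using gt[of u] by linarith
          next
            case False
            then have "u < \<kappa>1 \<or> 1 - u < \<kappa>1" by auto
            then show ?thesis using low[OF u] by blast
          qed
        qed
        moreover have "\<kappa>1 powr (1/4) \<le> a / (16 * M)"
        proof -
          have "\<kappa>1 powr (1/4) \<le> ((a / (16 * M)) ^ 4) powr (1/4)"
            using a M0 by (intro powr_mono2) (auto simp: \<kappa>1_def)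
          also have "\<dots> = a / (16 * M)"
            using powr_powr[of "a / (16 * M)" 4 "1/4"] a M0 by simp
          finally show ?thesis .
        qed
        then have "M * \<kappa>1 powr (1/4) * 8 \<le> M * (a / (16 * M)) * 8" using M0 by (intro mult_right_mono mult_left_mono) auto
        moreover have "M * (a / (16 * M)) * 8 = a / 2" using M0 by simp
        ultimately show False using a by linarith
      qed
      then obtain u1 where u1: "u1 \<in> {\<kappa>1..1-\<kappa>1}" "\<Psi> N u1 \<le> a" by blast
      have \<kappa>2: "0 < \<kappa>2" "\<kappa>2 \<le> 1/4" by (auto simp: \<kappa>2_def)
      have "- A * ln \<kappa>2 \<ge> a + B"
      proof -
        have "ln \<kappa>2 \<le> ln (exp (- (a + B) / A))" using \<kappa>2(1) by (subst ln_le_cancel_iff) (auto simp: \<kappa>2_def)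
        then have "A * ln \<kappa>2 \<le> A * (- (a + B) / A)" using A_pos by (intro mult_left_mono) auto
        then show ?thesis using A_pos by simp
      qed
      moreover have "1 / \<delta> \<le> real N" using N(1) by linarith
      then have "- A * ln \<kappa>2 - (3 * A + 5 * C + \<bar>G\<bar>) - \<bar>\<Psi> N (1/2)\<bar> \<le> \<Psi> N (1 - \<kappa>2)"
        using \<Psi>_lower_bound[of "1 - \<kappa>2" N] \<kappa>2 N by (simp add: G_def)
      moreover have "\<bar>\<Psi> N (1/2)\<bar> \<le> 4 * D" using bd4[of "1/2"] by simp
      ultimately have u2: "a \<le> \<Psi> N (1 - \<kappa>2)" using 3 unfolding B_def by linarith
      show ?thesis
      proof (rule IVT_either_order[OF cont _ u1(2) _ u2])
        show "u1 \<in> {\<kappa>..1-\<kappa>}" using u1(1) by (auto simp: \<kappa>_def)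
        show "1 - \<kappa>2 \<in> {\<kappa>..1-\<kappa>}" using \<kappa>2 by (auto simp: \<kappa>_def)
      qed
    qed
  qed
  then show ?thesis using \<kappa> by (intro that[of \<kappa> "nat \<lceil>1 / \<delta>\<rceil>"]) auto
qed

end

section \<open>Birkhoff sums at well placed denominators\<close>

lemma periodic_function_of_int:
  fixes g :: "real \<Rightarrow> 'a"
  assumes per: "\<And>x. g (x + 1) = g x"
  shows "g (x + of_int n) = g x"
proof -
  have nat: "g (x + real n) = g x" for x n
  proof (induction n)
    case (Suc n)
    have "x + real (Suc n) = (x + real n) + 1" by simp
    then show ?case using Suc by (simp only: per)
  qed simp
  show ?thesis
  proof (cases "n \<ge> 0")
    case True
    then show ?thesis using nat[of x "nat n"] by simp
  next
    case False
    then show ?thesis using nat[of "x + of_int n" "nat (- n)"] by simp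
  qed
qed

lemma summation_by_parts:
  fixes s k :: "nat \<Rightarrow> real"
  shows "(\<Sum>i<Suc n. s i * k i) = (\<Sum>i<Suc n. s i) * k n - (\<Sum>i<n. (\<Sum>j<Suc i. s j) * (k (Suc i) - k i))"
  by (induction n) (simp_all add: algebra_simps)

lemma taylor_first_order_bound:
  fixes f f' f'' :: "real \<Rightarrow> real"
  assumes d1: "\<And>y. \<bar>y - t\<bar> \<le> \<epsilon> \<Longrightarrow> (f has_real_derivative f' y) (at y)"
    and d2: "\<And>y. \<bar>y - t\<bar> \<le> \<epsilon> \<Longrightarrow> (f' has_real_derivative f'' y) (at y)"
    and M: "\<And>y. \<bar>y - t\<bar> \<le> \<epsilon> \<Longrightarrow> \<bar>f'' y\<bar> \<le> M" and h: "\<bar>h\<bar> \<le> \<epsilon>"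
  shows "\<bar>f (t + h) - f t - h * f' t\<bar> \<le> M * h\<^sup>2"
proof -
  have "0 \<le> \<epsilon>" using h by linarith
  then have "\<bar>f'' t\<bar> \<le> M" by (intro M) simp
  then have M0: "0 \<le> M" by linarith
  let ?S = "{t - \<bar>h\<bar>..t + \<bar>h\<bar>}"
  have S: "\<bar>y - t\<bar> \<le> \<epsilon>" "\<bar>y - t\<bar> \<le> \<bar>h\<bar>" if "y \<in> ?S" for y using that h by auto
  have f': "\<bar>f' y - f' t\<bar> \<le> M * \<bar>h\<bar>" if y: "y \<in> ?S" for y
  proof -
    have "norm (f' y - f' t) \<le> M * norm (y - t)"
    proof (rule field_differentiable_bound[of ?S f' f''])
      show "(f' has_field_derivative f'' z) (at z within ?S)" if "z \<in> ?S" for z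
        using d2[OF S(1)[OF that]] by (rule has_field_derivative_at_within)
      show "norm (f'' z) \<le> M" if "z \<in> ?S" for z using M[OF S(1)[OF that]] by simp
    qed (use y in auto)
    also have "\<dots> \<le> M * \<bar>h\<bar>" using S(2)[OF y] M0 by (intro mult_left_mono) auto
    finally show ?thesis by simp
  qed
  have "norm ((f (t + h) - f' t * (t + h)) - (f t - f' t * t)) \<le> (M * \<bar>h\<bar>) * norm ((t + h) - t)"
  proof (rule field_differentiable_bound[of ?S "\<lambda>y. f y - f' t * y" "\<lambda>y. f' y - f' t"])
    show "((\<lambda>y. f y - f' t * y) has_field_derivative f' z - f' t) (at z within ?S)" if "z \<in> ?S" for z
    proof (rule has_field_derivative_at_within)
      show "((\<lambda>y. f y - f' t * y) has_real_derivative f' z - f' t) (at z)"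
        using d1[OF S(1)[OF that]] by (intro DERIV_diff DERIV_cmult_Id)
    qed
    show "norm (f' z - f' t) \<le> M * \<bar>h\<bar>" if "z \<in> ?S" for z using f'[OF that] by simp
  qed auto
  then show ?thesis by (simp add: algebra_simps power2_eq_square)
qed

lemma inverse_square_le_scaled:
  assumes "0 < \<kappa>" "\<kappa> \<le> 1" "\<kappa> \<le> v"
  shows "1 / (v + real i)\<^sup>2 \<le> 1 / \<kappa>\<^sup>2 * (1 / (real i + 1)\<^sup>2)"
proof -
  have "\<kappa> * real i \<le> real i" using assms by (simp add: mult_left_le_one_le)
  then have "\<kappa> * (real i + 1) \<le> v + real i" using assms by (simp add: distrib_left)
  then have "(\<kappa> * (real i + 1))\<^sup>2 \<le> (v + real i)\<^sup>2" using assms by (intro power_mono) auto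
  then have "1 / (v + real i)\<^sup>2 \<le> 1 / (\<kappa> * (real i + 1))\<^sup>2"
    using assms by (intro divide_left_mono mult_pos_pos) auto
  then show ?thesis by (simp add: power_mult_distrib)
qed

lemma sum_sqrt_over_square_le: "(\<Sum>i<n. sqrt (real i + 1) * (1 / (real i + 1)\<^sup>2)) \<le> 3"
proof -
  have "sqrt (real i + 1) * (1 / (real i + 1)\<^sup>2) = 1 / (real (Suc i) * sqrt (real (Suc i)))" for i
  proof -
    have "s * (1 / (s\<^sup>2)\<^sup>2) = 1 / (s\<^sup>2 * s)" if "s > 0" for s :: real
      using that by (simp add: power2_eq_square)
    from this[of "sqrt (real i + 1)"] show ?thesis by (simp add: add.commute)
  qed
  then have "(\<Sum>i<n. sqrt (real i + 1) * (1 / (real i + 1)\<^sup>2)) = (\<Sum>i<n. 1 / (real (Suc i) * sqrt (real (Suc i))))"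
    by (rule sum.cong[OF refl])
  also have "\<dots> = (\<Sum>m=1..n. 1 / (real m * sqrt (real m)))"
    by (rule sum.reindex_bij_witness[of _ "\<lambda>m. m - 1" Suc]) auto
  also have "\<dots> \<le> 3" by (rule sum_inverse_three_halves_le)
  finally show ?thesis .
qed

text \<open>The second estimate counts from the right: a full period sums to at most 4, so a partial
  sum is minus its tail up to 4. Both are used because f' is singular at both ends of the
  period.\<close>

lemma well_placed_sawtooth_partial_sums:
  fixes \<gamma> :: real
  assumes wp: "well_placed Q N p" and r: "int N dvd r * p - 1" and m: "m \<le> N"
  defines "s \<equiv> \<lambda>i. frac (\<gamma> + real i * (of_int r / real N)) - 1/2"
  shows "\<bar>\<Sum>i<m. s i\<bar> \<le> 600 * sqrt (real m)" (is ?A)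
    and "\<bar>\<Sum>i<m. s i\<bar> \<le> 4 + 600 * sqrt (real (N - m))" (is ?B)
proof -
  have N: "N > 0" using wp by (simp add: well_placed_def)
  have partial: "\<bar>\<Sum>i<L. frac (\<gamma>' + real i * (of_int r / real N)) - 1/2\<bar> \<le> 600 * sqrt (real L)" if "L \<le> N" for L \<gamma>'
    using well_placed_inverse_badly_approximable[OF wp r] that by (intro sawtooth_sum_le[where N = N]) blast+
  show ?A using partial[OF m] by (simp add: s_def)
  have cop: "coprime r (int N)"
  proof (rule coprimeI)
    fix c assume "c dvd r" "c dvd int N"
    then have "c dvd r * p" "c dvd r * p - 1" using r by (auto intro: dvd_trans)
    then have "c dvd r * p - (r * p - 1)" by (rule dvd_diff)
    then show "is_unit c" by simp
  qed
  have full: "\<bar>\<Sum>i<N. s i\<bar> \<le> 4"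
    unfolding s_def using N cop by (intro sawtooth_block_sum_le) auto
  have split: "(\<Sum>i<N. s i) = (\<Sum>i<m. s i) + (\<Sum>i<N - m. s (m + i))"
    using sum_lessThan_add[of s m "N - m"] m by simp
  have "(\<Sum>i<N - m. s (m + i)) = (\<Sum>i<N - m. frac ((\<gamma> + real m * (of_int r / real N)) + real i * (of_int r / real N)) - 1/2)"
    by (simp add: s_def distrib_right add.assoc add_divide_distrib)
  then have "\<bar>\<Sum>i<N - m. s (m + i)\<bar> \<le> 600 * sqrt (real (N - m))" using partial[of "N - m"] by simp
  then show ?B using full split by linarith
qed

context logarithmic_singularity
begin

lemma periodic_int: "f (t + of_int n) = f t"
  by (rule periodic_function_of_int[of f, OF periodic])

text \<open>
  Summation by parts: the sawtooth sums over \<open>m\<close> consecutive cells are \<open>O(sqrt m)\<close>, which makes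
  the increments of \<open>f'\<close>, of size \<open>N / m\<^sup>2\<close> at distance \<open>m\<close> cells from the singularity, summable.
\<close>

lemma weighted_derivative_sum_bound:
  assumes \<kappa>: "0 < \<kappa>" "\<kappa> \<le> 1/2"
  obtains K where "0 \<le> K"
    "\<And>Q N p r u \<gamma>. \<lbrakk>well_placed Q N p; int N dvd r * p - 1; \<kappa> \<le> u; u \<le> 1 - \<kappa>\<rbrakk> \<Longrightarrow>
      \<bar>\<Sum>i<N. (frac (\<gamma> + real i * (of_int r / real N)) - 1/2) * f' ((u + real i) / real N)\<bar> \<le> K * real N"
proof -
  obtain C1 where C1: "0 \<le> C1" "\<And>t. \<lbrakk>0 < t; t < 1\<rbrakk> \<Longrightarrow> \<bar>f' t\<bar> \<le> C1 * (1 / t + 1 / (1 - t))"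
    using f'_bound by blast
  define K where "K = 8 * C1 / \<kappa> + 3624 * C / \<kappa>\<^sup>2"
  have "\<bar>\<Sum>i<N. (frac (\<gamma> + real i * (of_int r / real N)) - 1/2) * f' ((u + real i) / real N)\<bar> \<le> K * real N"
    if wp: "well_placed Q N p" and r: "int N dvd r * p - 1" and u: "\<kappa> \<le> u" "u \<le> 1 - \<kappa>" for Q N p r u \<gamma>
  proof -
    have N: "N > 0" using wp by (simp add: well_placed_def)
    then obtain n where n: "N = Suc n" by (cases N) auto
    have u0: "0 < u" "u < 1" using u \<kappa> by auto
    define s where "s = (\<lambda>i. frac (\<gamma> + real i * (of_int r / real N)) - 1/2)"
    define k where "k = (\<lambda>i. f' ((u + real i) / real N))"
    define S where "S = (\<lambda>m. \<Sum>i<m. s i)"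
    have S1: "\<bar>S m\<bar> \<le> 600 * sqrt (real m)" and S2: "\<bar>S m\<bar> \<le> 4 + 600 * sqrt (real (N - m))" if "m \<le> N" for m
      using well_placed_sawtooth_partial_sums[OF wp r that, of \<gamma>] by (simp_all add: S_def s_def)
    have kn: "\<bar>k n\<bar> \<le> 2 * C1 / \<kappa> * real N"
    proof -
      have c: "0 < (u + real n) / real N \<and> (u + real n) / real N < 1" using cell[OF u0, of n N] n by simp
      have e: "1 - (u + real n) / real N = (1 - u) / real N" by (simp add: n field_simps)
      have "\<bar>k n\<bar> \<le> C1 * (1 / ((u + real n) / real N) + 1 / ((1 - u) / real N))"
        using C1(2)[of "(u + real n) / real N"] c unfolding e k_def by blast
      also have "\<dots> = C1 * real N * (1 / (u + real n) + 1 / (1 - u))" by (simp add: distrib_left)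
      also have "\<dots> \<le> C1 * real N * (1 / \<kappa> + 1 / \<kappa>)"
        using u u0 \<kappa> C1(1) by (intro mult_left_mono add_mono divide_left_mono) auto
      finally show ?thesis by (simp add: mult_ac)
    qed
    have kd: "\<bar>k (Suc i) - k i\<bar> \<le> C * real N / \<kappa>\<^sup>2 * (1 / (real i + 1)\<^sup>2 + 1 / (real (n - Suc i) + 1)\<^sup>2)" if i: "i < n" for i
    proof -
      let ?a = "(u + real i) / real N" and ?b = "(u + real (Suc i)) / real N"
      define B where "B = C * (real N)\<^sup>2 * (1 / (u + real i)\<^sup>2 + 1 / (1 - u + real (n - Suc i))\<^sup>2)"
      have ab: "?a \<le> ?b" by (intro divide_right_mono) auto
      have a0: "0 < ?a" "?b < 1" using cell[OF u0, of i N] cell[OF u0, of "Suc i" N] i n by auto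
      have "\<bar>k (Suc i) - k i\<bar> \<le> B * ?b - B * ?a"
        unfolding k_def
      proof (rule abs_diff_le_of_deriv_le[OF ab])
        fix x assume x: "?a \<le> x" "x \<le> ?b"
        then have x01: "0 < x" "x < 1" using a0 by linarith+
        show "(f' has_real_derivative f'' x) (at x)" using x01 by (intro deriv2 not_Ints)
        show "((\<lambda>x. B * x) has_real_derivative B) (at x)" by (rule DERIV_cmult_Id)
        have "1 - ?b = (1 - u + real (n - Suc i)) / real N" using i N by (simp add: n of_nat_diff field_simps)
        then have "(1 - u + real (n - Suc i)) / real N \<le> 1 - x" using x by linarith
        then have 1: "1 / (1 - x)\<^sup>2 \<le> 1 / ((1 - u + real (n - Suc i)) / real N)\<^sup>2"
          using u0 x01 N by (intro divide_left_mono power_mono mult_pos_pos) (auto intro!: divide_pos_pos add_pos_nonneg)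
        have 2: "1 / x\<^sup>2 \<le> 1 / ((u + real i) / real N)\<^sup>2"
          by (intro divide_left_mono power_mono mult_pos_pos zero_less_power) (use a0 x01 x in linarith)+
        have "\<bar>f'' x\<bar> \<le> C * (1 / x\<^sup>2 + 1 / (1 - x)\<^sup>2)" by (rule bound2[OF x01])
        also have "\<dots> \<le> C * (1 / ((u + real i) / real N)\<^sup>2 + 1 / ((1 - u + real (n - Suc i)) / real N)\<^sup>2)"
          using 1 2 C_nonneg by (intro mult_left_mono add_mono) auto
        also have "\<dots> = B" by (simp add: B_def power_divide distrib_left)
        finally show "\<bar>f'' x\<bar> \<le> B" .
      qed
      also have "\<dots> = B / real N" using N by (simp add: field_simps)
      also have "\<dots> \<le> (C * (real N)\<^sup>2 * (1 / \<kappa>\<^sup>2 * (1 / (real i + 1)\<^sup>2) + 1 / \<kappa>\<^sup>2 * (1 / (real (n - Suc i) + 1)\<^sup>2))) / real N"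
        unfolding B_def using \<kappa> u C_nonneg
        by (intro divide_right_mono mult_left_mono add_mono inverse_square_le_scaled) auto
      also have "\<dots> = C * real N / \<kappa>\<^sup>2 * (1 / (real i + 1)\<^sup>2 + 1 / (real (n - Suc i) + 1)\<^sup>2)"
      proof -
        have scaled: "C * n\<^sup>2 * (1 / z * a + 1 / z * b) / n = C * n / z * (a + b)" if "n > 0" "z > 0" for n z a b :: real
          using that by (simp add: power2_eq_square field_simps)
        show ?thesis by (rule scaled) (use N \<kappa> in simp_all)
      qed
      finally show ?thesis .
    qed
    \<comment> \<open>Each estimate of the partial sum is paired with the inverse square that decays
      from the same end; two copies of \<Sum> m^(-3/2) result.\<close>
    have summand: "\<bar>S (Suc i) * (k (Suc i) - k i)\<bar> \<le> C * real N / \<kappa>\<^sup>2 *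
        (604 * (sqrt (real i + 1) * (1 / (real i + 1)\<^sup>2)) + 604 * (sqrt (real (n - Suc i) + 1) * (1 / (real (n - Suc i) + 1)\<^sup>2)))"
      if i: "i < n" for i
    proof -
      have le: "Suc i \<le> N" using i n by simp
      have Sa: "\<bar>S (Suc i)\<bar> \<le> 604 * sqrt (real i + 1)"
        using S1[OF le] real_sqrt_ge_zero[of "real i + 1"] by (simp add: add.commute)
      have "N - Suc i = Suc (n - Suc i)" using i n by simp
      then have "\<bar>S (Suc i)\<bar> \<le> 4 + 600 * sqrt (real (n - Suc i) + 1)"
        using S2[OF le] by (simp add: add.commute)
      moreover have "1 \<le> sqrt (real (n - Suc i) + 1)" by simp
      ultimately have Sb: "\<bar>S (Suc i)\<bar> \<le> 604 * sqrt (real (n - Suc i) + 1)" by linarith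
      have "\<bar>S (Suc i) * (k (Suc i) - k i)\<bar> \<le> \<bar>S (Suc i)\<bar> * (C * real N / \<kappa>\<^sup>2 * (1 / (real i + 1)\<^sup>2 + 1 / (real (n - Suc i) + 1)\<^sup>2))"
        unfolding abs_mult using kd[OF i] by (intro mult_left_mono) auto
      also have "\<dots> = C * real N / \<kappa>\<^sup>2 * (\<bar>S (Suc i)\<bar> * (1 / (real i + 1)\<^sup>2) + \<bar>S (Suc i)\<bar> * (1 / (real (n - Suc i) + 1)\<^sup>2))"
        by (simp only: distrib_left mult_ac)
      also have "\<dots> \<le> C * real N / \<kappa>\<^sup>2 * ((604 * sqrt (real i + 1)) * (1 / (real i + 1)\<^sup>2)
          + (604 * sqrt (real (n - Suc i) + 1)) * (1 / (real (n - Suc i) + 1)\<^sup>2))"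
        using Sa Sb C_nonneg by (intro mult_left_mono add_mono mult_right_mono) auto
      finally show ?thesis by (simp only: mult.assoc)
    qed
    have "\<bar>\<Sum>i<n. S (Suc i) * (k (Suc i) - k i)\<bar> \<le> (\<Sum>i<n. \<bar>S (Suc i) * (k (Suc i) - k i)\<bar>)"
      by (rule sum_abs)
    also have "\<dots> \<le> (\<Sum>i<n. C * real N / \<kappa>\<^sup>2 *
        (604 * (sqrt (real i + 1) * (1 / (real i + 1)\<^sup>2)) + 604 * (sqrt (real (n - Suc i) + 1) * (1 / (real (n - Suc i) + 1)\<^sup>2))))"
      using summand by (intro sum_mono) auto
    also have "\<dots> = C * real N / \<kappa>\<^sup>2 * (604 * (\<Sum>i<n. sqrt (real i + 1) * (1 / (real i + 1)\<^sup>2))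
        + 604 * (\<Sum>i<n. sqrt (real (n - Suc i) + 1) * (1 / (real (n - Suc i) + 1)\<^sup>2)))"
      by (simp only: sum_distrib_left[symmetric] sum.distrib)
    also have "(\<Sum>i<n. sqrt (real (n - Suc i) + 1) * (1 / (real (n - Suc i) + 1)\<^sup>2)) = (\<Sum>i<n. sqrt (real i + 1) * (1 / (real i + 1)\<^sup>2))"
      by (rule sum.nat_diff_reindex)
    also have "C * real N / \<kappa>\<^sup>2 * (604 * (\<Sum>i<n. sqrt (real i + 1) * (1 / (real i + 1)\<^sup>2))
        + 604 * (\<Sum>i<n. sqrt (real i + 1) * (1 / (real i + 1)\<^sup>2))) \<le> C * real N / \<kappa>\<^sup>2 * (604 * 3 + 604 * 3)"
      using C_nonneg by (intro mult_left_mono add_mono sum_sqrt_over_square_le) auto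
    finally have P1: "\<bar>\<Sum>i<n. S (Suc i) * (k (Suc i) - k i)\<bar> \<le> 3624 * C / \<kappa>\<^sup>2 * real N" by (simp add: mult_ac)
    \<comment> \<open>In the boundary term \<open>k n\<close> is already of size N, so it matters
      that the sawtooth sum over the full period is bounded by 4 and not by a multiple of sqrt
      N.\<close>
    have "\<bar>S N * k n\<bar> \<le> 4 * (2 * C1 / \<kappa> * real N)"
      unfolding abs_mult using S2[of N] kn by (intro mult_mono) auto
    then have P2: "\<bar>S N * k n\<bar> \<le> 8 * C1 / \<kappa> * real N" by simp
    have "(\<Sum>i<N. s i * k i) = S N * k n - (\<Sum>i<n. S (Suc i) * (k (Suc i) - k i))"
      unfolding n S_def by (rule summation_by_parts)
    then have "\<bar>\<Sum>i<N. s i * k i\<bar> \<le> 8 * C1 / \<kappa> * real N + 3624 * C / \<kappa>\<^sup>2 * real N" using P1 P2 by linarith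
    then show ?thesis by (simp add: s_def k_def K_def distrib_right)
  qed
  moreover have "0 \<le> K" using C1(1) C_nonneg \<kappa> by (simp add: K_def)
  ultimately show ?thesis using that by blast
qed

text \<open>
  The orbit point \<open>x + j \<alpha>\<close> lies in cell \<open>\<sigma> j\<close> at offset \<open>\<theta> (j / N - 1/2)\<close> from a lattice of mesh
  \<open>1 / N\<close>; centring \<open>x\<close> by \<open>\<theta> / 2\<close> makes the first order term a sawtooth sum over the cells, so
  that it does not feel the possibly logarithmic size of \<open>\<Psi>'\<close>.
\<close>

lemma birkhoff_sum_approx:
  assumes \<kappa>: "0 < \<kappa>" "\<kappa> \<le> 1/2"
  obtains K where "0 \<le> K"
    "\<And>Q N p \<alpha> \<eta> x u i0. \<lbrakk>well_placed Q N p; \<bar>real N * \<alpha> - of_int p\<bar> \<le> \<eta> / real N; \<eta> \<le> \<kappa>; \<kappa> \<le> u; u \<le> 1 - \<kappa>;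
       x + (real N * \<alpha> - of_int p) / 2 = (u + of_int i0) / real N\<rbrakk> \<Longrightarrow>
      \<bar>(\<Sum>j<N. f (x + real j * \<alpha>)) - \<Psi> N u\<bar> \<le> K * \<eta>"
proof -
  obtain K1 where K1: "0 \<le> K1"
    "\<And>Q N p r u \<gamma>. \<lbrakk>well_placed Q N p; int N dvd r * p - 1; \<kappa> \<le> u; u \<le> 1 - \<kappa>\<rbrakk> \<Longrightarrow>
      \<bar>\<Sum>i<N. (frac (\<gamma> + real i * (of_int r / real N)) - 1/2) * f' ((u + real i) / real N)\<bar> \<le> K1 * real N"
    using weighted_derivative_sum_bound[OF \<kappa>] by blast
  define K where "K = K1 + 4 * C / \<kappa>\<^sup>2"
  have "\<bar>(\<Sum>j<N. f (x + real j * \<alpha>)) - \<Psi> N u\<bar> \<le> K * \<eta>"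
    if wp: "well_placed Q N p" and \<theta>\<eta>: "\<bar>real N * \<alpha> - of_int p\<bar> \<le> \<eta> / real N" and \<eta>: "\<eta> \<le> \<kappa>"
      and u: "\<kappa> \<le> u" "u \<le> 1 - \<kappa>" and x: "x + (real N * \<alpha> - of_int p) / 2 = (u + of_int i0) / real N"
    for Q N p \<alpha> \<eta> x u i0
  proof -
    have N: "N > 0" and cop: "coprime p (int N)" using wp by (auto simp: well_placed_def)
    have u0: "0 < u" "u < 1" using u \<kappa> by auto
    define \<theta> where "\<theta> = real N * \<alpha> - of_int p"
    have \<theta>: "\<bar>\<theta>\<bar> \<le> \<eta> / real N" using \<theta>\<eta> by (simp add: \<theta>_def)
    have "0 \<le> \<eta> / real N" using \<theta> by linarith
    then have \<eta>0: "0 \<le> \<eta>" using N by (simp add: zero_le_divide_iff)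
    have \<alpha>: "\<alpha> = (of_int p + \<theta>) / real N" using N by (simp add: \<theta>_def)
    obtain r where r: "int N dvd r * p - 1"
    proof -
      obtain b c where "b * p + c * int N = gcd p (int N)" using bezout_int by blast
      then have "b * p - 1 = int N * (- c)" using cop by (simp add: mult.commute)
      then show ?thesis using that[of b] by simp
    qed
    obtain w where w: "r * p - 1 = int N * w" using r by (auto simp: dvd_def)
    define \<sigma> where "\<sigma> = (\<lambda>j. nat ((i0 + int j * p) mod int N))"
    have bij: "bij_betw \<sigma> {..<N} {..<N}" unfolding \<sigma>_def by (rule bij_betw_affine_mod[OF cop N])
    \<comment> \<open>With this phase the sawtooth recovers time from position: r (\<sigma> j - i0)
      is congruent to j modulo N, whence
      \<open>s (\<sigma> j) = real j / real N - 1/2\<close>.\<close>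
    define \<gamma> where "\<gamma> = - of_int (r * i0) / real N"
    define s where "s = (\<lambda>i. frac (\<gamma> + real i * (of_int r / real N)) - 1/2)"
    define t where "t = (\<lambda>i. (u + real i) / real N)"
    have point: "f (x + real j * \<alpha>) = f (t (\<sigma> j) + \<theta> * s (\<sigma> j))" if j: "j < N" for j
    proof -
      define q where "q = (i0 + int j * p) div int N"
      have "int (\<sigma> j) = (i0 + int j * p) mod int N" using N by (simp add: \<sigma>_def)
      then have e: "i0 + int j * p = int N * q + int (\<sigma> j)" by (simp add: q_def)
      then have er: "of_int i0 + real j * of_int p = real N * of_int q + real (\<sigma> j)"
        by (metis of_int_add of_int_mult of_int_of_nat_eq)
      have "int (\<sigma> j) = i0 + int j * p - int N * q" using e by simp
      then have "r * int (\<sigma> j) - r * i0 = r * (i0 + int j * p - int N * q) - r * i0" by (simp only:)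
      then have "r * int (\<sigma> j) - r * i0 = int j * (r * p) - r * int N * q" by (simp add: algebra_simps)
      also have "r * p = 1 + int N * w" using w by simp
      finally have "r * int (\<sigma> j) - r * i0 = int j + int N * (int j * w - r * q)" by (simp add: algebra_simps)
      then have "real_of_int (r * int (\<sigma> j) - r * i0) = real_of_int (int j + int N * (int j * w - r * q))" by (rule arg_cong)
      then have "(real_of_int r * real (\<sigma> j) - real_of_int (r * i0)) / real N = (real j + real N * of_int (int j * w - r * q)) / real N"
        by simp
      then have "\<gamma> + real (\<sigma> j) * (of_int r / real N) = real j / real N + of_int (int j * w - r * q)"
        using N by (simp only: \<gamma>_def add_divide_distrib diff_divide_distrib) (simp add: mult.commute)
      then have "frac (\<gamma> + real (\<sigma> j) * (of_int r / real N)) = frac (real j / real N)"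
        by (simp add: frac_def)
      also have "\<dots> = real j / real N" using j by (subst frac_eq) auto
      finally have s: "s (\<sigma> j) = real j / real N - 1/2" by (simp add: s_def)
      have "x + real j * \<alpha> = (u + of_int i0) / real N - \<theta> / 2 + real j * ((of_int p + \<theta>) / real N)"
      proof -
        have "x = (u + of_int i0) / real N - \<theta> / 2" using x unfolding \<theta>_def by linarith
        moreover have "real j * \<alpha> = real j * ((of_int p + \<theta>) / real N)" by (rule arg_cong[OF \<alpha>])
        ultimately show ?thesis by (rule arg_cong2[where f = "(+)"])
      qed
      also have "\<dots> = (u + (of_int i0 + real j * of_int p)) / real N + \<theta> * (real j / real N - 1/2)"
        by (simp add: algebra_simps add_divide_distrib)
      also have "\<dots> = t (\<sigma> j) + \<theta> * s (\<sigma> j) + of_int q"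
        unfolding er s t_def using N by (simp add: add_divide_distrib)
      finally show ?thesis using periodic_int by simp
    qed
    have "(\<Sum>j<N. f (x + real j * \<alpha>)) = (\<Sum>j<N. f (t (\<sigma> j) + \<theta> * s (\<sigma> j)))"
      using point by (intro sum.cong) auto
    also have "\<dots> = (\<Sum>i<N. f (t i + \<theta> * s i))" by (rule sum.reindex_bij_betw[OF bij])
    finally have sum1: "(\<Sum>j<N. f (x + real j * \<alpha>)) = (\<Sum>i<N. f (t i + \<theta> * s i))" .
    have taylor: "\<bar>f (t i + \<theta> * s i) - f (t i) - \<theta> * s i * f' (t i)\<bar>
        \<le> \<eta> * (C / \<kappa>\<^sup>2) * (1 / (real i + 1)\<^sup>2 + 1 / (real (N - Suc i) + 1)\<^sup>2)" if i: "i < N" for i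
    proof -
      define M where "M = C * (real N)\<^sup>2 * (1 / (\<kappa>/2)\<^sup>2 * (1 / (real i + 1)\<^sup>2) + 1 / (\<kappa>/2)\<^sup>2 * (1 / (real (N - Suc i) + 1)\<^sup>2))"
      \<comment> \<open>The displacement is at most \<eta> / (2 N), hence at most half of the margin
        \<kappa> / N; perturbed points remain in their cell with relative margin
        \<open>\<kappa>/2\<close>, the value used in \<open>M\<close>.\<close>
      define \<epsilon> where "\<epsilon> = \<kappa> / (2 * real N)"
      have sh: "\<bar>s i\<bar> \<le> 1/2"
        using frac_ge_0[of "\<gamma> + real i * (of_int r / real N)"] frac_lt_1[of "\<gamma> + real i * (of_int r / real N)"]
        unfolding s_def by linarith
      have h1: "\<bar>\<theta> * s i\<bar> \<le> \<eta> / real N * (1/2)"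
        unfolding abs_mult using \<theta> sh by (intro mult_mono) auto
      also have "\<dots> \<le> \<kappa> / real N * (1/2)" using \<eta> by (intro mult_right_mono divide_right_mono) auto
      finally have h: "\<bar>\<theta> * s i\<bar> \<le> \<epsilon>" by (simp add: \<epsilon>_def)
      have near: "\<exists>v. \<kappa>/2 \<le> v \<and> v \<le> 1 - \<kappa>/2 \<and> y = (v + real i) / real N" if y: "\<bar>y - t i\<bar> \<le> \<epsilon>" for y
      proof (intro exI conjI)
        have "\<bar>real N * y - (u + real i)\<bar> = real N * \<bar>y - t i\<bar>"
        proof -
          have "real N * y - (u + real i) = real N * (y - t i)" using N by (simp add: t_def field_simps)
          then show ?thesis by (simp add: abs_mult)
        qed
        also have "\<dots> \<le> real N * \<epsilon>" using y by (intro mult_left_mono) auto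
        also have "\<dots> = \<kappa> / 2" using N by (simp add: \<epsilon>_def)
        finally have "\<bar>real N * y - real i - u\<bar> \<le> \<kappa> / 2" by (simp add: algebra_simps)
        then show "\<kappa>/2 \<le> real N * y - real i" "real N * y - real i \<le> 1 - \<kappa>/2" using u by linarith+
        show "y = (real N * y - real i + real i) / real N" using N by simp
      qed
      have "\<bar>f (t i + \<theta> * s i) - f (t i) - (\<theta> * s i) * f' (t i)\<bar> \<le> M * (\<theta> * s i)\<^sup>2"
      proof (rule taylor_first_order_bound[OF _ _ _ h])
        fix y assume "\<bar>y - t i\<bar> \<le> \<epsilon>"
        then obtain v where v: "\<kappa>/2 \<le> v" "v \<le> 1 - \<kappa>/2" "y = (v + real i) / real N" using near by blast
        have v0: "0 < v" "v < 1" using v \<kappa> by auto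
        have y01: "0 < y" "y < 1" using cell[OF v0 i] v by auto
        show "(f has_real_derivative f' y) (at y)" using y01 by (intro deriv not_Ints)
        show "(f' has_real_derivative f'' y) (at y)" using y01 by (intro deriv2 not_Ints)
        have e: "real N - (v + real i) = 1 - v + real (N - Suc i)" using i by (simp add: of_nat_diff)
        have "\<bar>f'' y\<bar> \<le> C * (real N)\<^sup>2 * (1 / (v + real i)\<^sup>2 + 1 / (1 - v + real (N - Suc i))\<^sup>2)"
          using bound2_cell[OF v0 i] unfolding v(3) e .
        also have "\<dots> \<le> M"
          unfolding M_def using \<kappa> v C_nonneg by (intro mult_left_mono add_mono inverse_square_le_scaled) auto
        finally show "\<bar>f'' y\<bar> \<le> M" .
      qed
      also have "\<dots> \<le> M * (\<eta> / real N * (1/2))\<^sup>2"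
      proof (intro mult_left_mono)
        show "(\<theta> * s i)\<^sup>2 \<le> (\<eta> / real N * (1/2))\<^sup>2"
          using h1 \<eta>0 by (subst abs_le_square_iff[symmetric]) auto
        show "0 \<le> M" unfolding M_def using C_nonneg by (intro mult_nonneg_nonneg add_nonneg_nonneg) auto
      qed
      also have "\<dots> = \<eta>\<^sup>2 * (C / \<kappa>\<^sup>2) * (1 / (real i + 1)\<^sup>2 + 1 / (real (N - Suc i) + 1)\<^sup>2)"
      proof -
        have scaled: "C * n\<^sup>2 * (1 / (\<kappa>/2)\<^sup>2 * a + 1 / (\<kappa>/2)\<^sup>2 * b) * (\<eta> / n * (1/2))\<^sup>2 = \<eta>\<^sup>2 * (C / \<kappa>\<^sup>2) * (a + b)" if "n > 0" for n a b :: real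
          using that \<kappa> by (simp add: power2_eq_square field_simps)
        show ?thesis unfolding M_def by (rule scaled) (use N in simp)
      qed
      also have "\<dots> \<le> \<eta> * (C / \<kappa>\<^sup>2) * (1 / (real i + 1)\<^sup>2 + 1 / (real (N - Suc i) + 1)\<^sup>2)"
      proof (intro mult_right_mono)
        have "\<eta> * \<eta> \<le> \<eta> * 1" using \<eta> \<kappa> \<eta>0 by (intro mult_left_mono) auto
        then show "\<eta>\<^sup>2 \<le> \<eta>" by (simp add: power2_eq_square)
      qed (use C_nonneg in auto)
      finally show ?thesis .
    qed
    define R where "R = (\<Sum>i<N. f (t i + \<theta> * s i) - f (t i) - \<theta> * s i * f' (t i))"
    have "\<bar>R\<bar> \<le> (\<Sum>i<N. \<bar>f (t i + \<theta> * s i) - f (t i) - \<theta> * s i * f' (t i)\<bar>)" unfolding R_def by (rule sum_abs)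
    also have "\<dots> \<le> (\<Sum>i<N. \<eta> * (C / \<kappa>\<^sup>2) * (1 / (real i + 1)\<^sup>2 + 1 / (real (N - Suc i) + 1)\<^sup>2))"
      using taylor by (intro sum_mono) auto
    also have "\<dots> = \<eta> * (C / \<kappa>\<^sup>2) * ((\<Sum>i<N. 1 / (real i + 1)\<^sup>2) + (\<Sum>i<N. 1 / (real (N - Suc i) + 1)\<^sup>2))"
      by (simp only: sum_distrib_left[symmetric] sum.distrib)
    also have "(\<Sum>i<N. 1 / (real (N - Suc i) + 1)\<^sup>2) = (\<Sum>i<N. 1 / (real i + 1)\<^sup>2)"
      by (rule sum.nat_diff_reindex)
    also have "\<eta> * (C / \<kappa>\<^sup>2) * ((\<Sum>i<N. 1 / (real i + 1)\<^sup>2) + (\<Sum>i<N. 1 / (real i + 1)\<^sup>2)) \<le> \<eta> * (C / \<kappa>\<^sup>2) * (2 + 2)"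
      using \<eta>0 C_nonneg by (intro mult_left_mono add_mono sum_inverse_square_le) auto
    finally have R: "\<bar>R\<bar> \<le> 4 * C / \<kappa>\<^sup>2 * \<eta>" by (simp add: mult_ac)
    define V where "V = (\<Sum>i<N. s i * f' (t i))"
    have "\<bar>V\<bar> \<le> K1 * real N" unfolding V_def s_def t_def by (rule K1(2)[OF wp r u])
    then have "\<bar>\<theta> * V\<bar> \<le> \<eta> / real N * (K1 * real N)" unfolding abs_mult using \<theta> by (intro mult_mono) auto
    then have V: "\<bar>\<theta> * V\<bar> \<le> K1 * \<eta>" using N by (simp add: mult.commute)
    have "(\<Sum>i<N. f (t i + \<theta> * s i)) - \<Psi> N u = R + \<theta> * V"
      by (simp add: R_def V_def \<Psi>_def t_def sum_subtractf sum_distrib_left mult.assoc)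
    then have "\<bar>(\<Sum>i<N. f (t i + \<theta> * s i)) - \<Psi> N u\<bar> \<le> 4 * C / \<kappa>\<^sup>2 * \<eta> + K1 * \<eta>" using R V by linarith
    then show ?thesis unfolding sum1 K_def by (simp add: distrib_right add.commute)
  qed
  moreover have "0 \<le> K" using K1(1) C_nonneg by (simp add: K_def)
  ultimately show ?thesis using that by blast
qed

text \<open>Two errors of size \<open>\<epsilon>/2\<close>: passing from the Birkhoff sum to the
  lattice sum costs \<open>K * \<eta>\<close>, and moving by c / ln N away from the point where the
  lattice sum equals \<open>a\<close> costs \<open>B * c\<close>, as the slope is at most B ln N.
  The approximation is taken with margin \<open>\<kappa>/2\<close> to leave room for this
  move.\<close>

lemma birkhoff_sum_hits:
  assumes a: "0 < a" and \<epsilon>: "0 < \<epsilon>"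
  obtains c \<eta> N0 where "0 < c" "0 < \<eta>" "\<eta> \<le> 1/2"
    "\<And>Q N p \<alpha> \<rho>. \<lbrakk>N0 \<le> N; well_placed Q N p; \<bar>\<alpha> - of_int p / real N\<bar> < \<eta> / (real N * real Q); \<rho> \<le> c / ln (real N)\<rbrakk> \<Longrightarrow>
      \<exists>b. \<forall>x\<in>comb (real N) b \<rho>. \<bar>(\<Sum>j<N. f (x + real j * \<alpha>)) - a\<bar> < \<epsilon>"
proof -
  obtain \<kappa> N1 where \<kappa>: "0 < \<kappa>" "\<kappa> \<le> 1/4" and hits: "\<And>N. \<lbrakk>N1 \<le> N; 0 < N\<rbrakk> \<Longrightarrow> \<exists>u\<in>{\<kappa>..1-\<kappa>}. \<Psi> N u = a"
    using \<Psi>_hits[OF a] by blast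
  have \<kappa>2: "0 < \<kappa>/2" "\<kappa>/2 \<le> 1/2" using \<kappa> by auto
  obtain K where K: "0 \<le> K"
    "\<And>Q N p \<alpha> \<eta> x u i0. \<lbrakk>well_placed Q N p; \<bar>real N * \<alpha> - of_int p\<bar> \<le> \<eta> / real N; \<eta> \<le> \<kappa>/2; \<kappa>/2 \<le> u; u \<le> 1 - \<kappa>/2;
       x + (real N * \<alpha> - of_int p) / 2 = (u + of_int i0) / real N\<rbrakk> \<Longrightarrow>
      \<bar>(\<Sum>j<N. f (x + real j * \<alpha>)) - \<Psi> N u\<bar> \<le> K * \<eta>"
    using birkhoff_sum_approx[OF \<kappa>2] by blast
  obtain C2 where C2: "0 \<le> C2" "\<And>N. 0 < N \<Longrightarrow> \<bar>\<Psi>' N (1/2)\<bar> \<le> C2 * (1 + ln (real N))"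
    using \<Psi>'_half_bound by blast
  define B where "B = 2 * C2 + 8 * C / \<kappa> + 1"
  define \<eta> where "\<eta> = min (\<kappa>/2) (\<epsilon> / (2 * (K + 1)))"
  define c where "c = min (\<kappa>/2) (\<epsilon> / (2 * B))"
  have B0: "0 < B" using C2(1) C_nonneg \<kappa> by (simp add: B_def add_nonneg_pos)
  have \<eta>: "0 < \<eta>" "\<eta> \<le> \<kappa>/2" "\<eta> \<le> 1/2" and K\<eta>: "K * \<eta> < \<epsilon>/2"
  proof -
    show "0 < \<eta>" using \<kappa> \<epsilon> K(1) by (simp add: \<eta>_def)
    show "\<eta> \<le> \<kappa>/2" unfolding \<eta>_def by (rule min.cobounded1)
    then show "\<eta> \<le> 1/2" using \<kappa> by linarith
    have "K * \<eta> < (K + 1) * \<eta>" using \<open>0 < \<eta>\<close> by simp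
    also have "\<dots> \<le> (K + 1) * (\<epsilon> / (2 * (K + 1)))" using K(1) by (intro mult_left_mono) (auto simp: \<eta>_def)
    also have "\<dots> = \<epsilon>/2"
    proof -
      have "z * (\<epsilon> / (2 * z)) = \<epsilon>/2" if "z \<noteq> 0" for z using that by simp
      then show ?thesis using K(1) by (smt (verit))
    qed
    finally show "K * \<eta> < \<epsilon>/2" .
  qed
  have c: "0 < c" "c \<le> \<kappa>/2" "B * c \<le> \<epsilon>/2"
  proof -
    show "0 < c" using \<kappa> \<epsilon> B0 by (simp add: c_def)
    show "c \<le> \<kappa>/2" unfolding c_def by (rule min.cobounded1)
    have "B * c \<le> B * (\<epsilon> / (2 * B))" using B0 by (intro mult_left_mono) (auto simp: c_def)
    then show "B * c \<le> \<epsilon>/2" using B0 by simp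
  qed
  have "\<exists>b. \<forall>x\<in>comb (real N) b \<rho>. \<bar>(\<Sum>j<N. f (x + real j * \<alpha>)) - a\<bar> < \<epsilon>"
    if N: "max N1 3 \<le> N" and wp: "well_placed Q N p" and ap: "\<bar>\<alpha> - of_int p / real N\<bar> < \<eta> / (real N * real Q)"
      and \<rho>: "\<rho> \<le> c / ln (real N)" for Q N p \<alpha> \<rho>
  proof -
    have N0: "0 < N" using N by simp
    have Q: "N \<le> Q" using wp by (simp add: well_placed_def)
    have lnN: "1 \<le> ln (real N)"
    proof -
      have "exp 1 \<le> real N" using e_less_272 N by simp
      then show ?thesis using N0 by (simp add: ln_ge_iff)
    qed
    obtain u where u: "u \<in> {\<kappa>..1-\<kappa>}" "\<Psi> N u = a" using hits[of N] N by auto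
    define \<theta> where "\<theta> = real N * \<alpha> - of_int p"
    have \<theta>: "\<bar>real N * \<alpha> - of_int p\<bar> \<le> \<eta> / real N"
    proof -
      have "\<bar>real N * \<alpha> - of_int p\<bar> = real N * \<bar>\<alpha> - of_int p / real N\<bar>"
      proof -
        have "real N * \<alpha> - of_int p = real N * (\<alpha> - of_int p / real N)" using N0 by (simp add: field_simps)
        then show ?thesis by (simp add: abs_mult)
      qed
      also have "\<dots> \<le> real N * (\<eta> / (real N * real Q))" using ap by (intro mult_left_mono) auto
      also have "\<dots> = \<eta> / real Q" using N0 by simp
      also have "\<dots> \<le> \<eta> / real N" using Q N0 \<eta> by (intro divide_left_mono) auto
      finally show ?thesis .
    qed
    \<comment> \<open>The offset compensates the centring by \<open>\<theta> / 2\<close> in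
      \<open>birkhoff_sum_approx\<close>; the integer of the tooth becomes the index
      \<open>i0\<close> of the cell.\<close>
    have "\<bar>(\<Sum>j<N. f (x + real j * \<alpha>)) - a\<bar> < \<epsilon>" if x: "x \<in> comb (real N) (u - real N * \<theta> / 2) \<rho>" for x
    proof -
      obtain i where i: "\<bar>real N * x - (u - real N * \<theta> / 2) - of_int i\<bar> < \<rho>" using x by (auto simp: comb_def)
      define v where "v = real N * x + real N * \<theta> / 2 - of_int i"
      have vu: "\<bar>v - u\<bar> < \<rho>" using i by (simp add: v_def algebra_simps)
      have "c / ln (real N) \<le> c / 1" using lnN c by (intro divide_left_mono) auto
      then have "\<bar>v - u\<bar> < \<kappa>/2" using vu \<rho> c by linarith
      moreover have "\<kappa> \<le> u" "u \<le> 1 - \<kappa>" using u(1) by auto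
      ultimately have v: "\<kappa>/2 \<le> v" "v \<le> 1 - \<kappa>/2" by linarith+
      have xv: "x + (real N * \<alpha> - of_int p) / 2 = (v + of_int i) / real N"
      proof -
        have "(v + of_int i) / real N = x + \<theta> / 2" using N0 by (simp add: v_def add_divide_distrib)
        then show ?thesis by (simp add: \<theta>_def)
      qed
      have 1: "\<bar>(\<Sum>j<N. f (x + real j * \<alpha>)) - \<Psi> N v\<bar> \<le> K * \<eta>" by (rule K(2)[OF wp \<theta> \<eta>(2) v xv])
      have "norm (\<Psi> N v - \<Psi> N u) \<le> (B * ln (real N)) * norm (v - u)"
      proof (rule field_differentiable_bound[of "{\<kappa>/2..1-\<kappa>/2}" "\<Psi> N" "\<Psi>' N"])
        show "(\<Psi> N has_field_derivative \<Psi>' N z) (at z within {\<kappa>/2..1-\<kappa>/2})" if "z \<in> {\<kappa>/2..1-\<kappa>/2}" for z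
          using that \<kappa> N0 by (intro has_field_derivative_at_within[OF \<Psi>_deriv]) auto
        show "norm (\<Psi>' N z) \<le> B * ln (real N)" if z: "z \<in> {\<kappa>/2..1-\<kappa>/2}" for z
        proof -
          have z0: "0 < z" "z < 1" using z \<kappa> by auto
          have "\<bar>\<Psi>' N z - \<Psi>' N (1/2)\<bar> \<le> 2 * C * (1 / z + 1 / (1 - z))"
            by (rule inverse_square_second_derivative.bound1[OF \<Psi>_second_derivative[OF N0] z0])
          also have "\<dots> \<le> 2 * C * (1 / (\<kappa>/2) + 1 / (\<kappa>/2))"
            using z z0 \<kappa> C_nonneg by (intro mult_left_mono add_mono divide_left_mono) auto
          also have "\<dots> = 8 * C / \<kappa> * 1" by simp
          also have "\<dots> \<le> 8 * C / \<kappa> * ln (real N)" using lnN C_nonneg \<kappa> by (intro mult_left_mono) auto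
          finally have A: "\<bar>\<Psi>' N z - \<Psi>' N (1/2)\<bar> \<le> 8 * C / \<kappa> * ln (real N)" .
          have "\<bar>\<Psi>' N (1/2)\<bar> \<le> C2 * (1 + ln (real N))" by (rule C2(2)[OF N0])
          also have "\<dots> \<le> C2 * (2 * ln (real N))" using lnN C2(1) by (intro mult_left_mono) auto
          finally have "\<bar>\<Psi>' N z\<bar> \<le> C2 * (2 * ln (real N)) + 8 * C / \<kappa> * ln (real N)" using A by linarith
          also have "\<dots> \<le> B * ln (real N)" using lnN by (simp add: B_def algebra_simps)
          finally show ?thesis by simp
        qed
      qed (use v u \<kappa> in auto)
      also have "\<dots> \<le> (B * ln (real N)) * (c / ln (real N))"
        using vu \<rho> B0 lnN by (intro mult_left_mono) auto
      also have "\<dots> = B * c" using lnN by simp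
      finally have "\<bar>\<Psi> N v - a\<bar> \<le> \<epsilon>/2" using c(3) u(2) by simp
      then show ?thesis using 1 K\<eta> by linarith
    qed
    then show ?thesis by blast
  qed
  then show ?thesis using c \<eta> by (intro that[of c \<eta> "max N1 3"]) auto
qed

end

section \<open>Translation invariant sets\<close>

lemma measure_Int_interval_add:
  assumes B: "B \<in> sets borel" and abc: "a \<le> b" "b \<le> c"
  shows "measure lborel (B \<inter> {a..c::real}) = measure lborel (B \<inter> {a..b}) + measure lborel (B \<inter> {b..c})"
proof -
  have "measure lborel (B \<inter> {a..b} \<union> B \<inter> {b..c}) = measure lborel (B \<inter> {a..b}) + measure lborel (B \<inter> {b..c})"
  proof (rule measure_Un_AE)
    have "AE x in lborel. x \<noteq> b" by (rule AE_lborel_singleton)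
    then show "AE x in lborel. x \<notin> B \<inter> {a..b} \<or> x \<notin> B \<inter> {b..c}" by eventually_elim auto
  qed (auto intro!: fmeasurable_Int_interval B)
  moreover have "B \<inter> {a..b} \<union> B \<inter> {b..c} = B \<inter> {a..c}" using abc by auto
  ultimately show ?thesis by simp
qed

lemma measure_Int_interval_le_shift:
  assumes B: "B \<in> sets borel"
  shows "measure lborel (B \<inter> {u..v::real}) \<le> measure lborel (B \<inter> {u'..v'}) + \<bar>u - u'\<bar> + \<bar>v - v'\<bar>"
proof -
  have "measure lborel (B \<inter> {u..v}) \<le> measure lborel ((B \<inter> {u'..v'}) \<union> {u..u'} \<union> {v'..v})"
    by (intro measure_mono_fmeasurable fmeasurable.Un fmeasurable_Int_interval fmeasurable_interval) (use B in auto)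
  also have "\<dots> \<le> measure lborel (B \<inter> {u'..v'}) + measure lborel {u..u'} + measure lborel {v'..v}"
    by (intro order_trans[OF measure_Un_le] add_right_mono measure_Un_le) (use B in auto)
  also have "measure lborel {u..u'} \<le> \<bar>u - u'\<bar>" by (cases "u \<le> u'") auto
  also have "measure lborel {v'..v} \<le> \<bar>v - v'\<bar>" by (cases "v' \<le> v") auto
  finally show ?thesis by simp
qed

lemma emeasure_lborel_translate:
  assumes "B \<in> sets borel"
  shows "emeasure lborel ((\<lambda>x. x + t) -` B) = emeasure lborel (B :: real set)"
proof -
  have comm: "(\<lambda>x. x + t) = (+) t" by (simp add: add.commute fun_eq_iff)
  have "emeasure lborel B = emeasure (distr lborel borel ((+) t)) B"
    by (simp add: lborel_distr_plus)
  also have "\<dots> = emeasure lborel ((\<lambda>x. x + t) -` B)"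
    unfolding comm using assms by (subst emeasure_distr) auto
  finally show ?thesis by simp
qed

lemma measure_lborel_translate:
  "B \<in> sets borel \<Longrightarrow> measure lborel ((\<lambda>x. x + t) -` B) = measure lborel (B :: real set)"
  by (simp add: measure_def emeasure_lborel_translate)

text \<open>Rational endpoints and shifts make these countably many conditions, so that almost every
  section can satisfy all of them at once.\<close>

definition homogeneous :: "real set \<Rightarrow> bool" where
  "homogeneous B \<longleftrightarrow> (\<forall>u\<in>\<rat>. \<forall>v\<in>\<rat>. \<forall>a\<in>\<rat>. u < v \<longrightarrow> 0 < a \<longrightarrow>
     measure lborel (B \<inter> {u..v}) = measure lborel (B \<inter> {u + a..v + a}))"

text \<open>Grid cells of equal length carry equal mass, so \<open>B\<close> has the same density
  \<open>c\<close> in every interval. For c < 1 this excludes the intervals of density near 1 that a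
  set of positive measure must have.\<close>

lemma homogeneous_null:
  assumes B: "B \<in> sets borel" and hom: "homogeneous B" and c: "measure lborel (B \<inter> {0..1}) < 1"
  shows "emeasure lborel B = 0"
proof (rule ccontr)
  assume nz: "emeasure lborel B \<noteq> 0"
  define c where "c = measure lborel (B \<inter> {0..1})"
  have cell: "measure lborel (B \<inter> {of_int i / real n..(of_int i + real k) / real n}) = real k * (c / real n)"
    if n: "n > 0" for n k and i :: int
  proof -
    define d where "d = (\<lambda>i::int. measure lborel (B \<inter> {of_int i / real n..of_int (i + 1) / real n}))"
    have nr: "real n > 0" using n by simp
    have dd: "d i = d j" if "i < j" for i j
    proof -
      have 1: "of_int i / real n + of_int (j - i) / real n = of_int j / real n"
        "of_int (i + 1) / real n + of_int (j - i) / real n = of_int (j + 1) / real n"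
        by (simp_all add: add_divide_distrib[symmetric])
      have "measure lborel (B \<inter> {of_int i / real n..of_int (i + 1) / real n})
        = measure lborel (B \<inter> {of_int i / real n + of_int (j - i) / real n..of_int (i + 1) / real n + of_int (j - i) / real n})"
        using hom[unfolded homogeneous_def] nr that
        by (auto simp: divide_strict_right_mono)
      then show ?thesis unfolding 1 d_def .
    qed
    then have d0: "d i = d 0" for i by (metis linorder_neqE)
    have run: "measure lborel (B \<inter> {of_int i / real n..(of_int i + real k) / real n}) = real k * d 0" for i :: int and k :: nat
    proof (induction k)
      case 0
      have "measure lborel (B \<inter> {of_int i / real n..of_int i / real n}) \<le> measure lborel {of_int i / real n..of_int i / real n}"
        using B by (intro measure_mono_fmeasurable fmeasurable_interval) auto
      then show ?case by (simp add: measure_le_0_iff)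
    next
      case (Suc k)
      have "measure lborel (B \<inter> {of_int i / real n..(of_int i + real (Suc k)) / real n})
        = measure lborel (B \<inter> {of_int i / real n..(of_int i + real k) / real n})
          + measure lborel (B \<inter> {(of_int i + real k) / real n..(of_int i + real (Suc k)) / real n})"
        using nr by (intro measure_Int_interval_add B divide_right_mono) auto
      also have "measure lborel (B \<inter> {(of_int i + real k) / real n..(of_int i + real (Suc k)) / real n}) = d (i + int k)"
        by (simp add: d_def add_ac)
      finally show ?case using Suc d0 by (simp add: distrib_right)
    qed
    have "c = real n * d 0" using run[of 0 n] nr by (simp add: c_def)
    then show ?thesis using run[of i k] nr by simp
  qed
  \<comment> \<open>Rounding the endpoints outwards to a grid of mesh 1 / n costs at most two cells,
    which vanish in the limit.\<close>
  have le: "measure lborel (B \<inter> {u..v}) \<le> c * (v - u)" if uv: "u < v" for u v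
  proof (rule LIMSEQ_le_const)
    have "(\<lambda>n. c * (v - u) + 2 * c * (1 / real n)) \<longlonglongrightarrow> c * (v - u) + 2 * c * 0"
      by (intro tendsto_intros lim_1_over_n)
    then show "(\<lambda>n. c * (v - u) + 2 * c * (1 / real n)) \<longlonglongrightarrow> c * (v - u)" by simp
    have "measure lborel (B \<inter> {u..v}) \<le> c * (v - u) + 2 * c * (1 / real n)" if n: "1 \<le> n" for n
    proof -
      define i where "i = \<lfloor>real n * u\<rfloor>"
      define k where "k = nat (\<lceil>real n * v\<rceil> - i)"
      have nr: "real n > 0" using n by simp
      have "real n * u < real n * v" using uv nr by simp
      then have "i \<le> \<lceil>real n * v\<rceil>" unfolding i_def by linarith
      then have k: "of_int i + real k = of_int \<lceil>real n * v\<rceil>" by (simp add: k_def)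
      have "of_int i / real n \<le> u"
        using nr by (simp add: i_def pos_divide_le_eq mult.commute)
      moreover have "v \<le> (of_int i + real k) / real n"
        using nr unfolding k by (simp add: pos_le_divide_eq mult.commute)
      ultimately have "measure lborel (B \<inter> {u..v}) \<le> measure lborel (B \<inter> {of_int i / real n..(of_int i + real k) / real n})"
        using B by (intro measure_mono_fmeasurable fmeasurable_Int_interval) auto
      also have "\<dots> = real k * (c / real n)" using n by (intro cell) auto
      also have "\<dots> \<le> (real n * (v - u) + 2) * (c / real n)"
      proof (intro mult_right_mono)
        have "of_int i + real k \<le> real n * v + 1" unfolding k by linarith
        moreover have "real n * u - 1 \<le> of_int i" unfolding i_def by linarith
        ultimately show "real k \<le> real n * (v - u) + 2" unfolding right_diff_distrib by linarith
      qed (auto simp: c_def)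
      also have "\<dots> = c * (v - u) + 2 * c * (1 / real n)" using nr by (simp add: field_simps)
      finally show ?thesis .
    qed
    then show "\<exists>N. \<forall>n\<ge>N. measure lborel (B \<inter> {u..v}) \<le> c * (v - u) + 2 * c * (1 / real n)" by blast
  qed
  have c01: "0 \<le> c" "c < 1" using c by (auto simp: c_def)
  obtain u v where uv: "u < v" "(1 - (1 - c) / 2) * (v - u) \<le> measure lborel (B \<inter> {u..v})"
    using exists_interval_of_high_density[of B "(1 - c) / 2"] B nz c01 by auto
  then have "(1 - (1 - c) / 2) * (v - u) \<le> c * (v - u)" using le[OF uv(1)] by linarith
  then have "1 - (1 - c) / 2 \<le> c" using uv(1) by simp
  then show False using c01 by (simp add: field_simps)
qed

lemma homogeneous_null_or_conull:
  assumes B: "B \<in> sets borel" and hom: "homogeneous B"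
  shows "emeasure lborel B = 0 \<or> emeasure lborel (- B) = 0"
proof (cases "measure lborel (B \<inter> {0..1}) < 1")
  case True
  then show ?thesis using homogeneous_null[OF B hom] by blast
next
  case False
  have compl: "measure lborel (- B \<inter> {u..v}) = (v - u) - measure lborel (B \<inter> {u..v})" if "u \<le> v" for u v
  proof -
    have "measure lborel (B \<inter> {u..v} \<union> - B \<inter> {u..v}) = measure lborel (B \<inter> {u..v}) + measure lborel (- B \<inter> {u..v})"
      by (rule measure_Un_AE) (use B in \<open>auto intro!: fmeasurable_Int_interval\<close>)
    moreover have "B \<inter> {u..v} \<union> - B \<inter> {u..v} = {u..v}" by auto
    ultimately show ?thesis using that by simp
  qed
  have "homogeneous (- B)"
    unfolding homogeneous_def
  proof (intro ballI impI)
    fix u v a :: real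
    assume *: "u \<in> \<rat>" "v \<in> \<rat>" "a \<in> \<rat>" "u < v" "0 < a"
    then have "measure lborel (B \<inter> {u..v}) = measure lborel (B \<inter> {u + a..v + a})"
      using hom unfolding homogeneous_def by blast
    then show "measure lborel (- B \<inter> {u..v}) = measure lborel (- B \<inter> {u + a..v + a})"
      using compl[of u v] compl[of "u + a" "v + a"] \<open>u < v\<close> by simp
  qed
  moreover have "measure lborel (- B \<inter> {0..1}) < 1" using False compl[of 0 1] by simp
  ultimately show ?thesis using homogeneous_null[of "- B"] B by simp
qed

text \<open>Ergodicity of the irrational rotation through homogeneity: Dirichlet gives invariance
  under arbitrarily small g = |k \<alpha> - h| > 0, multiples of g come within g of any shift, and
  the mass of an interval depends continuously on its endpoints.\<close>

lemma rotation_invariant_null_or_conull: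
  fixes H :: "real set" and \<alpha> :: real
  assumes H: "H \<in> sets borel" and \<alpha>: "\<alpha> \<notin> \<rat>"
    and rot: "\<And>x. x + \<alpha> \<in> H \<longleftrightarrow> x \<in> H" and per: "\<And>x. x + 1 \<in> H \<longleftrightarrow> x \<in> H"
  shows "emeasure lborel H = 0 \<or> emeasure lborel (- H) = 0"
proof (rule homogeneous_null_or_conull[OF H])
  have shift_nat: "x + real n * g \<in> H \<longleftrightarrow> x \<in> H" if g: "\<And>x. x + g \<in> H \<longleftrightarrow> x \<in> H" for x g n
  proof (induction n)
    case (Suc n)
    have "x + real (Suc n) * g = (x + real n * g) + g" by (simp add: algebra_simps)
    then have "x + real (Suc n) * g \<in> H \<longleftrightarrow> (x + real n * g) + g \<in> H" by (simp only:)
    then show ?case using Suc g by blast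
  qed simp
  have shift_int: "x + of_int n * g \<in> H \<longleftrightarrow> x \<in> H" if g: "\<And>x. x + g \<in> H \<longleftrightarrow> x \<in> H" for x g n
  proof (cases "n \<ge> 0")
    case True
    then show ?thesis using shift_nat[OF g, of x "nat n"] by simp
  next
    case False
    then show ?thesis using shift_nat[OF g, of "x + of_int n * g" "nat (- n)"] by simp
  qed
  have inv_measure: "measure lborel (H \<inter> {u..v}) = measure lborel (H \<inter> {u + g..v + g})"
    if g: "\<And>x. x + g \<in> H \<longleftrightarrow> x \<in> H" for u v g
  proof -
    have "measure lborel (H \<inter> {u + g..v + g}) = measure lborel ((\<lambda>x. x + g) -` (H \<inter> {u + g..v + g}))"
      using H by (intro measure_lborel_translate[symmetric]) auto
    also have "(\<lambda>x. x + g) -` (H \<inter> {u + g..v + g}) = H \<inter> {u..v}" using g by auto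
    finally show ?thesis ..
  qed
  have all: "measure lborel (H \<inter> {u..v}) = measure lborel (H \<inter> {u + a..v + a})" if a: "0 < a" for u v a
  proof -
    have close: "\<bar>measure lborel (H \<inter> {u..v}) - measure lborel (H \<inter> {u + a..v + a})\<bar> \<le> e" if e: "0 < e" for e :: real
    proof -
      obtain M :: nat where M: "M > 0" "1 / real M < e / 2"
        using real_arch_inverse[of "e / 2"] e by (auto simp: inverse_eq_divide)
      obtain h k where hk: "0 < k" "\<bar>of_int k * \<alpha> - of_int h\<bar> < 1 / real M"
        using Dirichlet_approx[OF M(1)] by metis
      define g where "g = \<bar>of_int k * \<alpha> - of_int h\<bar>"
      have "of_int k * \<alpha> - of_int h \<noteq> 0"
      proof
        assume "of_int k * \<alpha> - of_int h = 0"
        then have "\<alpha> = of_int h / of_int k" using hk by (simp add: field_simps)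
        then show False using \<alpha> by simp
      qed
      then have g0: "0 < g" by (simp add: g_def)
      have base: "x + (of_int k * \<alpha> - of_int h) \<in> H \<longleftrightarrow> x \<in> H" for x
      proof -
        have "x + (of_int k * \<alpha> - of_int h) \<in> H \<longleftrightarrow> (x + of_int k * \<alpha>) + of_int (- h) * 1 \<in> H"
          by (simp add: algebra_simps)
        also have "\<dots> \<longleftrightarrow> x + of_int k * \<alpha> \<in> H" by (rule shift_int[OF per])
        also have "\<dots> \<longleftrightarrow> x \<in> H" by (rule shift_int[OF rot])
        finally show ?thesis .
      qed
      have ginv: "x + g \<in> H \<longleftrightarrow> x \<in> H" for x
        using base[of x] base[of "x + g"] by (auto simp: g_def abs_if split: if_splits)
      define n where "n = nat \<lfloor>a / g\<rfloor>"
      have "0 \<le> a / g" using a g0 by simp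
      then have "real n \<le> a / g" "a / g < real n + 1" unfolding n_def by linarith+
      then have n: "real n * g \<le> a" "a < real n * g + g" using g0 by (auto simp: field_simps)
      have ng: "\<bar>a - real n * g\<bar> \<le> e / 2" using n M hk by (auto simp: g_def[symmetric])
      have eq: "measure lborel (H \<inter> {u..v}) = measure lborel (H \<inter> {u + real n * g..v + real n * g})"
        by (rule inv_measure, rule shift_nat, rule ginv)
      show ?thesis
        unfolding eq
        using measure_Int_interval_le_shift[OF H, of "u + real n * g" "v + real n * g" "u + a" "v + a"]
          measure_Int_interval_le_shift[OF H, of "u + a" "v + a" "u + real n * g" "v + real n * g"] ng
          abs_minus_commute[of a "real n * g"]
        by (simp add: abs_le_iff)
    qed
    have "\<bar>measure lborel (H \<inter> {u..v}) - measure lborel (H \<inter> {u + a..v + a})\<bar> \<le> 0"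
    proof (rule field_le_epsilon)
      fix e :: real assume "0 < e"
      from close[OF this] show "\<bar>measure lborel (H \<inter> {u..v}) - measure lborel (H \<inter> {u + a..v + a})\<bar> \<le> 0 + e"
        by simp
    qed
    then show ?thesis by simp
  qed
  then show "homogeneous H" unfolding homogeneous_def by blast
qed

section \<open>Functions with a logarithmic singularity\<close>

lemma has_integral_translate:
  fixes g :: "real \<Rightarrow> real"
  assumes "(g has_integral I) {a..b}"
  shows "((\<lambda>x. g (x + c)) has_integral I) {a - c..b - c}"
proof -
  have "((\<lambda>x. g (1 *\<^sub>R x + c)) has_integral (1 / \<bar>1::real\<bar> ^ DIM(real)) *\<^sub>R I) ((\<lambda>x. (1 / 1) *\<^sub>R x + - ((1 / 1) *\<^sub>R c)) ` cbox a b)"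
    using assms by (intro has_integral_affinity) auto
  moreover have "(\<lambda>x::real. (1 / 1) *\<^sub>R x + - ((1 / 1) *\<^sub>R c)) ` cbox a b = {a - c..b - c}"
    using image_add_atLeastAtMost'[of "- c" a b] by simp
  ultimately show ?thesis by simp
qed

lemma has_integral_periodic:
  fixes g :: "real \<Rightarrow> real"
  assumes per: "\<And>x. g (x + 1) = g x" and I: "(g has_integral I) {a..a + 1}"
  shows "(g has_integral I) {b..b + 1}"
proof -
  define a' where "a' = a + of_int \<lfloor>b - a\<rfloor>"
  have a': "a' \<le> b" "b < a' + 1" unfolding a'_def by linarith+
  have "((\<lambda>x. g (x + of_int (- \<lfloor>b - a\<rfloor>))) has_integral I) {a - of_int (- \<lfloor>b - a\<rfloor>)..a + 1 - of_int (- \<lfloor>b - a\<rfloor>)}"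
    by (rule has_integral_translate[OF I])
  then have I': "(g has_integral I) {a'..a' + 1}"
    unfolding periodic_function_of_int[of g, OF per] by (simp add: a'_def algebra_simps)
  have int: "g integrable_on {a'..b}" "g integrable_on {b..a' + 1}"
    using integrable_on_subinterval[of g "{a'..a' + 1}"] has_integral_integrable[OF I'] a' by auto
  define J K where "J = integral {a'..b} g" and "K = integral {b..a' + 1} g"
  have J: "(g has_integral J) {a'..b}" and K: "(g has_integral K) {b..a' + 1}"
    using int by (auto simp: J_def K_def)
  have JK: "J + K = I"
    using has_integral_combine[OF a'(1) less_imp_le[OF a'(2)] J K] I' by (rule has_integral_unique)
  have "((\<lambda>x. g (x + of_int (- 1))) has_integral J) {a' - of_int (- 1)..b - of_int (- 1)}"
    by (rule has_integral_translate[OF J])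
  then have "(g has_integral J) {a' + 1..b + 1}"
    unfolding periodic_function_of_int[of g, OF per] by simp
  then have "(g has_integral K + J) {b..b + 1}"
    using a' by (intro has_integral_combine[OF _ _ K]) auto
  then show ?thesis using JK by (simp add: add.commute)
qed

lemma deriv_periodic:
  fixes g :: "real \<Rightarrow> real"
  assumes per: "\<And>x. g (x + 1) = g x"
  shows "deriv g (x + 1) = deriv g x"
proof -
  have "(g has_real_derivative D) (at (x + 1)) \<longleftrightarrow> (g has_real_derivative D) (at x)" for D
    using DERIV_shift[of g D x 1] by (simp add: per)
  then show ?thesis by (simp add: deriv_def)
qed

text \<open>The limit from the right governs t near 0; the limit from the left governs t near 1
  after moving by one period; continuity on a compact interval covers the rest. The factor
  \<open>sgn A\<close> makes the blow-up at t = 1 positive.\<close>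

lemma log_singularity_cell_bounds:
  assumes ls: "log_singularity \<phi> x0"
  defines "d \<equiv> \<lambda>t. deriv (deriv \<phi>) (x0 + t)"
  obtains A C \<delta> where "A \<noteq> 0" "0 < \<delta>"
    "\<And>t. \<lbrakk>1 - \<delta> < t; t < 1\<rbrakk> \<Longrightarrow> \<bar>A\<bar> / 2 / (1 - t)\<^sup>2 \<le> sgn A * d t"
    "\<And>t. \<lbrakk>0 < t; t < 1\<rbrakk> \<Longrightarrow> \<bar>d t\<bar> \<le> C * (1 / t\<^sup>2 + 1 / (1 - t)\<^sup>2)"
proof -
  have per: "\<phi> (x + 1) = \<phi> x" for x using ls by (simp add: log_singularity_def)
  have dper: "d (t + 1) = d t" for t
  proof -
    have "deriv \<phi> (x + 1) = deriv \<phi> x" for x by (rule deriv_periodic[of \<phi>, OF per])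
    from deriv_periodic[of "deriv \<phi>", OF this, of "x0 + t"] show ?thesis by (simp add: d_def add.assoc)
  qed
  have C2: "C2_on \<phi> {x. x - x0 \<notin> \<int>}" using ls by (simp add: log_singularity_def)
  obtain A B where AB: "A \<noteq> 0" "B \<noteq> 0"
    "((\<lambda>x. deriv (deriv \<phi>) x * (x - x0)\<^sup>2) \<longlongrightarrow> A) (at_left x0)"
    "((\<lambda>x. deriv (deriv \<phi>) x * (x - x0)\<^sup>2) \<longlongrightarrow> B) (at_right x0)"
    using ls by (auto simp: log_singularity_def)
  obtain d1 where d1: "0 < d1" "\<And>t. \<lbrakk>0 < t; t < d1\<rbrakk> \<Longrightarrow> \<bar>d t * t\<^sup>2 - B\<bar> < 1"
  proof -
    have "\<forall>\<^sub>F x in at_right x0. \<bar>deriv (deriv \<phi>) x * (x - x0)\<^sup>2 - B\<bar> < 1"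
      using tendstoD[OF AB(4), of 1] by (simp add: dist_real_def)
    then obtain b where b: "b > x0" "\<And>y. \<lbrakk>x0 < y; y < b\<rbrakk> \<Longrightarrow> \<bar>deriv (deriv \<phi>) y * (y - x0)\<^sup>2 - B\<bar> < 1"
      by (auto simp: eventually_at_right_field)
    show ?thesis using b(1) b(2)[of "x0 + _"] by (intro that[of "b - x0"]) (auto simp: d_def)
  qed
  obtain d2 where d2: "0 < d2" "\<And>t. \<lbrakk>1 - d2 < t; t < 1\<rbrakk> \<Longrightarrow> \<bar>d t * (1 - t)\<^sup>2 - A\<bar> < \<bar>A\<bar> / 2"
  proof -
    have "\<forall>\<^sub>F x in at_left x0. \<bar>deriv (deriv \<phi>) x * (x - x0)\<^sup>2 - A\<bar> < \<bar>A\<bar> / 2"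
      using tendstoD[OF AB(3), of "\<bar>A\<bar> / 2"] AB(1) by (simp add: dist_real_def)
    then obtain b where b: "b < x0" "\<And>y. \<lbrakk>b < y; y < x0\<rbrakk> \<Longrightarrow> \<bar>deriv (deriv \<phi>) y * (y - x0)\<^sup>2 - A\<bar> < \<bar>A\<bar> / 2"
      by (auto simp: eventually_at_left_field)
    have "\<bar>d t * (1 - t)\<^sup>2 - A\<bar> < \<bar>A\<bar> / 2" if t: "1 - (x0 - b) < t" "t < 1" for t
    proof -
      have "\<bar>d (t - 1) * (t - 1)\<^sup>2 - A\<bar> < \<bar>A\<bar> / 2"
        using b(2)[of "x0 + (t - 1)"] t by (simp add: d_def)
      then show ?thesis using dper[of "t - 1"] by (simp add: power2_commute)
    qed
    then show ?thesis using b(1) by (intro that[of "x0 - b"]) auto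
  qed
  define r where "r = min (1/2) (min d1 d2) / 2"
  have r: "0 < r" "r < d1" "r < d2" "r \<le> 1/2" using d1(1) d2(1) by (auto simp: r_def)
  have "continuous_on {r..1 - r} d"
  proof -
    have "continuous_on {x. x - x0 \<notin> \<int>} (deriv (deriv \<phi>))" using C2 by (simp add: C2_on_def)
    moreover have "(\<lambda>t. x0 + t) ` {r..1 - r} \<subseteq> {x. x - x0 \<notin> \<int>}"
    proof (rule image_subsetI)
      fix t assume "t \<in> {r..1 - r}"
      then have "0 < t" "t < 1" using r by auto
      then have "t \<notin> \<int>" by (auto elim!: Ints_cases)
      then show "x0 + t \<in> {x. x - x0 \<notin> \<int>}" by simp
    qed
    ultimately show ?thesis
      unfolding d_def
      using continuous_on_compose2[of _ "deriv (deriv \<phi>)" "{r..1 - r}" "\<lambda>t. x0 + t"] continuous_on_add[OF continuous_on_const continuous_on_id]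
      by blast
  qed
  then have "bounded (d ` {r..1 - r})" by (intro compact_imp_bounded compact_continuous_image) auto
  then obtain M where M: "\<forall>t\<in>{r..1 - r}. \<bar>d t\<bar> \<le> M" by (auto simp: bounded_iff)
  define C where "C = max M 0 + 2 * \<bar>A\<bar> + \<bar>B\<bar> + 1"
  have bound: "\<bar>d t\<bar> \<le> C * (1 / t\<^sup>2 + 1 / (1 - t)\<^sup>2)" if t: "0 < t" "t < 1" for t
  proof -
    have C0: "0 \<le> C" by (simp add: C_def)
    consider "t < r" | "1 - r < t" | "t \<in> {r..1 - r}" by force
    then show ?thesis
    proof cases
      case 1
      have "\<bar>d t * t\<^sup>2\<bar> \<le> C" using d1(2)[of t] 1 r t by (simp add: C_def)
      then have "\<bar>d t\<bar> \<le> C * (1 / t\<^sup>2)" using t by (simp add: abs_mult field_simps)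
      also have "\<dots> \<le> C * (1 / t\<^sup>2 + 1 / (1 - t)\<^sup>2)" using C0 by (intro mult_left_mono) auto
      finally show ?thesis .
    next
      case 2
      have "1 - d2 < t" using 2 r by linarith
      from d2(2)[OF this t(2)] have "\<bar>d t * (1 - t)\<^sup>2\<bar> \<le> 2 * \<bar>A\<bar>" by linarith
      also have "\<dots> \<le> C" by (simp add: C_def add_increasing add_increasing2)
      finally have "\<bar>d t * (1 - t)\<^sup>2\<bar> \<le> C" .
      then have "\<bar>d t\<bar> \<le> C * (1 / (1 - t)\<^sup>2)" using t by (simp add: abs_mult pos_le_divide_eq)
      also have "\<dots> \<le> C * (1 / t\<^sup>2 + 1 / (1 - t)\<^sup>2)" using C0 by (intro mult_left_mono) auto
      finally show ?thesis .
    next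
      case 3
      have "\<bar>d t\<bar> \<le> C * 1" using bspec[OF M 3] by (simp add: C_def)
      also have "\<dots> \<le> C * (1 / t\<^sup>2 + 1 / (1 - t)\<^sup>2)"
      proof (intro mult_left_mono)
        have "1 \<le> 1 / t\<^sup>2" using t by (simp add: power_le_one)
        then show "1 \<le> 1 / t\<^sup>2 + 1 / (1 - t)\<^sup>2" by (simp add: add_increasing2)
      qed (rule C0)
      finally show ?thesis .
    qed
  qed
  have low: "\<bar>A\<bar> / 2 / (1 - t)\<^sup>2 \<le> sgn A * d t" if t: "1 - d2 < t" "t < 1" for t
  proof -
    have "\<bar>A\<bar> / 2 \<le> sgn A * (d t * (1 - t)\<^sup>2)"
      using d2(2)[OF t] by (cases "A > 0") (auto simp: abs_if sgn_if split: if_splits)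
    then show ?thesis using t by (simp add: pos_divide_le_eq mult.assoc)
  qed
  show ?thesis by (rule that[OF AB(1) d2(1) low bound])
qed

text \<open>The integral in the hypothesis would be 0 by default for a non-integrable function, so
  it carries information only once integrability is known. This comes from \<open>bound0\<close>,
  whose majorant \<open>edge (-1/2)\<close> is integrable, and from continuity off the countable set
  x0 + \<int>.\<close>

lemma log_singularity_has_integral:
  assumes ls: "log_singularity \<phi> x0" and zero: "(\<integral>x. \<phi> x \<partial>circle) = 0"
  shows "((\<lambda>t. \<phi> (x0 + t)) has_integral 0) {0..1}"
proof -
  have per: "\<phi> (x + 1) = \<phi> x" for x using ls by (simp add: log_singularity_def)
  have C2: "C2_on \<phi> {x. x - x0 \<notin> \<int>}" using ls by (simp add: log_singularity_def)
  define f where "f = (\<lambda>t. \<phi> (x0 + t))"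
  have d1: "(f has_real_derivative deriv \<phi> (x0 + t)) (at t)"
    and d2: "((\<lambda>t. deriv \<phi> (x0 + t)) has_real_derivative deriv (deriv \<phi>) (x0 + t)) (at t)" if "t \<notin> \<int>" for t
  proof -
    have "(\<phi> has_real_derivative deriv \<phi> (x0 + t)) (at (x0 + t))"
      "(deriv \<phi> has_real_derivative deriv (deriv \<phi>) (x0 + t)) (at (x0 + t))"
      using C2 that by (auto simp: C2_on_def DERIV_deriv_iff_real_differentiable)
    then show "(f has_real_derivative deriv \<phi> (x0 + t)) (at t)"
      "((\<lambda>t. deriv \<phi> (x0 + t)) has_real_derivative deriv (deriv \<phi>) (x0 + t)) (at t)"
      using DERIV_shift[of \<phi> _ t x0] DERIV_shift[of "deriv \<phi>" _ t x0] by (simp_all add: f_def add.commute)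
  qed
  have nI: "t \<notin> \<int>" if "0 < t" "t < 1" for t :: real using that by (auto elim!: Ints_cases)
  obtain C where C: "\<And>t. \<lbrakk>0 < t; t < 1\<rbrakk> \<Longrightarrow> \<bar>deriv (deriv \<phi>) (x0 + t)\<bar> \<le> C * (1 / t\<^sup>2 + 1 / (1 - t)\<^sup>2)"
    using log_singularity_cell_bounds[OF ls] by metis
  interpret inverse_square_second_derivative f "\<lambda>t. deriv \<phi> (x0 + t)" "\<lambda>t. deriv (deriv \<phi>) (x0 + t)" C
    by unfold_locales (use d1 d2 C nI in auto)
  define D where "D = \<bar>f (1/2)\<bar> + \<bar>deriv \<phi> (x0 + 1/2)\<bar>"
  have fb: "norm (f t) \<le> D + 2 * C * edge (-1/2) t" if t: "t \<in> {0<..<1}" for t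
  proof -
    have "\<bar>deriv \<phi> (x0 + 1/2) * (t - 1/2)\<bar> \<le> \<bar>deriv \<phi> (x0 + 1/2)\<bar> * 1"
      unfolding abs_mult using t by (intro mult_left_mono) auto
    then show ?thesis using bound0[of t] t by (simp add: D_def)
  qed
  have gi: "(\<lambda>t. D + 2 * C * edge (-1/2) t) integrable_on {0<..<1}"
  proof -
    have "(\<lambda>t. D + 2 * C * edge (-1/2) t) integrable_on {0..1}"
      using has_integral_integrable[OF has_integral_mult_right[OF has_integral_edge[of "-1/2"], of "2 * C"]]
      by (intro integrable_add) auto
    then show ?thesis by (simp add: integrable_on_Icc_iff_Ioo)
  qed
  have cont: "continuous_on {0<..<1} f"
  proof (rule continuous_at_imp_continuous_on, intro ballI)
    fix t :: real assume "t \<in> {0<..<1}"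
    then have "t \<notin> \<int>" by (intro nI) auto
    then show "isCont f t" by (intro DERIV_isCont[OF d1])
  qed
  have "f absolutely_integrable_on {0<..<1}"
    by (rule measurable_bounded_by_integrable_imp_absolutely_integrable[OF _ _ gi fb])
      (auto intro: continuous_imp_measurable_on_sets_lebesgue[OF cont])
  then have "f integrable_on {0<..<1}" "(\<lambda>t. norm (f t)) integrable_on {0<..<1}"
    by (auto simp: absolutely_integrable_on_def)
  then have fi: "f integrable_on {0..1}" "(\<lambda>t. norm (f t)) integrable_on {0..1}"
    by (simp_all add: integrable_on_Icc_iff_Ioo)
  define I J where "I = integral {0..1} f" and "J = integral {0..1} (\<lambda>t. norm (f t))"
  have I: "(f has_integral I) {0..1}" and J: "((\<lambda>t. norm (f t)) has_integral J) {0..1}"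
    using fi by (auto simp: I_def J_def)
  have shift: "(g has_integral K) {0..1}" if "((\<lambda>t. g (x0 + t)) has_integral K) {0..1}" "\<And>x. g (x + 1) = g x" for g :: "real \<Rightarrow> real" and K
  proof -
    have "((\<lambda>x. g (x0 + (x + (- x0)))) has_integral K) {0 - (- x0)..1 - (- x0)}"
      using has_integral_translate[OF that(1), of "- x0"] .
    then have "(g has_integral K) {x0..x0 + 1}" by (simp add: add.commute)
    then have "(g has_integral K) {0..0 + 1}" by (rule has_integral_periodic[of g, OF that(2)])
    then show ?thesis by simp
  qed
  have \<phi>I: "(\<phi> has_integral I) {0..1}" by (rule shift) (use I per in \<open>auto simp: f_def\<close>)
  have \<phi>J: "((\<lambda>x. norm (\<phi> x)) has_integral J) {0..1}"
    by (rule shift) (use J per in \<open>auto simp: f_def\<close>)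
  have abs: "\<phi> absolutely_integrable_on {0..1}"
    using has_integral_integrable[OF \<phi>I] has_integral_integrable[OF \<phi>J] by (simp add: absolutely_integrable_on_def)
  have meas: "\<phi> \<in> borel_measurable borel"
  proof (rule borel_measurable_continuous_countable_exceptions)
    have "range (\<lambda>n::int. x0 + of_int n) = {x. x - x0 \<in> \<int>}" by (auto simp: Ints_def algebra_simps image_iff)
    then show "countable {x. x - x0 \<in> \<int>}" by (metis countable_image countableI_type)
    show "continuous_on (- {x. x - x0 \<in> \<int>}) \<phi>"
    proof (rule continuous_at_imp_continuous_on, intro ballI)
      fix x assume "x \<in> - {x. x - x0 \<in> \<int>}"
      then have "\<phi> differentiable (at x)" using C2 by (simp add: C2_on_def)
      then show "isCont \<phi> x" by (rule differentiable_imp_continuous_within)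
    qed
  qed
  have "set_integrable lborel {0..1} \<phi>"
    using abs meas unfolding set_integrable_def by (simp add: integrable_completion)
  then have "set_integrable lborel {0..<1} \<phi>" by (rule set_integrable_subset) auto
  then have "integral {0..<1} \<phi> = (LINT x:{0..<1}|lborel. \<phi> x)"
    using set_borel_integral_eq_integral(2) by metis
  also have "\<dots> = (\<integral>x. \<phi> x \<partial>circle)"
    unfolding circle_def set_lebesgue_integral_def by (subst integral_restrict_space) auto
  finally have "integral {0..<1} \<phi> = 0" using zero by simp
  moreover have "integral {0..1} \<phi> = integral {0..<1} \<phi>"
    by (rule integral_spike_set) (auto intro!: negligible_subset[OF negligible_sing[of 1]])
  ultimately have "I = 0" using integral_unique[OF \<phi>I] by simp
  then show ?thesis using I by (simp add: f_def)
qed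

lemma log_singularity_locale:
  assumes ls: "log_singularity \<phi> x0" and zero: "(\<integral>x. \<phi> x \<partial>circle) = 0"
  obtains \<sigma> A C \<delta> where "\<sigma> = 1 \<or> \<sigma> = -1"
    "logarithmic_singularity (\<lambda>t. \<sigma> * \<phi> (x0 + t)) (\<lambda>t. \<sigma> * deriv \<phi> (x0 + t)) (\<lambda>t. \<sigma> * deriv (deriv \<phi>) (x0 + t)) A C \<delta>"
proof -
  obtain A C \<delta> where A: "A \<noteq> 0" "0 < \<delta>"
    "\<And>t. \<lbrakk>1 - \<delta> < t; t < 1\<rbrakk> \<Longrightarrow> \<bar>A\<bar> / 2 / (1 - t)\<^sup>2 \<le> sgn A * deriv (deriv \<phi>) (x0 + t)"
    "\<And>t. \<lbrakk>0 < t; t < 1\<rbrakk> \<Longrightarrow> \<bar>deriv (deriv \<phi>) (x0 + t)\<bar> \<le> C * (1 / t\<^sup>2 + 1 / (1 - t)\<^sup>2)"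
    using log_singularity_cell_bounds[OF ls] by metis
  have s: "sgn A = 1 \<or> sgn A = -1" "\<bar>sgn A\<bar> = 1" using A(1) by (auto simp: sgn_if)
  have per: "\<phi> (x + 1) = \<phi> x" for x using ls by (simp add: log_singularity_def)
  have C2: "C2_on \<phi> {x. x - x0 \<notin> \<int>}" using ls by (simp add: log_singularity_def)
  have "logarithmic_singularity (\<lambda>t. sgn A * \<phi> (x0 + t)) (\<lambda>t. sgn A * deriv \<phi> (x0 + t)) (\<lambda>t. sgn A * deriv (deriv \<phi>) (x0 + t)) (\<bar>A\<bar> / 2) C \<delta>"
  proof
    show "sgn A * \<phi> (x0 + (t + 1)) = sgn A * \<phi> (x0 + t)" for t
      using per[of "x0 + t"] by (simp add: add.assoc)
    show "((\<lambda>t. sgn A * \<phi> (x0 + t)) has_real_derivative sgn A * deriv \<phi> (x0 + t)) (at t)" if "t \<notin> \<int>" for t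
    proof -
      have "(\<phi> has_real_derivative deriv \<phi> (x0 + t)) (at (x0 + t))"
        using C2 that by (auto simp: C2_on_def DERIV_deriv_iff_real_differentiable)
      then show ?thesis using DERIV_shift[of \<phi> _ t x0] by (intro DERIV_cmult) (simp add: add.commute)
    qed
    show "((\<lambda>t. sgn A * deriv \<phi> (x0 + t)) has_real_derivative sgn A * deriv (deriv \<phi>) (x0 + t)) (at t)" if "t \<notin> \<int>" for t
    proof -
      have "(deriv \<phi> has_real_derivative deriv (deriv \<phi>) (x0 + t)) (at (x0 + t))"
        using C2 that by (auto simp: C2_on_def DERIV_deriv_iff_real_differentiable)
      then show ?thesis using DERIV_shift[of "deriv \<phi>" _ t x0] by (intro DERIV_cmult) (simp add: add.commute)
    qed
    show "\<bar>sgn A * deriv (deriv \<phi>) (x0 + t)\<bar> \<le> C * (1 / t\<^sup>2 + 1 / (1 - t)\<^sup>2)" if "0 < t" "t < 1" for t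
      using A(4)[OF that] s by (simp add: abs_mult)
    show "((\<lambda>t. sgn A * \<phi> (x0 + t)) has_integral 0) {0..1}"
      using has_integral_mult_right[OF log_singularity_has_integral[OF ls zero], of "sgn A"] by simp
  qed (use A in auto)
  then show ?thesis using s(1) by (intro that)
qed

section \<open>Ergodicity\<close>

definition birkhoff_sum :: "real \<Rightarrow> (real \<Rightarrow> real) \<Rightarrow> nat \<Rightarrow> real \<Rightarrow> real" where
  "birkhoff_sum \<alpha> \<phi> N x = (\<Sum>j<N. \<phi> (x + real j * \<alpha>))"

text \<open>Essential values in the sense of Schmidt, lifted to the line with \<open>p\<close> as
  integer correction. One returning point is enough, because the condition is used against sets on
  which any return is contradictory.\<close>

definition recurrent_along :: "real \<Rightarrow> (real \<Rightarrow> real) \<Rightarrow> real \<Rightarrow> bool" where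
  "recurrent_along \<alpha> \<phi> a \<longleftrightarrow> (\<forall>\<epsilon>>0. \<forall>A\<in>sets lborel. emeasure lborel A \<noteq> 0 \<longrightarrow>
     (\<exists>N. \<exists>p::int. \<exists>x\<in>A. x + (real N * \<alpha> - of_int p) \<in> A \<and> \<bar>birkhoff_sum \<alpha> \<phi> N x - a\<bar> < \<epsilon>))"

lemma frac_add_frac: "frac (frac x + a) = frac (x + a)" for x a :: real
proof -
  have "frac (y - of_int n) = frac y" for y :: real and n by (simp add: frac_def)
  moreover have "frac x + a = (x + a) - of_int \<lfloor>x\<rfloor>" by (simp add: frac_def)
  ultimately show ?thesis by (simp only:)
qed

text \<open>
  Recurrence along \<open>a\<close> forces the mass of the section \<open>E\<^sub>x\<close> in an interval to be invariant under
  translation by \<open>a\<close>. Hence almost every section is null or conull, and which of the two happens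
  is invariant under the rotation.
\<close>

lemma ergodic_cylinder_map:
  fixes \<alpha> \<sigma> :: real and \<phi> :: "real \<Rightarrow> real"
  assumes \<alpha>: "\<alpha> \<notin> \<rat>" and per: "\<And>x. \<phi> (x + 1) = \<phi> x" and \<sigma>: "\<sigma> = 1 \<or> \<sigma> = -1"
    and rec: "\<And>a. 0 < a \<Longrightarrow> recurrent_along \<alpha> \<phi> (\<sigma> * a)"
  shows "ergodic (circle \<Otimes>\<^sub>M lborel) (cylinder_map \<alpha> \<phi>)"
  unfolding ergodic_def
proof (intro ballI impI)
  fix E assume E: "E \<in> sets (circle \<Otimes>\<^sub>M lborel)"
    and inv: "cylinder_map \<alpha> \<phi> -` E \<inter> space (circle \<Otimes>\<^sub>M lborel) = E"
  have space: "space (circle \<Otimes>\<^sub>M lborel) = {0..<1} \<times> UNIV"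
    by (simp add: space_pair_measure circle_def space_restrict_space)
  \<comment> \<open>The lift of \<open>E\<close> to the plane, periodic in the first variable; its
    sections are the sets \<open>Sec x\<close>.\<close>
  define P where "P = (\<lambda>z::real \<times> real. (frac (fst z), snd z)) -` E"
  define Sec where "Sec = (\<lambda>x. {y. (frac x, y) \<in> E})"
  have P_sec: "Pair x -` P = Sec x" for x by (auto simp: P_def Sec_def)
  have frac_meas: "frac \<in> borel \<rightarrow>\<^sub>M (circle :: real measure)"
  proof -
    have "(\<lambda>x::real. frac x) \<in> borel_measurable borel" unfolding frac_def by measurable
    then show ?thesis unfolding circle_def
      by (intro measurable_restrict_space2) (auto simp: frac_lt_1)
  qed
  have P: "P \<in> sets (lborel \<Otimes>\<^sub>M lborel)"
  proof -
    have "(\<lambda>z::real \<times> real. (frac (fst z), snd z)) \<in> lborel \<Otimes>\<^sub>M lborel \<rightarrow>\<^sub>M circle \<Otimes>\<^sub>M lborel"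
      using frac_meas by measurable
    from measurable_sets[OF this E] show ?thesis by (simp add: P_def space_pair_measure)
  qed
  have Sec_meas [measurable]: "Sec x \<in> sets borel" for x
    using sets_Pair1[OF P, of x] by (simp add: P_sec)
  have Sec_step: "y \<in> Sec x \<longleftrightarrow> y + \<phi> x \<in> Sec (x + \<alpha>)" for x y
  proof -
    have \<phi>: "\<phi> (frac x) = \<phi> x"
      using periodic_function_of_int[of \<phi>, OF per, of "frac x" "\<lfloor>x\<rfloor>"] by (simp add: frac_def)
    have "(frac x, y) \<in> {0..<1} \<times> UNIV" by (simp add: frac_lt_1)
    then have "(frac x, y) \<in> E \<longleftrightarrow> cylinder_map \<alpha> \<phi> (frac x, y) \<in> E"
      using inv unfolding space by blast
    then show ?thesis by (simp add: Sec_def cylinder_map_def frac_add_frac \<phi> add.commute)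
  qed
  have Sec_int: "Sec (x + of_int p) = Sec x" for x p
    by (simp add: Sec_def frac_def)
  have Sec_iter: "y \<in> Sec x \<longleftrightarrow> y + birkhoff_sum \<alpha> \<phi> N x \<in> Sec (x + real N * \<alpha>)" for x y N
  proof (induction N)
    case (Suc N)
    have "x + real (Suc N) * \<alpha> = (x + real N * \<alpha>) + \<alpha>" by (simp add: algebra_simps)
    moreover have "y + birkhoff_sum \<alpha> \<phi> (Suc N) x = (y + birkhoff_sum \<alpha> \<phi> N x) + \<phi> (x + real N * \<alpha>)"
      by (simp add: birkhoff_sum_def)
    ultimately show ?case using Suc Sec_step[of "y + birkhoff_sum \<alpha> \<phi> N x" "x + real N * \<alpha>"] by (simp only:)
  qed (simp add: birkhoff_sum_def)
  define m where "m = (\<lambda>x u v. measure lborel (Sec x \<inter> {u..v}))"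
  have m_meas [measurable]: "(\<lambda>x. m x u v) \<in> borel_measurable borel" for u v
  proof -
    have "P \<inter> (UNIV \<times> {u..v}) \<in> sets (lborel \<Otimes>\<^sub>M lborel)" using P by (intro sets.Int pair_measureI) auto
    then have "(\<lambda>x. emeasure lborel (Pair x -` (P \<inter> (UNIV \<times> {u..v})))) \<in> borel_measurable lborel"
      by (rule lborel.measurable_emeasure_Pair)
    moreover have "Pair x -` (P \<inter> (UNIV \<times> {u..v})) = Sec x \<inter> {u..v}" for x using P_sec[of x] by auto
    ultimately show ?thesis by (simp add: m_def measure_def)
  qed
  have m_iter: "m x u v = m (x + (real N * \<alpha> - of_int p)) (u + birkhoff_sum \<alpha> \<phi> N x) (v + birkhoff_sum \<alpha> \<phi> N x)" for x u v N p
  proof -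
    let ?S = "birkhoff_sum \<alpha> \<phi> N x"
    have "Sec (x + (real N * \<alpha> - of_int p)) = Sec (x + real N * \<alpha>)"
      using Sec_int[of "x + real N * \<alpha>" "- p"] by (simp add: algebra_simps)
    then have "Sec x \<inter> {u..v} = (\<lambda>y. y + ?S) -` (Sec (x + (real N * \<alpha> - of_int p)) \<inter> {u + ?S..v + ?S})"
      using Sec_iter[of _ x N] by auto
    then have "m x u v = measure lborel ((\<lambda>y. y + ?S) -` (Sec (x + (real N * \<alpha> - of_int p)) \<inter> {u + ?S..v + ?S}))"
      unfolding m_def by (rule arg_cong)
    also have "\<dots> = m (x + (real N * \<alpha> - of_int p)) (u + ?S) (v + ?S)"
      unfolding m_def by (rule measure_lborel_translate) simp
    finally show ?thesis .
  qed
  have m_shift: "m x u v \<le> m x u' v' + \<bar>u - u'\<bar> + \<bar>v - v'\<bar>" for x u v u' v'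
    unfolding m_def by (rule measure_Int_interval_le_shift[OF Sec_meas])
  have translation: "AE x in lborel. m x u v = m x (u + \<sigma> * a) (v + \<sigma> * a)" if a: "0 < a" for u v a
  proof -
    \<comment> \<open>Where the two masses differ, rational levels \<open>s < t\<close> separate
      them. If a separating set had positive measure, some point would return to it with Birkhoff
      sum within \<open>(t - s) / 2\<close> of \<open>\<sigma> * a\<close>. Moving the interval by
      the Birkhoff sum itself preserves the mass, and the discrepancy changes it by less than
      \<open>t - s\<close>: a contradiction.\<close>
    define B1 where "B1 = (\<lambda>(s, t). {x. m x u v < s \<and> t < m x (u + \<sigma> * a) (v + \<sigma> * a)})"
    define B2 where "B2 = (\<lambda>(s, t). {x. m x (u + \<sigma> * a) (v + \<sigma> * a) < s \<and> t < m x u v})"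
    have meas: "B1 z \<in> sets lborel" "B2 z \<in> sets lborel" for z
      unfolding B1_def B2_def by (cases z; simp; measurable)+
    have close: "\<bar>m x u v - m (x + (real N * \<alpha> - of_int p)) (u + \<sigma> * a) (v + \<sigma> * a)\<bar> \<le> 2 * \<bar>birkhoff_sum \<alpha> \<phi> N x - \<sigma> * a\<bar>" for x N p
      unfolding m_iter[of x u v N p]
      using m_shift[of "x + (real N * \<alpha> - of_int p)" "u + birkhoff_sum \<alpha> \<phi> N x" "v + birkhoff_sum \<alpha> \<phi> N x" "u + \<sigma> * a" "v + \<sigma> * a"]
        m_shift[of "x + (real N * \<alpha> - of_int p)" "u + \<sigma> * a" "v + \<sigma> * a" "u + birkhoff_sum \<alpha> \<phi> N x" "v + birkhoff_sum \<alpha> \<phi> N x"]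
        abs_minus_commute[of "\<sigma> * a" "birkhoff_sum \<alpha> \<phi> N x"]
      by (simp add: abs_le_iff)
    have null: "B1 (s, t) \<in> null_sets lborel" "B2 (s, t) \<in> null_sets lborel" if st: "s < t" for s t
    proof -
      have \<epsilon>: "0 < (t - s) / 2" using st by simp
      have rc: "\<exists>N. \<exists>p::int. \<exists>x\<in>X. x + (real N * \<alpha> - of_int p) \<in> X \<and> \<bar>birkhoff_sum \<alpha> \<phi> N x - \<sigma> * a\<bar> < (t - s) / 2"
        if "X \<in> sets lborel" "emeasure lborel X \<noteq> 0" for X
        using rec[OF a] \<epsilon> that unfolding recurrent_along_def by blast
      have "emeasure lborel (B1 (s, t)) = 0"
      proof (rule ccontr)
        assume "emeasure lborel (B1 (s, t)) \<noteq> 0"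
        then obtain N p x where x: "x \<in> B1 (s, t)" "x + (real N * \<alpha> - of_int p) \<in> B1 (s, t)"
          "\<bar>birkhoff_sum \<alpha> \<phi> N x - \<sigma> * a\<bar> < (t - s) / 2" using rc[OF meas(1)] by blast
        then have "m x u v < s" "t < m (x + (real N * \<alpha> - of_int p)) (u + \<sigma> * a) (v + \<sigma> * a)" by (auto simp: B1_def)
        then show False using close[of x N p] x(3) by (simp add: abs_le_iff)
      qed
      moreover have "emeasure lborel (B2 (s, t)) = 0"
      proof (rule ccontr)
        assume "emeasure lborel (B2 (s, t)) \<noteq> 0"
        then obtain N p x where x: "x \<in> B2 (s, t)" "x + (real N * \<alpha> - of_int p) \<in> B2 (s, t)"
          "\<bar>birkhoff_sum \<alpha> \<phi> N x - \<sigma> * a\<bar> < (t - s) / 2" using rc[OF meas(2)] by blast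
        then have "m (x + (real N * \<alpha> - of_int p)) (u + \<sigma> * a) (v + \<sigma> * a) < s" "t < m x u v" by (auto simp: B2_def)
        then show False using close[of x N p] x(3) by (simp add: abs_le_iff)
      qed
      ultimately show "B1 (s, t) \<in> null_sets lborel" "B2 (s, t) \<in> null_sets lborel"
        using meas by (auto simp: null_sets_def)
    qed
    define R where "R = {(s::real, t::real). s \<in> \<rat> \<and> t \<in> \<rat> \<and> s < t}"
    have "R \<subseteq> \<rat> \<times> \<rat>" by (auto simp: R_def)
    then have R: "countable R" by (rule countable_subset) (simp add: countable_rat)
    have "(\<Union>z\<in>R. B1 z \<union> B2 z) \<in> null_sets lborel"
      using null by (intro null_sets_UN' R null_sets.Un) (auto simp: R_def)
    moreover have "{x \<in> space lborel. \<not> m x u v = m x (u + \<sigma> * a) (v + \<sigma> * a)} \<subseteq> (\<Union>z\<in>R. B1 z \<union> B2 z)"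
    proof
      fix x assume "x \<in> {x \<in> space lborel. \<not> m x u v = m x (u + \<sigma> * a) (v + \<sigma> * a)}"
      then consider "m x u v < m x (u + \<sigma> * a) (v + \<sigma> * a)" | "m x (u + \<sigma> * a) (v + \<sigma> * a) < m x u v"
        by (auto simp: neq_iff)
      then show "x \<in> (\<Union>z\<in>R. B1 z \<union> B2 z)"
      proof cases
        case 1
        then obtain s where s: "s \<in> \<rat>" "m x u v < s" "s < m x (u + \<sigma> * a) (v + \<sigma> * a)" using Rats_dense_in_real by blast
        obtain t where t: "t \<in> \<rat>" "s < t" "t < m x (u + \<sigma> * a) (v + \<sigma> * a)" using Rats_dense_in_real[OF s(3)] by blast
        have "(s, t) \<in> R" "x \<in> B1 (s, t)" using s t by (auto simp: R_def B1_def)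
        then show ?thesis by blast
      next
        case 2
        then obtain s where s: "s \<in> \<rat>" "m x (u + \<sigma> * a) (v + \<sigma> * a) < s" "s < m x u v" using Rats_dense_in_real by blast
        obtain t where t: "t \<in> \<rat>" "s < t" "t < m x u v" using Rats_dense_in_real[OF s(3)] by blast
        have "(s, t) \<in> R" "x \<in> B2 (s, t)" using s t by (auto simp: R_def B2_def)
        then show ?thesis by blast
      qed
    qed
    ultimately show ?thesis by (rule AE_I')
  qed
  \<comment> \<open>For \<open>\<sigma> = -1\<close>, the downward translation starting from
    \<open>u + a\<close> and \<open>v + a\<close> gives the same equation.\<close>
  have translation': "AE x in lborel. m x u v = m x (u + a) (v + a)" if a: "0 < a" for u v a
    using \<sigma>
  proof
    assume "\<sigma> = 1"
    then show ?thesis using translation[OF a, of u v] by simp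
  next
    assume "\<sigma> = -1"
    then show ?thesis using translation[OF a, of "u + a" "v + a"] by (simp add: eq_commute)
  qed
  have "AE x in lborel. \<forall>u\<in>\<rat>. \<forall>v\<in>\<rat>. \<forall>a\<in>\<rat>. 0 < a \<longrightarrow> m x u v = m x (u + a) (v + a)"
    unfolding AE_ball_countable[OF countable_rat]
  proof (intro ballI)
    fix u v a :: real
    show "AE x in lborel. 0 < a \<longrightarrow> m x u v = m x (u + a) (v + a)"
    proof (cases "0 < a")
      case True
      from translation'[OF True, of u v] show ?thesis by eventually_elim simp
    qed simp
  qed
  then have hom: "AE x in lborel. homogeneous (Sec x)"
    unfolding homogeneous_def m_def by eventually_elim blast
  \<comment> \<open>The dichotomy holds only almost everywhere, but \<open>H\<close> below is
    invariant at every point, since \<open>Sec_step\<close> is exact; ergodicity of the rotation is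
    therefore applied to \<open>H\<close>.\<close>
  define H0 where "H0 = {x. emeasure lborel (Sec x) = 0}"
  define H where "H = {x. emeasure lborel (- Sec x) = 0}"
  have dichotomy: "AE x in lborel. x \<in> H0 \<or> x \<in> H"
    using hom
  proof eventually_elim
    case (elim x)
    then show ?case using homogeneous_null_or_conull[OF Sec_meas elim] by (simp add: H0_def H_def)
  qed
  have H: "H \<in> sets borel"
  proof -
    have "- P \<in> sets (lborel \<Otimes>\<^sub>M lborel)"
      using sets.compl_sets[OF P] by (simp add: Compl_eq_Diff_UNIV space_pair_measure)
    then have "(\<lambda>x. emeasure lborel (Pair x -` (- P))) \<in> borel_measurable lborel"
      by (rule lborel.measurable_emeasure_Pair)
    moreover have "Pair x -` (- P) = - Sec x" for x using P_sec[of x] by auto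
    ultimately have "(\<lambda>x. emeasure lborel (- Sec x)) \<in> borel_measurable borel" by simp
    then have "(\<lambda>x. emeasure lborel (- Sec x)) -` {0} \<inter> space borel \<in> sets borel"
      by (rule measurable_sets) simp
    then show ?thesis by (simp add: H_def vimage_def)
  qed
  have "emeasure lborel H = 0 \<or> emeasure lborel (- H) = 0"
  proof (rule rotation_invariant_null_or_conull[OF H \<alpha>])
    show "x + \<alpha> \<in> H \<longleftrightarrow> x \<in> H" for x
    proof -
      have "- Sec x = (\<lambda>y. y + \<phi> x) -` (- Sec (x + \<alpha>))" using Sec_step[of _ x] by auto
      then show ?thesis using emeasure_lborel_translate[of "- Sec (x + \<alpha>)" "\<phi> x"] by (simp add: H_def)
    qed
    show "x + 1 \<in> H \<longleftrightarrow> x \<in> H" for x using Sec_int[of x 1] by (simp add: H_def)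
  qed
  then have cases: "(AE x in lborel. emeasure lborel (Sec x) = 0) \<or> (AE x in lborel. emeasure lborel (- Sec x) = 0)"
  proof
    assume "emeasure lborel H = 0"
    then have "AE x in lborel. x \<notin> H" using H by (intro AE_not_in) (auto simp: null_sets_def)
    then have "AE x in lborel. emeasure lborel (Sec x) = 0"
      using dichotomy by eventually_elim (auto simp: H0_def)
    then show ?thesis ..
  next
    assume "emeasure lborel (- H) = 0"
    then have "AE x in lborel. x \<notin> - H" using H by (intro AE_not_in) (auto simp: null_sets_def)
    then have "AE x in lborel. emeasure lborel (- Sec x) = 0"
      by eventually_elim (auto simp: H_def)
    then show ?thesis ..
  qed
  have zero: "emeasure (circle \<Otimes>\<^sub>M lborel) X = 0"
    if X: "X \<in> sets (circle \<Otimes>\<^sub>M lborel)" and ae: "AE x in lborel. x \<in> {0..<1} \<longrightarrow> emeasure lborel (Pair x -` X) = 0" for X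
  proof -
    have "AE x in circle. emeasure lborel (Pair x -` X) = 0"
      unfolding circle_def using ae by (subst AE_restrict_space_iff) auto
    then show ?thesis
      using lborel.emeasure_pair_measure_alt[OF X] by (simp add: nn_integral_0_iff_AE lborel.measurable_emeasure_Pair[OF X])
  qed
  show "emeasure (circle \<Otimes>\<^sub>M lborel) E = 0 \<or> emeasure (circle \<Otimes>\<^sub>M lborel) (space (circle \<Otimes>\<^sub>M lborel) - E) = 0"
    using cases
  proof
    assume ae: "AE x in lborel. emeasure lborel (Sec x) = 0"
    have "emeasure (circle \<Otimes>\<^sub>M lborel) E = 0"
    proof (rule zero[OF E])
      show "AE x in lborel. x \<in> {0..<1} \<longrightarrow> emeasure lborel (Pair x -` E) = 0"
        using ae
      proof eventually_elim
        case (elim x)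
        show ?case
        proof
          assume "x \<in> {0..<1}"
          then have "frac x = x" by (simp add: frac_eq)
          then have "Pair x -` E = Sec x" by (auto simp: Sec_def)
          then show "emeasure lborel (Pair x -` E) = 0" using elim by simp
        qed
      qed
    qed
    then show ?thesis ..
  next
    assume ae: "AE x in lborel. emeasure lborel (- Sec x) = 0"
    have "emeasure (circle \<Otimes>\<^sub>M lborel) (space (circle \<Otimes>\<^sub>M lborel) - E) = 0"
    proof (rule zero[OF sets.compl_sets[OF E]])
      show "AE x in lborel. x \<in> {0..<1} \<longrightarrow> emeasure lborel (Pair x -` (space (circle \<Otimes>\<^sub>M lborel) - E)) = 0"
        using ae
      proof eventually_elim
        case (elim x)
        show ?case
        proof
          assume x: "x \<in> {0..<1}"
          then have "frac x = x" by (simp add: frac_eq)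
          then have "Pair x -` (space (circle \<Otimes>\<^sub>M lborel) - E) = - Sec x" using x unfolding space by (auto simp: Sec_def)
          then show "emeasure lborel (Pair x -` (space (circle \<Otimes>\<^sub>M lborel) - E)) = 0" using elim by simp
        qed
      qed
    qed
    then show ?thesis ..
  qed
qed

text \<open>The rotation number supplies times of order \<open>scale k\<close> along indices with
  divergent \<Sum> 1 / ln (scale k), the singular function supplies combs of that density, and
  \<open>comb_recurrence\<close> joins the two.\<close>

lemma recurrent_of_well_approximable:
  fixes \<alpha> :: real
  assumes good: "\<And>n. \<not> summable (\<lambda>k. if \<alpha> \<in> well_approx (1 / real (n + 2)) (scale k) then 1 / ln (real (scale k)) else 0)"
    and f: "logarithmic_singularity (\<lambda>t. \<sigma> * \<phi> (x0 + t)) f' f'' B C \<delta>" and \<sigma>: "\<sigma> = 1 \<or> \<sigma> = -1" and a: "0 < a"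
  shows "recurrent_along \<alpha> \<phi> (\<sigma> * a)"
  unfolding recurrent_along_def
proof (intro allI ballI impI)
  fix \<epsilon> :: real and A :: "real set"
  assume \<epsilon>: "0 < \<epsilon>" and A: "A \<in> sets lborel" "emeasure lborel A \<noteq> 0"
  let ?f = "\<lambda>t. \<sigma> * \<phi> (x0 + t)"
  obtain c \<eta> N0 where c: "0 < c" and \<eta>: "0 < \<eta>" and hits:
    "\<And>Q N p \<alpha> \<rho>. \<lbrakk>N0 \<le> N; well_placed Q N p; \<bar>\<alpha> - of_int p / real N\<bar> < \<eta> / (real N * real Q); \<rho> \<le> c / ln (real N)\<rbrakk> \<Longrightarrow>
      \<exists>b. \<forall>x\<in>comb (real N) b \<rho>. \<bar>(\<Sum>j<N. ?f (x + real j * \<alpha>)) - a\<bar> < \<epsilon>"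
    using logarithmic_singularity.birkhoff_sum_hits[OF f a \<epsilon>] by metis
  obtain n where n: "1 / real (n + 2) < \<eta>"
  proof -
    obtain n where "inverse (real (Suc n)) < \<eta>" using reals_Archimedean[OF \<eta>] by blast
    moreover have "1 / real (n + 2) \<le> inverse (real (Suc n))" by (simp add: inverse_eq_divide frac_le)
    ultimately show ?thesis using that[of n] by linarith
  qed
  define \<eta>' where "\<eta>' = 1 / real (n + 2)"
  have \<eta>': "0 < \<eta>'" "\<eta>' \<le> \<eta>" "\<eta>' \<le> 1" using n by (auto simp: \<eta>'_def)
  define c' where "c' = min c (1/2)"
  have c': "0 < c'" "c' \<le> c" "c' \<le> 1/2" using c by (auto simp: c'_def)
  let ?L = "\<lambda>k. ln (real (scale k))"
  \<comment> \<open>The last condition yields the separation of the combs: the ratio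
    \<open>(k + 1)\<^sup>2\<close> of consecutive scales has to beat ln (scale k) / c' and the
    factor 16 that may be lost between \<open>scale k\<close> and \<open>N k\<close>.\<close>
  have ev: "\<forall>\<^sub>F k in sequentially. 1 \<le> ?L k \<and> 16 * max N0 2 \<le> scale k \<and> 16 * ?L k \<le> c' * (real k + 1)\<^sup>2"
  proof (intro eventually_conj)
    have "\<forall>\<^sub>F k in sequentially. 3 \<le> scale k" using filterlim_scale by (simp add: filterlim_at_top)
    then show "\<forall>\<^sub>F k in sequentially. 1 \<le> ?L k"
    proof eventually_elim
      case (elim k)
      then have "exp 1 \<le> real (scale k)" using e_less_272 by simp
      then show ?case using scale_pos[of k] by (simp add: ln_ge_iff)
    qed
    show "\<forall>\<^sub>F k in sequentially. 16 * max N0 2 \<le> scale k" using filterlim_scale by (simp add: filterlim_at_top)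
    have "((\<lambda>x::real. ln x / x) \<longlongrightarrow> 0) at_top" by (rule ln_x_over_x_tendsto_0)
    then have "\<forall>\<^sub>F x::real in at_top. ln x / x < c' / 32"
      using c' by (intro order_tendstoD) auto
    moreover have "filterlim (\<lambda>k. real k + 1) at_top sequentially"
      by (rule filterlim_at_top_mono[OF filterlim_real_sequentially]) simp
    ultimately have "\<forall>\<^sub>F k in sequentially. ln (real k + 1) / (real k + 1) < c' / 32"
      by (rule eventually_compose_filterlim)
    then show "\<forall>\<^sub>F k in sequentially. 16 * ?L k \<le> c' * (real k + 1)\<^sup>2"
    proof eventually_elim
      case (elim k)
      then have "ln (real k + 1) \<le> c' / 32 * (real k + 1)" by (simp add: pos_divide_less_eq)
      then have "2 * real k * ln (real k + 1) \<le> 2 * (real k + 1) * (c' / 32 * (real k + 1))"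
        by (intro mult_mono) auto
      then show ?case using ln_scale_le[of k] by (simp add: power2_eq_square algebra_simps)
    qed
  qed
  then obtain K0 where K0: "\<And>k. K0 \<le> k \<Longrightarrow> 1 \<le> ?L k \<and> 16 * max N0 2 \<le> scale k \<and> 16 * ?L k \<le> c' * (real k + 1)\<^sup>2"
    by (auto simp: eventually_sequentially)
  define S where "S = {k. K0 \<le> k \<and> \<alpha> \<in> well_approx \<eta>' (scale k)}"
  have "\<exists>N p. well_placed (scale k) N p \<and> \<bar>\<alpha> - of_int p / real N\<bar> < \<eta>' / (real N * real (scale k))" if "k \<in> S" for k
    using that by (auto simp: S_def well_approx_def)
  then obtain N p where Np: "\<And>k. k \<in> S \<Longrightarrow> well_placed (scale k) (N k) (p k)"
    "\<And>k. k \<in> S \<Longrightarrow> \<bar>\<alpha> - of_int (p k) / real (N k)\<bar> < \<eta>' / (real (N k) * real (scale k))"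
    by metis
  have NQ: "0 < N k" "scale k \<le> 16 * N k" "N k \<le> scale k" if "k \<in> S" for k
    using Np(1)[OF that] by (auto simp: well_placed_def)
  have L: "1 \<le> ?L k" "16 * ?L k \<le> c' * (real k + 1)\<^sup>2" "max N0 2 \<le> N k" if "k \<in> S" for k
    using K0[of k] NQ[OF that] that by (auto simp: S_def)
  \<comment> \<open>Since \<open>N k \<le> scale k\<close>, the logarithm of the scale only narrows
    the teeth, and the divergence of the sum of \<open>\<rho>\<close> becomes the hypothesis
    \<open>good\<close>.\<close>
  define \<rho> where "\<rho> = (\<lambda>k. c' / ?L k)"
  have "\<exists>b. \<forall>x\<in>comb (real (N k)) b (\<rho> k). \<bar>(\<Sum>j<N k. ?f (x + real j * \<alpha>)) - a\<bar> < \<epsilon>" if k: "k \<in> S" for k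
  proof (rule hits[OF _ Np(1)[OF k]])
    show "N0 \<le> N k" using L(3)[OF k] by simp
    have "\<eta>' / (real (N k) * real (scale k)) \<le> \<eta> / (real (N k) * real (scale k))"
      using \<eta>' by (intro divide_right_mono) auto
    then show "\<bar>\<alpha> - of_int (p k) / real (N k)\<bar> < \<eta> / (real (N k) * real (scale k))"
      using Np(2)[OF k] by linarith
    have "0 < ln (real (N k))" using L(3)[OF k] by simp
    moreover have "ln (real (N k)) \<le> ?L k" using NQ[OF k] by simp
    ultimately show "\<rho> k \<le> c / ln (real (N k))"
      unfolding \<rho>_def using c' by (intro frac_le) auto
  qed
  then obtain b where b: "\<And>k x. k \<in> S \<Longrightarrow> x \<in> comb (real (N k)) (b k) (\<rho> k) \<Longrightarrow> \<bar>(\<Sum>j<N k. ?f (x + real j * \<alpha>)) - a\<bar> < \<epsilon>"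
    by metis
  \<comment> \<open>The combs belong to the function centred at its singularity; the extra offset
    \<open>real (N k) * x0\<close> moves them back.\<close>
  have "\<exists>k\<in>S. \<exists>x\<in>A. x \<in> comb (real (N k)) (b k + real (N k) * x0) (\<rho> k) \<and> x + (real (N k) * \<alpha> - of_int (p k)) \<in> A"
  proof (rule comb_recurrence)
    show "0 < real (N k)" if "k \<in> S" for k using NQ[OF that] by simp
    show "0 < \<rho> k" if "k \<in> S" for k using L[OF that] c' by (simp add: \<rho>_def)
    show "\<rho> k \<le> 1/2" if "k \<in> S" for k
    proof -
      have "\<rho> k \<le> (1/2) / 1" unfolding \<rho>_def using L[OF that] c' by (intro frac_le) auto
      then show ?thesis by simp
    qed
    show "\<bar>real (N k) * \<alpha> - of_int (p k)\<bar> \<le> 1 / real (N k)" if k: "k \<in> S" for k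
    proof -
      have "real (N k) * \<alpha> - of_int (p k) = real (N k) * (\<alpha> - of_int (p k) / real (N k))"
        using NQ[OF k] by (simp add: field_simps)
      then have "\<bar>real (N k) * \<alpha> - of_int (p k)\<bar> = real (N k) * \<bar>\<alpha> - of_int (p k) / real (N k)\<bar>"
        by (simp add: abs_mult)
      also have "\<dots> \<le> real (N k) * (\<eta>' / (real (N k) * real (scale k)))"
        using Np(2)[OF k] by (intro mult_left_mono) auto
      also have "\<dots> = \<eta>' / real (scale k)" using NQ[OF k] by simp
      also have "\<dots> \<le> 1 / real (N k)" using NQ[OF k] \<eta>' by (intro frac_le) auto
      finally show ?thesis .
    qed
    show "real (N l) \<le> \<rho> l * real (N k)" if lk: "l \<in> S" "k \<in> S" "l < k" for l k
    proof -
      have "scale (Suc l) \<le> scale k" using lk by (intro scale_mono) simp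
      then have "real ((Suc l)\<^sup>2 * scale l) \<le> real (16 * N k)"
        using NQ(2)[OF lk(2)] unfolding scale_Suc by (simp only: of_nat_le_iff)
      then have 1: "(real l + 1)\<^sup>2 * real (scale l) \<le> 16 * real (N k)" by (simp add: add.commute)
      have "16 * ?L l * real (N l) \<le> (c' * (real l + 1)\<^sup>2) * real (scale l)"
        by (rule mult_mono) (use L[OF lk(1)] NQ[OF lk(1)] c' in auto)
      also have "\<dots> = c' * ((real l + 1)\<^sup>2 * real (scale l))" by simp
      also have "\<dots> \<le> c' * (16 * real (N k))" using 1 c' by (intro mult_left_mono) auto
      finally have "?L l * real (N l) \<le> c' * real (N k)" by simp
      moreover have "0 < ?L l" using L(1)[OF lk(1)] by linarith
      ultimately show ?thesis by (simp add: \<rho>_def pos_le_divide_eq mult.commute)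
    qed
    show "\<forall>\<^sub>F k in sequentially. k \<in> S \<longrightarrow> D \<le> real (N k)" for D
    proof -
      have "\<forall>\<^sub>F k in sequentially. nat \<lceil>16 * D\<rceil> \<le> scale k"
        using filterlim_scale unfolding filterlim_at_top by blast
      then show ?thesis
      proof eventually_elim
        case (elim k)
        show ?case
        proof
          assume k: "k \<in> S"
          have "nat \<lceil>16 * D\<rceil> \<le> 16 * N k" using elim NQ(2)[OF k] by linarith
          then show "D \<le> real (N k)" by linarith
        qed
      qed
    qed
    show "\<not> summable (\<lambda>k. if k \<in> S then \<rho> k else 0)"
    proof
      assume "summable (\<lambda>k. if k \<in> S then \<rho> k else 0)"
      then have sm: "summable (\<lambda>k. (1 / c') * (if k \<in> S then \<rho> k else 0))" by (rule summable_mult)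
      have ev: "\<forall>\<^sub>F k in sequentially. (1 / c') * (if k \<in> S then \<rho> k else 0)
          = (if \<alpha> \<in> well_approx (1 / real (n + 2)) (scale k) then 1 / ?L k else 0)"
        using eventually_ge_at_top[of K0]
        by eventually_elim (use c' in \<open>auto simp: S_def \<rho>_def \<eta>'_def\<close>)
      have "summable (\<lambda>k. if \<alpha> \<in> well_approx (1 / real (n + 2)) (scale k) then 1 / ?L k else 0)"
        by (rule iffD1[OF summable_cong[OF ev] sm])
      with good[of n] show False by (rule notE)
    qed
  qed (use A in auto)
  then obtain k x where k: "k \<in> S" and x: "x \<in> A" "x \<in> comb (real (N k)) (b k + real (N k) * x0) (\<rho> k)"
    "x + (real (N k) * \<alpha> - of_int (p k)) \<in> A" by blast
  have "x - x0 \<in> comb (real (N k)) (b k) (\<rho> k)" using x(2) by (auto simp: comb_def algebra_simps)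
  then have "\<bar>(\<Sum>j<N k. ?f (x - x0 + real j * \<alpha>)) - a\<bar> < \<epsilon>" by (rule b[OF k])
  moreover have "(\<Sum>j<N k. ?f (x - x0 + real j * \<alpha>)) = \<sigma> * birkhoff_sum \<alpha> \<phi> (N k) x"
    by (simp add: birkhoff_sum_def sum_distrib_left)
  ultimately have "\<bar>\<sigma> * birkhoff_sum \<alpha> \<phi> (N k) x - a\<bar> < \<epsilon>" by simp
  then have "\<bar>birkhoff_sum \<alpha> \<phi> (N k) x - \<sigma> * a\<bar> < \<epsilon>" using \<sigma> by auto
  then show "\<exists>N. \<exists>p::int. \<exists>x\<in>A. x + (real N * \<alpha> - of_int p) \<in> A \<and> \<bar>birkhoff_sum \<alpha> \<phi> N x - \<sigma> * a\<bar> < \<epsilon>"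
    using x by blast
qed

theorem theorem1:
  "AE \<alpha> in circle. \<forall>(x0::real) \<phi>::real \<Rightarrow> real.
     log_singularity \<phi> x0 \<longrightarrow> (\<integral>x. \<phi> x \<partial>circle) = 0 \<longrightarrow>
     ergodic (circle \<Otimes>\<^sub>M lborel) (cylinder_map \<alpha> \<phi>)"
proof -
  \<comment> \<open>The \<eta> required later varies with the function, its singularity, a and
    \<epsilon>. Taking all 1 / (n + 2) at once yields a single null set valid for every
    choice.\<close>
  have "AE \<alpha> in lborel. \<forall>n. \<not> summable (\<lambda>k. if \<alpha> \<in> well_approx (1 / real (n + 2)) (scale k) then 1 / ln (real (scale k)) else 0)"
  proof (rule AE_all_countable[THEN iffD2], rule allI)
    fix n
    show "AE \<alpha> in lborel. \<not> summable (\<lambda>k. if \<alpha> \<in> well_approx (1 / real (n + 2)) (scale k) then 1 / ln (real (scale k)) else 0)"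
    proof (rule AE_not_summable_well_approx[OF filterlim_scale _ not_summable_inverse_ln_scale])
      show "0 \<le> 1 / ln (real (scale k))" for k using scale_pos[of k] by simp
    qed auto
  qed
  moreover have "AE \<alpha> in lborel. \<alpha> \<notin> (\<rat> :: real set)"
    by (intro AE_not_in countable_imp_null_set_lborel countable_rat)
  ultimately have "AE \<alpha> in lborel. \<forall>x0 \<phi>. log_singularity \<phi> x0 \<longrightarrow> (\<integral>x. \<phi> x \<partial>circle) = 0 \<longrightarrow>
     ergodic (circle \<Otimes>\<^sub>M lborel) (cylinder_map \<alpha> \<phi>)"
  proof eventually_elim
    case (elim \<alpha>)
    show ?case
    proof (intro allI impI)
      fix x0 \<phi>
      assume ls: "log_singularity \<phi> x0" and zero: "(\<integral>x. \<phi> x \<partial>circle) = 0"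
      obtain \<sigma> A C \<delta> where \<sigma>: "\<sigma> = 1 \<or> \<sigma> = -1" and loc:
        "logarithmic_singularity (\<lambda>t. \<sigma> * \<phi> (x0 + t)) (\<lambda>t. \<sigma> * deriv \<phi> (x0 + t)) (\<lambda>t. \<sigma> * deriv (deriv \<phi>) (x0 + t)) A C \<delta>"
        using log_singularity_locale[OF ls zero] by blast
      show "ergodic (circle \<Otimes>\<^sub>M lborel) (cylinder_map \<alpha> \<phi>)"
      proof (rule ergodic_cylinder_map[OF elim(2) _ \<sigma>])
        show "\<phi> (x + 1) = \<phi> x" for x using ls by (simp add: log_singularity_def)
        show "recurrent_along \<alpha> \<phi> (\<sigma> * a)" if "0 < a" for a
          using elim(1) by (intro recurrent_of_well_approximable[OF _ loc \<sigma> that]) blast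
      qed
    qed
  qed
  then show ?thesis
    unfolding circle_def by (subst AE_restrict_space_iff) auto
qed

end
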